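(* Let $j,k$ be coprime integers. For $T>0$ and Borel sets $A\in\mathfrak{B}(H(D))$ define $$P_T(A):=\frac1T\,\mathrm{meas}\{\tau\in[0,T]:\ \zeta(s+ij\tau)-\zeta(s+ik\tau)\in A\},\qquad P(A):=m_H\{\omega\in\Omega:\ \zeta(s,\omega^j)-\zeta(s,\omega^k)\in A\}.$$ Then $P_T$ converges weakly to $P$ as $T\to\infty$.
   Context: $D=\{s\in\mathbb{C}:1/2<\Re(s)<1\}$, and $H(D)$ is the space of analytic functions on $D$ with the topology of uniform convergence on compact subsets; $\mathfrak{B}(\cdot)$ denotes the Borel $\sigma$-algebra. Let $\gamma$ be the unit circle and $\Omega=\prod_p\gamma(p)$ with $\gamma(p)=\gamma$ for every prime $p$, a compact abelian group under the product topology and pointwise multiplication, with probability Haar measure $m_H$. For $\omega\in\Omega$ let $\omega(p)$ be its $p$-th coordinate, $\omega(1)=1$, and $\omega(n)=\prod_p\omega(p)^{v(n;p)}$ where $v(n;p)$ is the exponent of $p$ in $n$. For an integer $m$, $\omega^m$ denotes the element with coordinates $\omega(p)^m$. Define $\zeta(s,\omega)=\sum_{n\ge1}\omega(n)n^{-s}$; for $m_H$-almost all $\omega$ this series (for $\omega^j$ and $\omega^k$) converges uniformly on compact subsets of $D$, so $\zeta(s,\omega^j)-\zeta(s,\omega^k)$ is an $H(D)$-valued random element. $\mathrm{meas}$ is Lebesgue measure.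
   Formalization: The integers j and k are assumed nonzero: for j=0 or k=0 the series ζ(s,ω^0)=Σ n^{-s} diverges at every point of D, so the limit measure P is not defined there. *)

theory Defs
  imports "HOL-Probability.Probability"
begin

text \<open>The Riemann zeta function, as the analytic continuation of its Dirichlet series to
  \<open>\<complex> - {1}\<close>. The value \<open>0\<close> at the pole is an arbitrary convention making the description unique.\<close>

definition riemann_zeta :: "complex \<Rightarrow> complex" where
  "riemann_zeta = (THE f. f holomorphic_on (- {1}) \<and>
     (\<forall>s. Re s > 1 \<longrightarrow> (\<lambda>n. of_nat (Suc n) powr (- s)) sums f s) \<and> f 1 = 0)"

definition strip :: "complex set" where
  "strip = {s. 1/2 < Re s \<and> Re s < 1}"

text \<open>The space \<open>H(D)\<close>: a function on \<open>D\<close> is represented by its extensional representative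
  (value \<open>undefined\<close> off \<open>D\<close>), so that equality of elements is equality on \<open>D\<close>.\<close>

definition analytic_functions :: "complex set \<Rightarrow> (complex \<Rightarrow> complex) set" where
  "analytic_functions D = {f \<in> extensional D. f analytic_on D}"

definition compact_convergence_open ::
    "complex set \<Rightarrow> (complex \<Rightarrow> complex) set \<Rightarrow> bool" where
  "compact_convergence_open D U \<longleftrightarrow> U \<subseteq> analytic_functions D \<and>
     (\<forall>f\<in>U. \<exists>K \<epsilon>. compact K \<and> K \<subseteq> D \<and> \<epsilon> > 0 \<and>
        {g \<in> analytic_functions D. \<forall>z\<in>K. dist (f z) (g z) < \<epsilon>} \<subseteq> U)"

definition hol_space :: "complex set \<Rightarrow> (complex \<Rightarrow> complex) topology" where
  "hol_space D = topology (compact_convergence_open D)"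

lemma istopology_compact_convergence: "istopology (compact_convergence_open D)"
  unfolding istopology_def
proof (intro conjI allI impI)
  fix S T
  assume S: "compact_convergence_open D S" and T: "compact_convergence_open D T"
  have "\<exists>K \<epsilon>. compact K \<and> K \<subseteq> D \<and> \<epsilon> > 0 \<and>
          {g \<in> analytic_functions D. \<forall>z\<in>K. dist (f z) (g z) < \<epsilon>} \<subseteq> S \<inter> T"
    if f: "f \<in> S \<inter> T" for f
  proof -
    obtain K1 e1 where 1: "compact K1" "K1 \<subseteq> D" "e1 > 0"
      "{g \<in> analytic_functions D. \<forall>z\<in>K1. dist (f z) (g z) < e1} \<subseteq> S"
      using S f unfolding compact_convergence_open_def by blast
    obtain K2 e2 where 2: "compact K2" "K2 \<subseteq> D" "e2 > 0"
      "{g \<in> analytic_functions D. \<forall>z\<in>K2. dist (f z) (g z) < e2} \<subseteq> T"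
      using T f unfolding compact_convergence_open_def by blast
    show ?thesis
    proof (intro exI conjI)
      show "compact (K1 \<union> K2)" "K1 \<union> K2 \<subseteq> D" "min e1 e2 > 0"
        using 1 2 by auto
      show "{g \<in> analytic_functions D. \<forall>z\<in>K1 \<union> K2. dist (f z) (g z) < min e1 e2} \<subseteq> S \<inter> T"
        using 1(4) 2(4) by auto
    qed
  qed
  then show "compact_convergence_open D (S \<inter> T)"
    using S T unfolding compact_convergence_open_def by blast
next
  fix \<K>
  assume K: "\<forall>S\<in>\<K>. compact_convergence_open D S"
  have sub: "\<Union>\<K> \<subseteq> analytic_functions D"
    using K unfolding compact_convergence_open_def by blast
  have "\<exists>K \<epsilon>. compact K \<and> K \<subseteq> D \<and> \<epsilon> > 0 \<and>
          {g \<in> analytic_functions D. \<forall>z\<in>K. dist (f z) (g z) < \<epsilon>} \<subseteq> \<Union>\<K>"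
    if "f \<in> \<Union>\<K>" for f
  proof -
    obtain S where S: "S \<in> \<K>" "f \<in> S"
      using \<open>f \<in> \<Union>\<K>\<close> by blast
    have "compact_convergence_open D S"
      using K S(1) by auto
    with S(2) obtain K \<epsilon> where "compact K" "K \<subseteq> D" "\<epsilon> > 0"
      "{g \<in> analytic_functions D. \<forall>z\<in>K. dist (f z) (g z) < \<epsilon>} \<subseteq> S"
      unfolding compact_convergence_open_def by auto
    moreover have "S \<subseteq> \<Union>\<K>"
      using S(1) by auto
    ultimately show ?thesis
      by (intro exI[of _ K] exI[of _ \<epsilon>]) auto
  qed
  with sub show "compact_convergence_open D (\<Union>\<K>)"
    unfolding compact_convergence_open_def by blast
qed

lemma openin_hol_space: "openin (hol_space D) U \<longleftrightarrow> compact_convergence_open D U"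
  unfolding hol_space_def using istopology_compact_convergence
  by (simp add: topology_inverse')

lemma topspace_hol_space: "topspace (hol_space D) = analytic_functions D"
proof
  show "topspace (hol_space D) \<subseteq> analytic_functions D"
    using openin_topspace[of "hol_space D"]
    unfolding openin_hol_space compact_convergence_open_def by blast
  have "compact_convergence_open D (analytic_functions D)"
    unfolding compact_convergence_open_def
  proof (intro conjI ballI)
    fix f
    show "\<exists>K \<epsilon>. compact K \<and> K \<subseteq> D \<and> \<epsilon> > 0 \<and>
        {g \<in> analytic_functions D. \<forall>z\<in>K. dist (f z) (g z) < \<epsilon>} \<subseteq> analytic_functions D"
      by (intro exI[of _ "{}"] exI[of _ 1]) auto
  qed simp
  then show "analytic_functions D \<subseteq> topspace (hol_space D)"
    by (simp add: openin_hol_space openin_subset)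
qed

definition borel_of :: "'a topology \<Rightarrow> 'a measure" where
  "borel_of X = sigma (topspace X) {U. openin X U}"

definition weakly_converges ::
    "'a topology \<Rightarrow> ('b \<Rightarrow> 'a measure) \<Rightarrow> 'a measure \<Rightarrow> 'b filter \<Rightarrow> bool" where
  "weakly_converges X M L F \<longleftrightarrow>
     (\<forall>g. continuous_map X euclideanreal g \<and> bounded (g ` topspace X) \<longrightarrow>
        ((\<lambda>t. \<integral>x. g x \<partial>M t) \<longlongrightarrow> (\<integral>x. g x \<partial>L)) F)"

text \<open>The compact group \<open>\<Omega>\<close>, a product of unit circles indexed by the primes.\<close>

definition Omega_top :: "(nat \<Rightarrow> complex) topology" where
  "Omega_top = product_topology (\<lambda>p. top_of_set (sphere 0 1)) {p. prime p}"

definition Omega_mult :: "(nat \<Rightarrow> complex) \<Rightarrow> (nat \<Rightarrow> complex) \<Rightarrow> (nat \<Rightarrow> complex)" where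
  "Omega_mult \<alpha> \<omega> = (\<lambda>p\<in>{p. prime p}. \<alpha> p * \<omega> p)"

definition Omega_power :: "(nat \<Rightarrow> complex) \<Rightarrow> int \<Rightarrow> (nat \<Rightarrow> complex)" where
  "Omega_power \<omega> m = (\<lambda>p\<in>{p. prime p}. \<omega> p powi m)"

definition Omega_haar_prob :: "(nat \<Rightarrow> complex) measure \<Rightarrow> bool" where
  "Omega_haar_prob M \<longleftrightarrow> prob_space M \<and> sets M = sets (borel_of Omega_top) \<and>
     (\<forall>\<alpha>\<in>topspace Omega_top. \<forall>A\<in>sets M. emeasure M (Omega_mult \<alpha> ` A) = emeasure M A)"

definition Omega_ext :: "(nat \<Rightarrow> complex) \<Rightarrow> nat \<Rightarrow> complex" where
  "Omega_ext \<omega> n = (\<Prod>p\<in>prime_factors n. \<omega> p ^ multiplicity p n)"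

definition random_zeta_term :: "(nat \<Rightarrow> complex) \<Rightarrow> nat \<Rightarrow> complex \<Rightarrow> complex" where
  "random_zeta_term \<omega> n s = Omega_ext \<omega> n * of_nat n powr (- s)"

definition random_zeta :: "complex \<Rightarrow> (nat \<Rightarrow> complex) \<Rightarrow> complex" where
  "random_zeta s \<omega> = (\<Sum>n. random_zeta_term \<omega> (Suc n) s)"

definition random_zeta_converges :: "(nat \<Rightarrow> complex) \<Rightarrow> bool" where
  "random_zeta_converges \<omega> \<longleftrightarrow> (\<forall>K. compact K \<and> K \<subseteq> strip \<longrightarrow>
     uniformly_convergent_on K (\<lambda>N s. \<Sum>n=1..N. random_zeta_term \<omega> n s))"

text \<open>The random element \<open>\<zeta>(s, \<omega>\<^sup>j) - \<zeta>(s, \<omega>\<^sup>k)\<close> is only defined almost everywhere;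
  on the exceptional set where one of the series fails to converge it is set to \<open>0\<close>.\<close>

definition zeta_diff_random ::
    "int \<Rightarrow> int \<Rightarrow> (nat \<Rightarrow> complex) \<Rightarrow> (complex \<Rightarrow> complex)" where
  "zeta_diff_random j k \<omega> =
     (if random_zeta_converges (Omega_power \<omega> j) \<and> random_zeta_converges (Omega_power \<omega> k)
      then (\<lambda>s\<in>strip. random_zeta s (Omega_power \<omega> j) - random_zeta s (Omega_power \<omega> k))
      else (\<lambda>s\<in>strip. 0))"

definition zeta_diff_shift :: "int \<Rightarrow> int \<Rightarrow> real \<Rightarrow> (complex \<Rightarrow> complex)" where
  "zeta_diff_shift j k \<tau> =
     (\<lambda>s\<in>strip. riemann_zeta (s + \<i> * of_int j * of_real \<tau>) -
               riemann_zeta (s + \<i> * of_int k * of_real \<tau>))"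

text \<open>\<open>P\<^sub>T(A)\<close> is \<open>1/T\<close> times the Lebesgue measure of the \<open>\<tau> \<in> [0,T]\<close> whose shift lies in \<open>A\<close>:
  the image of the uniform distribution on \<open>[0,T]\<close>.\<close>

definition P_T :: "int \<Rightarrow> int \<Rightarrow> real \<Rightarrow> (complex \<Rightarrow> complex) measure" where
  "P_T j k T = distr (uniform_measure lborel {0..T}) (borel_of (hol_space strip))
                 (zeta_diff_shift j k)"

definition P_lim ::
    "(nat \<Rightarrow> complex) measure \<Rightarrow> int \<Rightarrow> int \<Rightarrow> (complex \<Rightarrow> complex) measure" where
  "P_lim m\<^sub>H j k = distr m\<^sub>H (borel_of (hol_space strip)) (zeta_diff_random j k)"

end

theory Submission
  imports Defs "HOL-Complex_Analysis.Complex_Analysis"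
begin

text \<open>
  Write \<open>\<omega>\<^sub>\<tau> = (p\<^bsup>-i\<tau>\<^esup>)\<^sub>p\<close>. The partial sums of \<open>\<zeta>(s + ij\<tau>) - \<zeta>(s + ik\<tau>)\<close> are the values at \<open>\<omega>\<^sub>\<tau>\<close> of
  the continuous map that sends \<open>\<omega>\<close> to the partial sum of \<open>\<zeta>(s, \<omega>\<^sup>j) - \<zeta>(s, \<omega>\<^sup>k)\<close>, and the line \<open>\<omega>\<^sub>\<tau>\<close> is
  equidistributed in the torus: by Stone--Weierstrass it suffices to test characters, whose means
  are those of \<open>(m/n)\<^bsup>-i\<tau>\<^esup>\<close>. So the theorem holds for partial sums. The second moment of the remaining tail is
  \<open>O(\<Sum>\<^sub>n\<^sub>>\<^sub>N n\<^bsup>-2\<sigma>\<^esup>) + o(1)\<close> on both sides: for the shifts by a mean value theorem for Dirichlet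
  polynomials, for the random series by orthogonality (its almost sure convergence is the
  Rademacher--Menshov theorem). Cauchy's formula turns moments at points into bounds on compact sets, and
  Montel's theorem gives the tightness needed to pass from partial sums to the full functions
  under an arbitrary bounded continuous functional.
\<close>

section \<open>Analytic continuation of the zeta function\<close>

text \<open>No constant is uniform over the strip: the tails of n^(-2a) blow up as a tends to 1/2
  and the pole term as b tends to 1. Estimates are therefore made on
  \<open>a \<le> Re s \<le> b\<close>, and each compact set of an exhaustion carries its own
  constants. The mean value theorem is a crude one, with weight n^(1+\<delta>) where Montgomery and
  Vaughan have n. The loss is affordable because a > 1/2 leaves room for a \<delta> depending on a.
  No functional equation enters: the approximation of zeta by partial sums comes from the same
  Taylor expansion as the continuation, carried to an order m that depends on a. Tightness is used
  without Prokhorov's theorem and without a metric on H(D). For one functional g, radii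
  \<open>R l\<close> are chosen so that the full function violates the bound \<open>R l\<close> on
  \<open>K l\<close> for some l only with small probability; on the functions obeying these bounds g
  is uniformly continuous. The shifted and the random function are compared with the same partial
  sum, and both powers of \<omega> are read off one point of the torus, so their joint law needs no
  separate argument.\<close>

lemma powr_taylor_bound:
  fixes a :: complex and x :: real
  assumes "0 \<le> x" "x \<le> 1" "Re a \<le> Suc m"
  shows "norm ((1 + of_real x) powr a - (\<Sum>k\<le>m. (a gchoose k) * of_real x ^ k))
         \<le> (\<Prod>i\<le>m. norm (a - of_nat i)) * x ^ Suc m"
proof -
  define f where "f = (\<lambda>(i::nat) (z::complex). (\<Prod>j<i. a - of_nat j) * (1 + z) powr (a - of_nat i))"
  define S where "S = closed_segment (0::complex) 1"
  have S: "\<exists>u\<ge>0. u \<le> 1 \<and> z = of_real u" if "z \<in> S" for z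
    using that by (auto simp: S_def closed_segment_def scaleR_conv_of_real)
  have "norm (f 0 (of_real x) - (\<Sum>i\<le>m. f i 0 * (of_real x - 0) ^ i / fact i))
      \<le> (\<Prod>i\<le>m. norm (a - of_nat i)) * norm (of_real x - 0 :: complex) ^ Suc m / fact m"
  proof (rule complex_Taylor[where S = S])
    show "convex S" "0 \<in> S" unfolding S_def by auto
    show "of_real x \<in> S"
      using assms unfolding S_def by (auto simp: closed_segment_def scaleR_conv_of_real)
  next
    fix i z assume "z \<in> S"
    then obtain u where u: "u \<ge> 0" "z = of_real u" using S by blast
    have "1 + z \<notin> \<real>\<^sub>\<le>\<^sub>0" using u by (auto simp: complex_nonpos_Reals_iff)
    then show "(f i has_field_derivative f (Suc i) z) (at z within S)"
      unfolding f_def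
      by (auto intro!: derivative_eq_intros simp: algebra_simps)
  next
    fix z assume "z \<in> S"
    then obtain u where u: "u \<ge> 0" "z = of_real u" using S by blast
    have "norm ((1 + z) powr (a - of_nat (Suc m))) = (1 + u) powr (Re a - Suc m)"
      using u by (subst norm_powr_real_powr) auto
    \<comment> \<open>This is where the bound on \<open>Re a\<close> enters: the power left in the
      derivative of order m+1 has nonpositive real exponent, so only the product of the factors a -
      i survives. The product is kept unexpanded because for a = 1 - s its factor i = 0 later
      cancels the pole.\<close>
    also have "\<dots> \<le> (1 + u) powr 0" using u assms by (intro powr_mono) auto
    finally have "norm ((1 + z) powr (a - of_nat (Suc m))) \<le> 1" using u by simp
    then show "norm (f (Suc m) z) \<le> (\<Prod>i\<le>m. norm (a - of_nat i))"
      unfolding f_def norm_mult prod_norm lessThan_Suc_atMost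
      by (intro mult_left_le) auto
  qed
  also have "\<dots> \<le> (\<Prod>i\<le>m. norm (a - of_nat i)) * x ^ Suc m"
  proof -
    have "(\<Prod>i\<le>m. norm (a - of_nat i)) * x ^ Suc m / fact m
       \<le> (\<Prod>i\<le>m. norm (a - of_nat i)) * x ^ Suc m / 1"
      using assms by (intro divide_left_mono mult_nonneg_nonneg prod_nonneg) auto
    then show ?thesis using assms by simp
  qed
  finally show ?thesis
    by (simp add: f_def gbinomial_prod_rev atLeast0LessThan)
qed

text \<open>The error of order m in the binomial expansion of (n+1)^(1-s). The power n^(1-s) is
  factored out so that the Taylor bound on [0,1] applies at x = 1/n.\<close>

definition zeta_rem :: "nat \<Rightarrow> complex \<Rightarrow> nat \<Rightarrow> complex" where
  "zeta_rem m s n = of_nat n powr (1 - s) *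
     ((1 + of_real (1 / real n)) powr (1 - s) - (\<Sum>k\<le>m. ((1 - s) gchoose k) * of_real (1 / real n) ^ k))"

lemma norm_zeta_rem_le:
  assumes "n \<ge> 1" "- Re s \<le> real m"
  shows "norm (zeta_rem m s n) \<le> (\<Prod>i\<le>m. norm (1 - s - of_nat i)) * real n powr (- Re s - real m)"
proof -
  have "norm (zeta_rem m s n) = real n powr (1 - Re s) *
    norm ((1 + of_real (1 / real n)) powr (1 - s) - (\<Sum>k\<le>m. ((1 - s) gchoose k) * of_real (1 / real n) ^ k))"
    using assms by (simp add: zeta_rem_def norm_mult norm_powr_real_powr)
  also have "\<dots> \<le> real n powr (1 - Re s) * ((\<Prod>i\<le>m. norm (1 - s - of_nat i)) * (1 / real n) ^ Suc m)"
    using assms by (intro mult_left_mono powr_taylor_bound) auto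
  also have "(1 / real n) ^ Suc m = real n powr (- real (Suc m))"
    using assms powr_realpow[of "real n" "Suc m"] by (simp only: powr_minus) (simp add: field_simps)
  also have "real n powr (1 - Re s) * ((\<Prod>i\<le>m. norm (1 - s - of_nat i)) * real n powr (- real (Suc m)))
     = (\<Prod>i\<le>m. norm (1 - s - of_nat i)) * (real n powr (1 - Re s) * real n powr (- real (Suc m)))"
    by simp
  also have "real n powr (1 - Re s) * real n powr (- real (Suc m)) = real n powr (- Re s - real m)"
    by (simp add: powr_add[symmetric])
  finally show ?thesis .
qed

text \<open>Taylor expansion of \<open>(n+1)\<^bsup>1-s\<^esup>\<close> around \<open>n\<close> makes \<open>(s-1) n\<^bsup>-s\<^esup>\<close> a telescoping term plus
  terms with larger exponents; summed over \<open>n\<close>, this continues \<open>(s-1) \<zeta>(s)\<close> one unit to the left at a time.\<close>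

lemma zeta_term_decomposition:
  assumes "n \<ge> 1" "m \<ge> 1"
  shows "(s - 1) * of_nat n powr (- s) = of_nat n powr (1 - s) - of_nat (Suc n) powr (1 - s)
     + (\<Sum>k=2..m. ((1 - s) gchoose k) * of_nat n powr (1 - s - of_nat k)) + zeta_rem m s n"
proof -
  have pw: "of_nat n powr (1 - s) * of_real (1 / real n) ^ k = (of_nat n :: complex) powr (1 - s - of_nat k)" for k
    using assms by (simp add: powr_diff powr_nat power_divide)
  have "of_nat n powr (1 - s) * (1 + of_real (1 / real n)) powr (1 - s) = (of_nat n * (1 + of_real (1 / real n))) powr (1 - s)"
    by (subst powr_times_real) auto
  also have "of_nat n * (1 + of_real (1 / real n)) = (of_nat (Suc n) :: complex)"
    using assms by (simp add: field_simps)
  finally have "zeta_rem m s n = of_nat (Suc n) powr (1 - s)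
      - (\<Sum>k\<le>m. ((1 - s) gchoose k) * (of_nat n powr (1 - s) * of_real (1 / real n) ^ k))"
    by (simp add: zeta_rem_def right_diff_distrib sum_distrib_left mult_ac)
  also have "(\<Sum>k\<le>m. ((1 - s) gchoose k) * (of_nat n powr (1 - s) * of_real (1 / real n) ^ k))
      = (\<Sum>k\<le>m. ((1 - s) gchoose k) * of_nat n powr (1 - s - of_nat k))"
    by (simp only: pw)
  also have "{..m} = insert 0 (insert 1 {2..m})" using assms by auto
  finally show ?thesis by (simp add: algebra_simps)
qed

section \<open>Holomorphy of the tail and remainder series\<close>

lemma holomorphic_suminf:
  fixes f :: "nat \<Rightarrow> complex \<Rightarrow> complex"
  assumes "open S" "\<And>n. f n holomorphic_on S"
    and "\<And>x. x \<in> S \<Longrightarrow> \<exists>d>0. \<exists>M. cball x d \<subseteq> S \<and> summable M \<and> (\<forall>n. \<forall>z\<in>cball x d. norm (f n z) \<le> M n)"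
  shows "(\<lambda>z. \<Sum>n. f n z) holomorphic_on S"
proof (rule holomorphic_uniform_sequence[OF assms(1), where f = "\<lambda>N z. \<Sum>n<N. f n z"])
  show "(\<lambda>z. \<Sum>n<N. f n z) holomorphic_on S" for N
    by (intro holomorphic_on_sum assms(2))
  fix x assume "x \<in> S"
  then obtain d M where "d > 0" and dM: "cball x d \<subseteq> S \<and> summable M \<and> (\<forall>n. \<forall>z\<in>cball x d. norm (f n z) \<le> M n)"
    using assms(3)[OF \<open>x \<in> S\<close>] by (elim exE conjE) simp
  then show "\<exists>d>0. cball x d \<subseteq> S \<and> uniform_limit (cball x d) (\<lambda>N z. \<Sum>n<N. f n z) (\<lambda>z. \<Sum>n. f n z) sequentially"
    by (intro exI[of _ d] conjI Weierstrass_m_test[where M = M]) simp_all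
qed

lemma summable_shift_powr:
  assumes "q < -1"
  shows "summable (\<lambda>n. real (n + N) powr q)"
  using summable_ignore_initial_segment[of "\<lambda>n. real n powr q" N] assms by (simp add: summable_real_powr_iff)

lemma Re_ge_if_cball: "z \<in> cball x d \<Longrightarrow> Re z \<ge> Re x - d"
  using abs_Re_le_cmod[of "x - z"] by (auto simp: dist_norm)

lemma norm_le_if_cball: "z \<in> cball x d \<Longrightarrow> norm z \<le> norm x + d" for x :: complex
  using norm_triangle_ineq4[of x "x - z"] by (auto simp: dist_norm)

lemma norm_nat_powr: "n \<ge> 1 \<Longrightarrow> norm ((of_nat n :: complex) powr s) = real n powr Re s"
  by (subst norm_powr_real_powr) auto

lemma zeta_tail_summable:
  assumes "N \<ge> 1" "Re s < -1"
  shows "summable (\<lambda>n. (of_nat (n + N) :: complex) powr s)" "summable (\<lambda>n. norm ((of_nat (n + N) :: complex) powr s))"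
proof -
  show *: "summable (\<lambda>n. norm ((of_nat (n + N) :: complex) powr s))"
    using summable_shift_powr[OF assms(2), of N] assms by (subst norm_nat_powr) auto
  show "summable (\<lambda>n. (of_nat (n + N) :: complex) powr s)"
    by (rule summable_norm_cancel[OF *])
qed

lemma zeta_tail_holomorphic:
  assumes "N \<ge> 1"
  shows "(\<lambda>s. \<Sum>n. (of_nat (n + N) :: complex) powr (1 - s - of_nat k)) holomorphic_on {s. Re s > 2 - real k}"
proof (rule holomorphic_suminf)
  show "open {s. Re s > 2 - real k}" by (simp add: open_halfspace_Re_gt)
  fix x assume x: "x \<in> {s. Re s > 2 - real k}"
  define d where "d = (Re x - (2 - real k)) / 2"
  have d: "d > 0" using x by (simp add: d_def)
  have sub: "Re z > 2 - real k" if "z \<in> cball x d" for z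
    using Re_ge_if_cball[OF that] d by (auto simp: d_def field_simps)
  show "\<exists>d>0. \<exists>M. cball x d \<subseteq> {s. Re s > 2 - real k} \<and> summable M \<and>
    (\<forall>n. \<forall>z\<in>cball x d. norm ((of_nat (n + N) :: complex) powr (1 - z - of_nat k)) \<le> M n)"
  proof (intro exI[of _ d] exI[of _ "\<lambda>n. real (n + N) powr (1 - (Re x - d) - real k)"] conjI allI ballI)
    show "summable (\<lambda>n. real (n + N) powr (1 - (Re x - d) - real k))"
      using d by (intro summable_shift_powr) (auto simp: d_def field_simps)
    fix n z assume "z \<in> cball x d"
    then show "norm ((of_nat (n + N) :: complex) powr (1 - z - of_nat k)) \<le> real (n + N) powr (1 - (Re x - d) - real k)"
      using Re_ge_if_cball[of z x d] assms by (subst norm_nat_powr) (auto intro!: powr_mono)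
  qed (use sub d in auto)
qed (intro holomorphic_intros)

text \<open>The exponent -Re s - m reaches -1 exactly on the line Re s = 1 - m. A ball of half the
  distance to that line keeps the exponent below -1 uniformly, which yields one summable
  majorant.\<close>

lemma zeta_rem_local_bound:
  assumes "N \<ge> 1" "Re x > 1 - real m"
  shows "\<exists>d>0. \<exists>M. cball x d \<subseteq> {s. Re s > 1 - real m} \<and> summable M \<and>
      (\<forall>n. \<forall>z\<in>cball x d. norm (zeta_rem m z (n + N)) \<le> M n)"
proof -
  define d where "d = (Re x - (1 - real m)) / 2"
  have d: "d > 0" using assms by (simp add: d_def)
  have sub: "Re z > 1 - real m" if "z \<in> cball x d" for z
    using Re_ge_if_cball[OF that] d by (auto simp: d_def field_simps)
  define C where "C = (norm x + d + 1 + real m) ^ Suc m"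
  define M where "M = (\<lambda>n. C * real (n + N) powr (- (Re x - d) - real m))"
  have C: "C \<ge> 0" using d by (simp add: C_def)
  show ?thesis
  proof (intro exI[of _ d] exI[of _ M] conjI allI ballI)
    show "d > 0" by fact
    show "cball x d \<subseteq> {s. Re s > 1 - real m}" using sub by auto
    show "summable M"
      unfolding M_def using d by (intro summable_mult summable_shift_powr) (auto simp: d_def field_simps)
    fix n z assume z: "z \<in> cball x d"
    have "norm (zeta_rem m z (n + N)) \<le> (\<Prod>i\<le>m. norm (1 - z - of_nat i)) * real (n + N) powr (- Re z - real m)"
      using assms sub[OF z] by (intro norm_zeta_rem_le) auto
    also have "\<dots> \<le> C * real (n + N) powr (- (Re x - d) - real m)"
    proof (intro mult_mono C powr_mono)
      have "(\<Prod>i\<le>m. norm (1 - z - of_nat i)) \<le> (\<Prod>i\<le>m. norm x + d + 1 + real m)"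
      proof (intro prod_mono conjI)
        fix i assume "i \<in> {..m}"
        have "norm (1 - z - of_nat i) \<le> norm (1 - z) + norm (of_nat i :: complex)"
          by (rule norm_triangle_ineq4)
        also have "norm (1 - z) \<le> norm (1::complex) + norm z"
          by (rule norm_triangle_ineq4)
        finally have "norm (1 - z - of_nat i) \<le> norm (1::complex) + norm z + norm (of_nat i :: complex)"
          by simp
        then show "norm (1 - z - of_nat i) \<le> norm x + d + 1 + real m"
          using norm_le_if_cball[OF z] \<open>i \<in> {..m}\<close> by auto
      qed auto
      then show "(\<Prod>i\<le>m. norm (1 - z - of_nat i)) \<le> C" by (simp add: C_def)
      show "- Re z - real m \<le> - (Re x - d) - real m" using Re_ge_if_cball[OF z] by simp
    qed (use assms in auto)
    finally show "norm (zeta_rem m z (n + N)) \<le> M n" by (simp add: M_def)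
  qed
qed

lemma gchoose_holomorphic [holomorphic_intros]:
  assumes "f holomorphic_on S"
  shows "(\<lambda>z. f z gchoose k) holomorphic_on S"
  unfolding gbinomial_prod_rev by (auto intro!: holomorphic_intros assms)

lemma zeta_rem_holomorphic: "n \<ge> 1 \<Longrightarrow> (\<lambda>s. zeta_rem m s n) holomorphic_on S"
  unfolding zeta_rem_def by (intro holomorphic_intros)

lemma zeta_rem_suminf_holomorphic:
  assumes "N \<ge> 1"
  shows "(\<lambda>s. \<Sum>n. zeta_rem m s (n + N)) holomorphic_on {s. Re s > 1 - real m}"
proof (rule holomorphic_suminf)
  show "open {s. Re s > 1 - real m}" by (simp add: open_halfspace_Re_gt)
  show "(\<lambda>s. zeta_rem m s (n + N)) holomorphic_on {s. Re s > 1 - real m}" for n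
    using assms by (intro zeta_rem_holomorphic) auto
  fix x assume "x \<in> {s. Re s > 1 - real m}"
  then show "\<exists>d>0. \<exists>M. cball x d \<subseteq> {s. Re s > 1 - real m} \<and> summable M \<and>
      (\<forall>n. \<forall>z\<in>cball x d. norm (zeta_rem m z (n + N)) \<le> M n)"
    by (intro zeta_rem_local_bound assms) simp
qed

lemma zeta_rem_summable:
  assumes "N \<ge> 1" "Re s > 1 - real m"
  shows "summable (\<lambda>n. zeta_rem m s (n + N))"
proof -
  obtain d M where d: "d > 0" "summable M" "\<forall>n. \<forall>z\<in>cball s d. norm (zeta_rem m z (n + N)) \<le> M n"
    using zeta_rem_local_bound[OF assms] by (elim exE conjE) simp
  show ?thesis using d by (intro summable_comparison_test'[OF d(2), of 0]) auto
qed

text \<open>Summation of the termwise decomposition: the differences telescope to N^(1-s), because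
  n^(1-s) tends to 0 for Re s > 1. The case N = 1 drives the continuation, general N the
  approximation by partial sums.\<close>

lemma zeta_tail_identity:
  assumes "N \<ge> 1" "m \<ge> 1" "Re s > 1"
  shows "(s - 1) * (\<Sum>n. (of_nat (n + N) :: complex) powr (- s)) = of_nat N powr (1 - s)
    + (\<Sum>k=2..m. ((1 - s) gchoose k) * (\<Sum>n. (of_nat (n + N) :: complex) powr (1 - s - of_nat k)))
    + (\<Sum>n. zeta_rem m s (n + N))"
proof -
  let ?f = "\<lambda>n. (of_nat (n + N) :: complex) powr (1 - s)"
  have "(\<lambda>n. real (n + N) powr (1 - Re s)) \<longlonglongrightarrow> 0"
    by (rule LIMSEQ_ignore_initial_segment[where f = "\<lambda>n. real n powr (1 - Re s)"])
       (rule tendsto_neg_powr, use assms filterlim_real_sequentially in auto)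
  then have "(\<lambda>n. norm (?f n)) \<longlonglongrightarrow> 0"
    using assms by (subst norm_nat_powr) auto
  then have "?f \<longlonglongrightarrow> 0" by (rule tendsto_norm_zero_cancel)
  from telescope_sums'[OF this]
  have 1: "(\<lambda>n. (of_nat (n + N) :: complex) powr (1 - s) - of_nat (Suc (n + N)) powr (1 - s)) sums (of_nat N powr (1 - s))"
    by simp
  have 2: "(\<lambda>n. \<Sum>k=2..m. ((1 - s) gchoose k) * (of_nat (n + N) :: complex) powr (1 - s - of_nat k))
     sums (\<Sum>k=2..m. ((1 - s) gchoose k) * (\<Sum>n. (of_nat (n + N) :: complex) powr (1 - s - of_nat k)))"
    by (intro sums_sum sums_mult summable_sums zeta_tail_summable) (use assms in auto)
  have 3: "(\<lambda>n. zeta_rem m s (n + N)) sums (\<Sum>n. zeta_rem m s (n + N))"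
    by (intro summable_sums zeta_rem_summable) (use assms in auto)
  have "(\<lambda>n. (s - 1) * (of_nat (n + N) :: complex) powr (- s)) sums (of_nat N powr (1 - s)
    + (\<Sum>k=2..m. ((1 - s) gchoose k) * (\<Sum>n. (of_nat (n + N) :: complex) powr (1 - s - of_nat k)))
    + (\<Sum>n. zeta_rem m s (n + N)))"
    using sums_add[OF sums_add[OF 1 2] 3] assms zeta_term_decomposition[of "n + N" m s for n] by (simp del: of_nat_add)
  moreover have "(\<lambda>n. (s - 1) * (of_nat (n + N) :: complex) powr (- s)) sums ((s - 1) * (\<Sum>n. (of_nat (n + N) :: complex) powr (- s)))"
    by (intro sums_mult summable_sums zeta_tail_summable) (use assms in auto)
  ultimately show ?thesis using sums_unique2 by blast
qed


section \<open>Continuation by unit steps and identification with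
  \<open>riemann_zeta\<close>\<close>

text \<open>With s' = s + k - 1 the factor \<open>s + of_nat k - 2\<close> is s' - 1, just what
  turns the Dirichlet series at s' into (s' - 1) zeta(s'). Thus the poles of the shifted zeta
  functions are absorbed by the binomial coefficients.\<close>

lemma gchoose_Suc_factor:
  fixes s :: complex
  assumes "k \<ge> 1"
  shows "((1 - s) gchoose k) = - ((\<Prod>i<k-1. 1 - s - of_nat i) / fact k) * (s + of_nat k - 2)"
proof -
  obtain l where l: "k = Suc l" using assms by (cases k) auto
  have e: "1 - s - of_nat l = - (s + of_nat (Suc l) - 2)" by simp
  have "P * (- Q) / F = - (P / F) * Q" for P Q F :: complex by simp
  then show ?thesis by (simp only: l gbinomial_prod_rev atLeast0LessThan diff_Suc_1 prod.lessThan_Suc e)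
qed

text \<open>Z plays the role of (s - 1) zeta(s). In the tail identity for N = 1, where N^(1-s) is 1,
  the terms k \<ge> 2 only involve Z at s + k - 1, at least one unit to the right, hence inside the
  half-plane where Z is already holomorphic.\<close>

lemma zeta_continuation_step:
  assumes "Z holomorphic_on {s. Re s > 1 - real m}"
    and "\<And>s. Re s > 1 \<Longrightarrow> Z s = (s - 1) * (\<Sum>n. (of_nat (Suc n) :: complex) powr (- s))"
  shows "\<exists>Z. Z holomorphic_on {s. Re s > 1 - real (Suc m)} \<and>
     (\<forall>s. Re s > 1 \<longrightarrow> Z s = (s - 1) * (\<Sum>n. (of_nat (Suc n) :: complex) powr (- s)))"
proof -
  define Z' where "Z' = (\<lambda>s. 1 + (\<Sum>k=2..Suc m. - ((\<Prod>i<k-1. 1 - s - of_nat i) / fact k) * Z (s + of_nat k - 1))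
      + (\<Sum>n. zeta_rem (Suc m) s (n + 1)))"
  have "Z' holomorphic_on {s. Re s > 1 - real (Suc m)}"
    unfolding Z'_def
  proof (intro holomorphic_on_add holomorphic_on_const holomorphic_on_sum holomorphic_on_mult)
    show "(\<lambda>s. \<Sum>n. zeta_rem (Suc m) s (n + 1)) holomorphic_on {s. Re s > 1 - real (Suc m)}"
      by (rule zeta_rem_suminf_holomorphic) simp
    fix k assume k: "k \<in> {2..Suc m}"
    show "(\<lambda>s. - ((\<Prod>i<k-1. 1 - s - of_nat i) / fact k)) holomorphic_on {s. Re s > 1 - real (Suc m)}"
      by (auto intro!: holomorphic_intros)
    have "(Z \<circ> (\<lambda>s. s + of_nat k - 1)) holomorphic_on {s. Re s > 1 - real (Suc m)}"
      by (rule holomorphic_on_compose_gen[OF _ assms(1)]) (use k in \<open>auto intro!: holomorphic_intros\<close>)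
    then show "(\<lambda>s. Z (s + of_nat k - 1)) holomorphic_on {s. Re s > 1 - real (Suc m)}"
      by (simp add: o_def)
  qed
  moreover have "Z' s = (s - 1) * (\<Sum>n. (of_nat (Suc n) :: complex) powr (- s))" if s: "Re s > 1" for s
  proof -
    have "- ((\<Prod>i<k-1. 1 - s - of_nat i) / fact k) * Z (s + of_nat k - 1) =
        ((1 - s) gchoose k) * (\<Sum>n. (of_nat (n + 1) :: complex) powr (1 - s - of_nat k))" if "k \<in> {2..Suc m}" for k
    proof -
      have "Z (s + of_nat k - 1) = (s + of_nat k - 2) * (\<Sum>n. (of_nat (Suc n) :: complex) powr (- (s + of_nat k - 1)))"
        using that s by (subst assms(2)) (auto simp: algebra_simps)
      moreover have "- (s + of_nat k - 1) = 1 - s - of_nat k" by simp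
      ultimately have "Z (s + of_nat k - 1) = (s + of_nat k - 2) * (\<Sum>n. (of_nat (n + 1) :: complex) powr (1 - s - of_nat k))"
        by (simp only: Suc_eq_plus1)
      then show ?thesis using that by (subst gchoose_Suc_factor) (simp_all only: mult.assoc atLeastAtMost_iff, auto)
    qed
    then have "(\<Sum>k=2..Suc m. - ((\<Prod>i<k-1. 1 - s - of_nat i) / fact k) * Z (s + of_nat k - 1)) =
        (\<Sum>k=2..Suc m. ((1 - s) gchoose k) * (\<Sum>n. (of_nat (n + 1) :: complex) powr (1 - s - of_nat k)))"
      by (rule sum.cong[OF refl])
    moreover have "of_nat 1 powr (1 - s) = (1 :: complex)" by simp
    ultimately show ?thesis
      using zeta_tail_identity[OF le_refl _ s, of "Suc m"]
      unfolding Z'_def Suc_eq_plus1 by (simp only: le_add2)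
  qed
  ultimately show ?thesis by blast
qed

lemma zeta_continuation_halfplane:
  "\<exists>Z. Z holomorphic_on {s. Re s > 1 - real m} \<and>
     (\<forall>s. Re s > 1 \<longrightarrow> Z s = (s - 1) * (\<Sum>n. (of_nat (Suc n) :: complex) powr (- s)))"
proof (induction m)
  case 0
  \<comment> \<open>The tail with k = 1 and N = 1 is the Dirichlet series itself.\<close>
  have "(\<lambda>s. \<Sum>n. (of_nat (n + 1) :: complex) powr (1 - s - of_nat 1)) holomorphic_on {s. Re s > 2 - real 1}"
    by (rule zeta_tail_holomorphic) simp
  then have "(\<lambda>s. (s - 1) * (\<Sum>n. (of_nat (Suc n) :: complex) powr (- s))) holomorphic_on {s. Re s > 1}"
    by (auto intro!: holomorphic_intros)
  then show ?case by auto
next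
  case (Suc m)
  then show ?case using zeta_continuation_step by blast
qed

lemma zeta_entire_continuation:
  "\<exists>Z. Z holomorphic_on UNIV \<and>
    (\<forall>s. Re s > 1 \<longrightarrow> Z s = (s - 1) * (\<Sum>n. (of_nat (Suc n) :: complex) powr (- s)))"
proof -
  obtain Y where Y: "\<And>m. Y m holomorphic_on {s. Re s > 1 - real m}"
     "\<And>m s. Re s > 1 \<Longrightarrow> Y m s = (s - 1) * (\<Sum>n. (of_nat (Suc n) :: complex) powr (- s))"
    using zeta_continuation_halfplane by metis
  have eq: "Y m s = Y n s" if "Re s > 1 - real m" "m \<le> n" for m n s
  proof (rule analytic_continuation_open[where f = "Y m" and g = "Y n" and z = s and s = "{s. Re s > 1}" and s' = "{s. Re s > 1 - real m}"])
    show "Y n holomorphic_on {s. Re s > 1 - real m}"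
      using that by (intro holomorphic_on_subset[OF Y(1)[of n]]) auto
    show "{s. Re s > 1} \<noteq> {}" by (auto intro!: exI[of _ 2])
    show "connected {s. Re s > 1 - real m}"
      by (intro convex_connected convex_halfspace_Re_gt)
  qed (use that Y in \<open>auto simp: open_halfspace_Re_gt\<close>)
  \<comment> \<open>Any index whose half-plane contains s would do, by \<open>eq\<close>; this one
    is an explicit choice.\<close>
  define Z where "Z = (\<lambda>s. Y (nat \<lceil>2 + \<bar>Re s\<bar>\<rceil>) s)"
  have Zeq: "Z s = Y m s" if "Re s > 1 - real m" for s m
  proof -
    define n where "n = nat \<lceil>2 + \<bar>Re s\<bar>\<rceil>"
    have "real n \<ge> 2 + \<bar>Re s\<bar>" unfolding n_def by linarith
    then have n: "Re s > 1 - real n" by linarith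
    have "Z s = Y n s" by (simp add: Z_def n_def)
    also have "\<dots> = Y m s"
      using eq[OF that, of n] eq[OF n, of m] by (metis nle_le)
    finally show ?thesis .
  qed
  have "Z holomorphic_on (\<Union>m. {s. Re s > 1 - real m})"
  proof (rule holomorphic_on_UN_open)
    fix m show "Z holomorphic_on {s. Re s > 1 - real m}"
      by (rule holomorphic_transform[OF Y(1)[of m]]) (auto simp: Zeq)
  qed (auto simp: open_halfspace_Re_gt)
  moreover have "(\<Union>m. {s. Re s > 1 - real m}) = UNIV"
  proof -
    have "\<exists>m. Re s > 1 - real m" for s
      using reals_Archimedean2[of "1 - Re s"] by (auto simp: algebra_simps)
    then show ?thesis by auto
  qed
  ultimately have "Z holomorphic_on UNIV" by simp
  moreover have "Z s = (s - 1) * (\<Sum>n. (of_nat (Suc n) :: complex) powr (- s))" if "Re s > 1" for s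
    using Zeq[of 0 s] Y(2)[of s 0] that by simp
  ultimately show ?thesis by blast
qed

text \<open>A definite description yields nothing before existence and uniqueness are known.
  Existence is Z(s)/(s - 1); uniqueness is the identity theorem on the connected punctured plane,
  with the prescribed value 0 settling the point 1.\<close>

lemma riemann_zeta_properties:
  shows "riemann_zeta holomorphic_on (- {1})"
    and "\<And>s. Re s > 1 \<Longrightarrow> (\<lambda>n. of_nat (Suc n) powr (- s)) sums riemann_zeta s"
proof -
  let ?P = "\<lambda>f. f holomorphic_on (- {1}) \<and>
     (\<forall>s. Re s > 1 \<longrightarrow> (\<lambda>n. of_nat (Suc n) powr (- s)) sums f s) \<and> f 1 = (0::complex)"
  obtain Z where Z: "Z holomorphic_on UNIV"
    "\<And>s. Re s > 1 \<Longrightarrow> Z s = (s - 1) * (\<Sum>n. (of_nat (Suc n) :: complex) powr (- s))"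
    using zeta_entire_continuation by (elim exE conjE) simp
  define f where "f = (\<lambda>s. if s = 1 then 0 else Z s / (s - 1))"
  have "(\<lambda>s. Z s / (s - 1)) holomorphic_on (- {1})"
    by (intro holomorphic_intros holomorphic_on_subset[OF Z(1)]) auto
  then have "f holomorphic_on (- {1})"
    by (rule holomorphic_transform) (auto simp: f_def)
  moreover have "(\<lambda>n. of_nat (Suc n) powr (- s)) sums f s" if "Re s > 1" for s
  proof -
    have "s \<noteq> 1" using that by auto
    moreover have "summable (\<lambda>n. (of_nat (Suc n) :: complex) powr (- s))"
      using zeta_tail_summable(1)[of 1 "- s"] that by simp
    ultimately show ?thesis using Z(2)[OF that] by (simp add: f_def summable_sums)
  qed
  ultimately have f: "?P f" by (simp add: f_def)
  have "g = f" if g: "?P g" for g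
  proof
    fix s show "g s = f s"
    proof (cases "s = 1")
      case False
      show ?thesis
      proof (rule analytic_continuation_open[where f = g and g = f and z = s and s = "{s. Re s > 1}" and s' = "- {1}"])
        show "{s. Re s > 1} \<noteq> {}" by (auto intro!: exI[of _ 2])
        show "connected (- {1::complex})"
          by (rule connected_punctured_universe) simp
        show "g z = f z" if "z \<in> {s. Re s > 1}" for z
          using g f that sums_unique2 by blast
      qed (use g f False in \<open>auto simp: open_halfspace_Re_gt\<close>)
    qed (use g f in simp)
  qed
  with f have "?P riemann_zeta"
    unfolding riemann_zeta_def by (rule theI)
  then show "riemann_zeta holomorphic_on (- {1})"
    and "\<And>s. Re s > 1 \<Longrightarrow> (\<lambda>n. of_nat (Suc n) powr (- s)) sums riemann_zeta s"
    by blast+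
qed

text \<open>Multiplied by s - 1, both sides are holomorphic on Re s > 0 without the point 1: the
  tails with k \<ge> 2 and the remainder with m \<ge> 1 converge there. They agree for Re s > 1 by
  the tail identity, so the identity theorem carries the equation into the strip.\<close>

lemma riemann_zeta_approximation:
  assumes "N \<ge> 1" "m \<ge> 1" "Re s > 0" "s \<noteq> 1"
  shows "riemann_zeta s - (\<Sum>n\<in>{1..<N}. of_nat n powr (- s)) = of_nat N powr (1 - s) / (s - 1)
    + (\<Sum>k=2..m. ((1 - s) gchoose k) / (s - 1) * (\<Sum>n. (of_nat (n + N) :: complex) powr (1 - s - of_nat k)))
    + (\<Sum>n. zeta_rem m s (n + N)) / (s - 1)"
proof -
  let ?L = "\<lambda>s. (s - 1) * (riemann_zeta s - (\<Sum>n\<in>{1..<N}. of_nat n powr (- s)))"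
  let ?R = "\<lambda>s. of_nat N powr (1 - s)
    + (\<Sum>k=2..m. ((1 - s) gchoose k) * (\<Sum>n. (of_nat (n + N) :: complex) powr (1 - s - of_nat k)))
    + (\<Sum>n. zeta_rem m s (n + N))"
  have "?L s = ?R s"
  proof (rule analytic_continuation_open[where f = ?L and g = ?R and z = s and s = "{s. Re s > 1}" and s' = "{s. Re s > 0} - {1}"])
    show "{s. Re s > 1} \<noteq> {}" by (auto intro!: exI[of _ 2])
    show "connected ({s. Re s > 0} - {1})"
      by (rule connected_open_delete)
         (auto simp: open_halfspace_Re_gt convex_connected convex_halfspace_Re_gt)
    show "?L holomorphic_on {s. Re s > 0} - {1}"
      by (intro holomorphic_intros holomorphic_on_subset[OF riemann_zeta_properties(1)]) auto
    show "?R holomorphic_on {s. Re s > 0} - {1}"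
    proof (intro holomorphic_on_add holomorphic_on_sum holomorphic_on_mult)
      show "(\<lambda>s. \<Sum>n. zeta_rem m s (n + N)) holomorphic_on {s. Re s > 0} - {1}"
        by (rule holomorphic_on_subset[OF zeta_rem_suminf_holomorphic]) (use assms in auto)
      fix k assume "k \<in> {2..m}"
      then show "(\<lambda>s. \<Sum>n. (of_nat (n + N) :: complex) powr (1 - s - of_nat k)) holomorphic_on {s. Re s > 0} - {1}"
        by (intro holomorphic_on_subset[OF zeta_tail_holomorphic]) (use assms in auto)
    qed (intro holomorphic_intros)+
    fix z assume z: "z \<in> {s. Re s > 1}"
    have "(\<lambda>n. of_nat (Suc n) powr (- z)) sums riemann_zeta z"
      using riemann_zeta_properties(2) z by simp
    from sums_split_initial_segment[OF this, of "N - 1"]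
    have "(\<lambda>n. of_nat (n + N) powr (- z)) sums (riemann_zeta z - (\<Sum>n<N-1. of_nat (Suc n) powr (- z)))"
      using assms by (simp add: algebra_simps of_nat_diff)
    moreover have "(\<Sum>n<N-1. (of_nat (Suc n) :: complex) powr (- z)) = (\<Sum>n\<in>{1..<N}. of_nat n powr (- z))"
      by (rule sum.reindex_bij_witness[of _ "\<lambda>n. n - 1" Suc]) auto
    ultimately have "(\<Sum>n. of_nat (n + N) powr (- z)) = riemann_zeta z - (\<Sum>n\<in>{1..<N}. of_nat n powr (- z))"
      using sums_unique by metis
    then show "?L z = ?R z" using zeta_tail_identity[of N m z] assms z by simp
  qed (use assms in \<open>auto simp: open_halfspace_Re_gt open_delete\<close>)
  moreover have "s - 1 \<noteq> 0" using assms by simp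
  ultimately have "riemann_zeta s - (\<Sum>n\<in>{1..<N}. of_nat n powr (- s)) = ?R s / (s - 1)"
    by (simp add: field_simps)
  then show ?thesis by (simp add: add_divide_distrib sum_divide_distrib)
qed

section \<open>Mean values of Dirichlet polynomials\<close>

lemma oscillatory_integral_bound:
  fixes x A B :: real
  assumes "A \<le> B" "x \<noteq> 0"
  shows "norm (integral {A..B} (\<lambda>t. cis (t * x))) \<le> 2 / \<bar>x\<bar>"
proof -
  have "((\<lambda>t. cis (t * x)) has_integral (cis (B * x) / (\<i> * of_real x) - cis (A * x) / (\<i> * of_real x))) {A..B}"
  proof (rule fundamental_theorem_of_calculus)
    fix t assume "t \<in> {A..B}"
    have "((\<lambda>z. exp (\<i> * (z * of_real x))) has_field_derivative (\<i> * of_real x) * exp (\<i> * (of_real t * of_real x))) (at (of_real t))"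
      by (auto intro!: derivative_eq_intros)
    from has_vector_derivative_real_field[OF this]
    have "((\<lambda>t. exp (\<i> * (of_real (t * x)))) has_vector_derivative (\<i> * of_real x) * exp (\<i> * (of_real (t * x)))) (at t within {A..B})"
      by simp
    then have "((\<lambda>t. cis (t * x) / (\<i> * of_real x)) has_vector_derivative ((\<i> * of_real x) * cis (t * x)) / (\<i> * of_real x)) (at t within {A..B})"
      unfolding cis_conv_exp by (rule has_vector_derivative_divide)
    then show "((\<lambda>t. cis (t * x) / (\<i> * of_real x)) has_vector_derivative cis (t * x)) (at t within {A..B})"
      using assms by simp
  qed (use assms in auto)
  then have "norm (integral {A..B} (\<lambda>t. cis (t * x))) = norm (cis (B * x) / (\<i> * of_real x) - cis (A * x) / (\<i> * of_real x))"
    by (simp add: integral_unique)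
  also have "\<dots> \<le> norm (cis (B * x) / (\<i> * of_real x)) + norm (cis (A * x) / (\<i> * of_real x))"
    by (rule norm_triangle_ineq4)
  also have "\<dots> = 2 / \<bar>x\<bar>" by (simp add: norm_divide norm_mult)
  finally show ?thesis .
qed

text \<open>For m < n, ln x \<le> x - 1 at x = m/n gives ln n - ln m \<ge> (n - m)/n, and n/(n - m)
  = 1 + m/(n - m). The two summands are treated by different means in the off-diagonal
  estimate.\<close>

lemma inverse_ln_diff_le:
  fixes m n :: nat
  assumes "m \<ge> 1" "n \<ge> 1" "m \<noteq> n"
  shows "1 / \<bar>ln (real n) - ln (real m)\<bar> \<le> 1 + real (min m n) / \<bar>real m - real n\<bar>"
proof -
  have *: "1 / (ln (real n) - ln (real m)) \<le> 1 + real m / (real n - real m)" if "1 \<le> m" "m < n" for m n :: nat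
  proof -
    have "ln (real m / real n) \<le> real m / real n - 1" using that by (intro ln_le_minus_one) auto
    then have l: "ln (real n) - ln (real m) \<ge> (real n - real m) / real n"
      using that by (simp add: ln_div field_simps)
    have "1 / (ln (real n) - ln (real m)) \<le> 1 / ((real n - real m) / real n)"
      using that by (intro divide_left_mono l mult_pos_pos) auto
    also have "\<dots> = 1 + real m / (real n - real m)" using that by (simp add: field_simps)
    finally show ?thesis .
  qed
  show ?thesis
  proof (cases "m < n")
    case True
    then show ?thesis using *[of m n] assms by (simp add: min_def abs_if)
  next
    case False
    then have "n < m" using assms by simp
    then show ?thesis using *[of n m] assms by (simp add: min_def abs_if)
  qed
qed

lemma summable_Suc_powr: "q < -1 \<Longrightarrow> summable (\<lambda>n. real (Suc n) powr q)"
  using summable_shift_powr[of q 1] by simp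

text \<open>Every distance d \<ge> 1 from m is attained at most twice, once on each side.\<close>

lemma sum_abs_diff_powr_le:
  fixes A :: "nat set"
  assumes "finite A" "q < -1"
  shows "(\<Sum>n\<in>A-{m}. \<bar>real m - real n\<bar> powr q) \<le> 2 * (\<Sum>n. real (Suc n) powr q)"
proof -
  let ?W = "\<Sum>n. real (Suc n) powr q"
  have 1: "(\<Sum>n\<in>{n\<in>A. n < m}. \<bar>real m - real n\<bar> powr q) \<le> ?W"
  proof -
    have "(\<Sum>n\<in>{n\<in>A. n < m}. \<bar>real m - real n\<bar> powr q) = (\<Sum>d\<in>(\<lambda>n. m - n - 1) ` {n\<in>A. n < m}. real (Suc d) powr q)"
      by (subst sum.reindex) (auto intro!: inj_onI sum.cong simp: of_nat_diff)
    also have "\<dots> \<le> ?W" using assms by (intro sum_le_suminf summable_Suc_powr) auto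
    finally show ?thesis .
  qed
  have 2: "(\<Sum>n\<in>{n\<in>A. n > m}. \<bar>real m - real n\<bar> powr q) \<le> ?W"
  proof -
    have "(\<Sum>n\<in>{n\<in>A. n > m}. \<bar>real m - real n\<bar> powr q) = (\<Sum>d\<in>(\<lambda>n. n - m - 1) ` {n\<in>A. n > m}. real (Suc d) powr q)"
      by (subst sum.reindex) (auto intro!: inj_onI sum.cong simp: of_nat_diff)
    also have "\<dots> \<le> ?W" using assms by (intro sum_le_suminf summable_Suc_powr) auto
    finally show ?thesis .
  qed
  have split: "A - {m} = {n\<in>A. n < m} \<union> {n\<in>A. n > m}" by auto
  have "(\<Sum>n\<in>A-{m}. \<bar>real m - real n\<bar> powr q) =
      (\<Sum>n\<in>{n\<in>A. n < m}. \<bar>real m - real n\<bar> powr q) + (\<Sum>n\<in>{n\<in>A. n > m}. \<bar>real m - real n\<bar> powr q)"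
    unfolding split using assms by (intro sum.union_disjoint) auto
  with 1 2 show ?thesis by simp
qed

text \<open>The first series pays for the constant part of the kernel (Cauchy-Schwarz), the second
  for the part min m n / |m - n| (Schur's test, row sums at most twice the series). The remaining
  factor 2 in both comes from the bound 2/|x| for oscillatory integrals.\<close>

definition mv_const :: "real \<Rightarrow> real" where
  "mv_const \<delta> = 2 * (\<Sum>n. real (Suc n) powr (-1 - \<delta>)) + 4 * (\<Sum>n. real (Suc n) powr (-1 - \<delta> / 2))"

lemma mv_const_nonneg: "\<delta> > 0 \<Longrightarrow> mv_const \<delta> \<ge> 0"
  unfolding mv_const_def by (intro add_nonneg_nonneg mult_nonneg_nonneg suminf_nonneg summable_Suc_powr) auto

text \<open>With the weights \<open>n\<^bsup>(1+\<delta>)/2\<^esup>\<close> the kernel \<open>min m n / \<bar>m - n\<bar>\<close> has bounded row sums, so Schur's test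
  controls the off-diagonal terms.\<close>

lemma min_times_diff_powr_le:
  fixes m n :: nat
  assumes "m \<ge> 1" "n \<ge> 1" "\<delta> > 0"
  shows "real (min m n) * \<bar>real m - real n\<bar> powr (\<delta>/2) \<le> real m powr ((1+\<delta>)/2) * real n powr ((1+\<delta>)/2)"
proof -
  have "real (min m n) = real (min m n) powr (1/2) * real (min m n) powr (1/2)"
    using assms by (simp add: powr_add[symmetric])
  also have "\<dots> \<le> real m powr (1/2) * real n powr (1/2)"
    by (intro mult_mono powr_mono2) auto
  finally have 1: "real (min m n) \<le> real m powr (1/2) * real n powr (1/2)" .
  have "\<bar>real m - real n\<bar> \<le> real m * real n"
  proof -
    have "real m \<le> real m * real n" "real n \<le> real m * real n" using assms by simp_all
    then show ?thesis using assms by linarith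
  qed
  then have "\<bar>real m - real n\<bar> powr (\<delta>/2) \<le> (real m * real n) powr (\<delta>/2)"
    using assms by (intro powr_mono2) auto
  also have "\<dots> = real m powr (\<delta>/2) * real n powr (\<delta>/2)" by (simp add: powr_mult)
  finally have "real (min m n) * \<bar>real m - real n\<bar> powr (\<delta>/2)
     \<le> (real m powr (1/2) * real n powr (1/2)) * (real m powr (\<delta>/2) * real n powr (\<delta>/2))"
    by (intro mult_mono 1) auto
  also have "\<dots> = (real m powr (1/2) * real m powr (\<delta>/2)) * (real n powr (1/2) * real n powr (\<delta>/2))"
    by (simp add: mult_ac)
  finally show ?thesis by (simp add: powr_add[symmetric] add_divide_distrib)
qed

text \<open>The kernel splits into the constant 1, whose double sum is at most the square of the sum
  of the \<open>a n\<close>, and the singular part, where the weights turn a into b, the kernel into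
  at most \<open>w m n\<close>, and b m b n is replaced by the mean of the squares.\<close>

lemma off_diagonal_bound:
  fixes a :: "nat \<Rightarrow> real"
  assumes "finite A" "\<And>n. n \<in> A \<Longrightarrow> n \<ge> 1" "\<delta> > 0" "\<And>n. a n \<ge> 0"
  shows "(\<Sum>m\<in>A. \<Sum>n\<in>A-{m}. a m * a n * (2 * (1 + real (min m n) / \<bar>real m - real n\<bar>)))
         \<le> mv_const \<delta> * (\<Sum>n\<in>A. real n powr (1 + \<delta>) * (a n)\<^sup>2)"
proof -
  define b where "b = (\<lambda>n. real n powr ((1+\<delta>)/2) * a n)"
  have b2: "(b n)\<^sup>2 = real n powr (1+\<delta>) * (a n)\<^sup>2" if "n \<in> A" for n
  proof -
    have "(real n powr ((1+\<delta>)/2))\<^sup>2 = real n powr (1+\<delta>)"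
      by (simp add: power2_eq_square powr_add[symmetric])
    then show ?thesis by (simp add: b_def power_mult_distrib)
  qed
  define w where "w = (\<lambda>m n. \<bar>real m - real n\<bar> powr (-1 - \<delta>/2))"
  have w_sym: "w m n = w n m" for m n by (simp add: w_def abs_minus_commute)
  define B where "B = (\<Sum>n\<in>A. (b n)\<^sup>2)"
  have "(\<Sum>m\<in>A. \<Sum>n\<in>A-{m}. a m * a n) \<le> (\<Sum>n\<in>A. a n)\<^sup>2"
  proof -
    have "(\<Sum>m\<in>A. \<Sum>n\<in>A-{m}. a m * a n) \<le> (\<Sum>m\<in>A. \<Sum>n\<in>A. a m * a n)"
      using assms by (intro sum_mono sum_mono2) auto
    then show ?thesis by (simp add: power2_eq_square sum_product)
  qed
  also have "(\<Sum>n\<in>A. a n)\<^sup>2 = (\<Sum>n\<in>A. real n powr (-(1+\<delta>)/2) * b n)\<^sup>2"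
  proof -
    have "a n = real n powr (-(1+\<delta>)/2) * b n" if "n \<in> A" for n
    proof -
      have "real n powr (-(1+\<delta>)/2) * real n powr ((1+\<delta>)/2) = 1"
        using assms(2)[OF that] by (simp add: powr_add[symmetric] add_divide_distrib[symmetric])
      then show ?thesis by (simp add: b_def)
    qed
    then show ?thesis by (metis (no_types, lifting) sum.cong)
  qed
  also have "\<dots> \<le> (\<Sum>n\<in>A. (real n powr (-(1+\<delta>)/2))\<^sup>2) * B"
    unfolding B_def by (rule Cauchy_Schwarz_ineq_sum)
  also have "(\<Sum>n\<in>A. (real n powr (-(1+\<delta>)/2))\<^sup>2) = (\<Sum>n\<in>(\<lambda>n. n - 1) ` A. real (Suc n) powr (-1-\<delta>))"
  proof -
    have "(real n powr (-(1+\<delta>)/2))\<^sup>2 = real n powr (-1-\<delta>)" for n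
    proof -
      have "-(1+\<delta>)/2 + -(1+\<delta>)/2 = -1-\<delta>" by (simp add: field_simps)
      then show ?thesis by (simp only: power2_eq_square powr_add[symmetric])
    qed
    moreover have "inj_on (\<lambda>n. n - 1) A"
    proof (rule inj_onI)
      fix x y assume "x \<in> A" "y \<in> A" "x - 1 = y - 1"
      then show "x = y" using assms(2)[of x] assms(2)[of y] by linarith
    qed
    ultimately show ?thesis using assms(2) by (subst sum.reindex) (auto intro!: sum.cong)
  qed
  also have "\<dots> * B \<le> (\<Sum>n. real (Suc n) powr (-1-\<delta>)) * B"
    unfolding B_def using assms by (intro mult_right_mono sum_le_suminf summable_Suc_powr sum_nonneg) auto
  finally have P1: "(\<Sum>m\<in>A. \<Sum>n\<in>A-{m}. a m * a n) \<le> (\<Sum>n. real (Suc n) powr (-1-\<delta>)) * B" .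
  have "(\<Sum>m\<in>A. \<Sum>n\<in>A-{m}. a m * a n * (real (min m n) / \<bar>real m - real n\<bar>))
     \<le> (\<Sum>m\<in>A. \<Sum>n\<in>A-{m}. ((b m)\<^sup>2 + (b n)\<^sup>2) / 2 * w m n)"
  proof (intro sum_mono)
    fix m n assume mn: "m \<in> A" "n \<in> A - {m}"
    then have "m \<noteq> n" by auto
    then have pos: "\<bar>real m - real n\<bar> > 0" by auto
    have "real (min m n) / \<bar>real m - real n\<bar> = (real (min m n) * \<bar>real m - real n\<bar> powr (\<delta>/2)) * w m n"
    proof -
      have "\<bar>real m - real n\<bar> powr (\<delta>/2) * w m n = \<bar>real m - real n\<bar> powr (-1)"
        unfolding w_def powr_add[symmetric] by simp
      also have "\<dots> = 1 / \<bar>real m - real n\<bar>" using pos by (simp add: powr_minus field_simps)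
      finally show ?thesis by (simp add: mult.assoc)
    qed
    also have "\<dots> \<le> (real m powr ((1+\<delta>)/2) * real n powr ((1+\<delta>)/2)) * w m n"
      using mn assms by (intro mult_right_mono min_times_diff_powr_le) (auto simp: w_def)
    finally have "a m * a n * (real (min m n) / \<bar>real m - real n\<bar>)
       \<le> a m * a n * ((real m powr ((1+\<delta>)/2) * real n powr ((1+\<delta>)/2)) * w m n)"
      using assms by (intro mult_left_mono mult_nonneg_nonneg) auto
    also have "\<dots> = (b m * b n) * w m n" by (simp add: b_def mult_ac)
    also have "\<dots> \<le> ((b m)\<^sup>2 + (b n)\<^sup>2) / 2 * w m n"
      using sum_squares_bound[of "b m" "b n"] by (intro mult_right_mono) (auto simp: w_def)
    finally show "a m * a n * (real (min m n) / \<bar>real m - real n\<bar>) \<le> ((b m)\<^sup>2 + (b n)\<^sup>2) / 2 * w m n" .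
  qed
  also have "\<dots> = (\<Sum>m\<in>A. \<Sum>n\<in>A-{m}. (b m)\<^sup>2 / 2 * w m n) + (\<Sum>m\<in>A. \<Sum>n\<in>A-{m}. (b n)\<^sup>2 / 2 * w m n)"
    by (simp add: sum.distrib[symmetric] add_divide_distrib distrib_right)
  \<comment> \<open>Symmetry of w: exchanging m and n makes the two halves equal, so only row sums
    of w remain.\<close>
  also have "(\<Sum>m\<in>A. \<Sum>n\<in>A-{m}. (b n)\<^sup>2 / 2 * w m n) = (\<Sum>m\<in>A. \<Sum>n\<in>A-{m}. (b m)\<^sup>2 / 2 * w m n)"
  proof -
    have "(\<Sum>m\<in>A. \<Sum>n\<in>A-{m}. g m n) = (\<Sum>m\<in>A. \<Sum>n\<in>A-{m}. g n m)" for g :: "nat \<Rightarrow> nat \<Rightarrow> real"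
    proof -
      have e: "(\<Sum>m\<in>A. \<Sum>n\<in>A-{m}. g m n) = (\<Sum>m\<in>A. \<Sum>n\<in>A. if n \<noteq> m then g m n else 0)" for g :: "nat \<Rightarrow> nat \<Rightarrow> real"
        using assms(1) by (intro sum.cong refl sum.mono_neutral_cong_left) auto
      show ?thesis unfolding e by (subst sum.swap) (auto intro!: sum.cong)
    qed
    from this[of "\<lambda>m n. (b n)\<^sup>2 / 2 * w m n"] show ?thesis by (simp add: w_sym)
  qed
  also have "(\<Sum>m\<in>A. \<Sum>n\<in>A-{m}. (b m)\<^sup>2 / 2 * w m n) + (\<Sum>m\<in>A. \<Sum>n\<in>A-{m}. (b m)\<^sup>2 / 2 * w m n)
      = (\<Sum>m\<in>A. (b m)\<^sup>2 * (\<Sum>n\<in>A-{m}. w m n))"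
    by (simp add: sum.distrib[symmetric] sum_distrib_left mult.commute)
  also have "\<dots> \<le> (\<Sum>m\<in>A. (b m)\<^sup>2 * (2 * (\<Sum>n. real (Suc n) powr (-1 - \<delta>/2))))"
    unfolding w_def using assms by (intro sum_mono mult_left_mono sum_abs_diff_powr_le) auto
  also have "\<dots> = 2 * (\<Sum>n. real (Suc n) powr (-1 - \<delta>/2)) * B"
    by (simp add: B_def sum_distrib_left sum_distrib_right mult_ac)
  finally have P2: "(\<Sum>m\<in>A. \<Sum>n\<in>A-{m}. a m * a n * (real (min m n) / \<bar>real m - real n\<bar>))
      \<le> 2 * (\<Sum>n. real (Suc n) powr (-1 - \<delta>/2)) * B" .
  have "(\<Sum>m\<in>A. \<Sum>n\<in>A-{m}. a m * a n * (2 * (1 + real (min m n) / \<bar>real m - real n\<bar>)))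
     = 2 * (\<Sum>m\<in>A. \<Sum>n\<in>A-{m}. a m * a n) + 2 * (\<Sum>m\<in>A. \<Sum>n\<in>A-{m}. a m * a n * (real (min m n) / \<bar>real m - real n\<bar>))"
    by (simp add: sum_distrib_left sum.distrib[symmetric] distrib_left mult_ac)
  also have "\<dots> \<le> 2 * ((\<Sum>n. real (Suc n) powr (-1-\<delta>)) * B) + 2 * (2 * (\<Sum>n. real (Suc n) powr (-1 - \<delta>/2)) * B)"
    using P1 P2 by (intro add_mono mult_left_mono) auto
  also have "\<dots> = mv_const \<delta> * B" by (simp add: mv_const_def algebra_simps)
  also have "B = (\<Sum>n\<in>A. real n powr (1 + \<delta>) * (a n)\<^sup>2)" unfolding B_def using b2 by (intro sum.cong) auto
  finally show ?thesis .
qed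

lemma nat_powr_it: "n \<ge> 1 \<Longrightarrow> (of_nat n :: complex) powr (- (\<i> * of_real t)) = cis (- t * ln (real n))"
  by (simp add: powr_def cis_conv_exp Ln_of_nat mult_ac)

text \<open>After the square is expanded, the diagonal contributes the interval length 2T, and each
  off-diagonal integral of (m/n)^(-it) is bounded independently of T by 2/|ln n - ln m|.\<close>

lemma mean_value_dirichlet_polynomial:
  fixes a :: "nat \<Rightarrow> complex"
  assumes "finite A" "\<And>n. n \<in> A \<Longrightarrow> n \<ge> 1" "\<delta> > 0" "T \<ge> 0"
  shows "integral {-T..T} (\<lambda>t. (norm (\<Sum>n\<in>A. a n * of_nat n powr (- (\<i> * of_real t))))\<^sup>2)
    \<le> 2 * T * (\<Sum>n\<in>A. (norm (a n))\<^sup>2) + mv_const \<delta> * (\<Sum>n\<in>A. real n powr (1 + \<delta>) * (norm (a n))\<^sup>2)"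
proof -
  let ?S = "\<lambda>t. \<Sum>n\<in>A. a n * of_nat n powr (- (\<i> * of_real t))"
  define I where "I = (\<lambda>m n. integral {-T..T} (\<lambda>t. cis (t * (ln (real n) - ln (real m)))))"
  have exp: "of_real ((norm (?S t))\<^sup>2) = (\<Sum>m\<in>A. \<Sum>n\<in>A. a m * cnj (a n) * cis (t * (ln (real n) - ln (real m))))" for t
  proof -
    have S: "?S t = (\<Sum>n\<in>A. a n * cis (- t * ln (real n)))"
      by (intro sum.cong refl) (simp add: nat_powr_it[OF assms(2)])
    have "of_real ((norm (?S t))\<^sup>2) = ?S t * cnj (?S t)" by (simp only: complex_norm_square)
    also have "\<dots> =
       (\<Sum>m\<in>A. \<Sum>n\<in>A. (a m * cis (- t * ln (real m))) * (cnj (a n) * cis (t * ln (real n))))"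
      unfolding S by (simp add: sum_product cis_cnj)
    also have "\<dots> = (\<Sum>m\<in>A. \<Sum>n\<in>A. a m * cnj (a n) * (cis (- t * ln (real m)) * cis (t * ln (real n))))"
      by (simp add: mult_ac)
    also have "\<dots> = (\<Sum>m\<in>A. \<Sum>n\<in>A. a m * cnj (a n) * cis (t * (ln (real n) - ln (real m))))"
      unfolding cis_mult by (simp add: algebra_simps)
    finally show ?thesis .
  qed
  have int: "(\<lambda>t. cis (t * x)) integrable_on {-T..T}" for x
    by (intro integrable_continuous_interval continuous_intros)
  have "((\<lambda>t. \<Sum>m\<in>A. \<Sum>n\<in>A. a m * cnj (a n) * cis (t * (ln (real n) - ln (real m)))) has_integral
      (\<Sum>m\<in>A. \<Sum>n\<in>A. a m * cnj (a n) * I m n)) {-T..T}"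
    unfolding I_def by (intro has_integral_sum assms(1) has_integral_mult_right integrable_integral int)
  then have "((\<lambda>t. complex_of_real ((norm (?S t))\<^sup>2)) has_integral (\<Sum>m\<in>A. \<Sum>n\<in>A. a m * cnj (a n) * I m n)) {-T..T}"
    by (simp only: exp)
  then have "((\<lambda>t. Re (complex_of_real ((norm (?S t))\<^sup>2))) has_integral Re (\<Sum>m\<in>A. \<Sum>n\<in>A. a m * cnj (a n) * I m n)) {-T..T}"
    by (rule has_integral_Re)
  then have "((\<lambda>t. (norm (?S t))\<^sup>2) has_integral Re (\<Sum>m\<in>A. \<Sum>n\<in>A. a m * cnj (a n) * I m n)) {-T..T}"
    by simp
  then have "integral {-T..T} (\<lambda>t. (norm (?S t))\<^sup>2) = Re (\<Sum>m\<in>A. \<Sum>n\<in>A. a m * cnj (a n) * I m n)"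
    by (rule integral_unique)
  also have "\<dots> \<le> norm (\<Sum>m\<in>A. \<Sum>n\<in>A. a m * cnj (a n) * I m n)" by (rule complex_Re_le_cmod)
  also have "\<dots> \<le> (\<Sum>m\<in>A. \<Sum>n\<in>A. norm (a m) * norm (a n) * norm (I m n))"
    by (intro sum_norm_le order.trans[OF norm_sum sum_mono]) (simp add: norm_mult)
  also have "\<dots> = (\<Sum>m\<in>A. (norm (a m))\<^sup>2 * (2 * T)) + (\<Sum>m\<in>A. \<Sum>n\<in>A-{m}. norm (a m) * norm (a n) * norm (I m n))"
  proof -
    have "norm (I m m) = 2 * T" for m using assms by (simp add: I_def)
    then have "(\<Sum>n\<in>A. norm (a m) * norm (a n) * norm (I m n)) = (norm (a m))\<^sup>2 * (2 * T)
       + (\<Sum>n\<in>A-{m}. norm (a m) * norm (a n) * norm (I m n))" if "m \<in> A" for m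
      using that assms(1) by (subst sum.remove[of A m]) (auto simp: power2_eq_square)
    then show ?thesis by (simp add: sum.distrib[symmetric] cong: sum.cong)
  qed
  also have "(\<Sum>m\<in>A. \<Sum>n\<in>A-{m}. norm (a m) * norm (a n) * norm (I m n)) \<le>
     (\<Sum>m\<in>A. \<Sum>n\<in>A-{m}. norm (a m) * norm (a n) * (2 * (1 + real (min m n) / \<bar>real m - real n\<bar>)))"
  proof (intro sum_mono mult_left_mono)
    fix m n assume mn: "m \<in> A" "n \<in> A - {m}"
    then have ne: "m \<ge> 1" "n \<ge> 1" "m \<noteq> n" using assms(2) by auto
    then have "norm (I m n) \<le> 2 / \<bar>ln (real n) - ln (real m)\<bar>"
      unfolding I_def using assms by (intro oscillatory_integral_bound) auto
    then show "norm (I m n) \<le> 2 * (1 + real (min m n) / \<bar>real m - real n\<bar>)"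
      using inverse_ln_diff_le[OF ne] by simp
  qed auto
  also have "\<dots> \<le> mv_const \<delta> * (\<Sum>n\<in>A. real n powr (1 + \<delta>) * (norm (a n))\<^sup>2)"
    using assms by (intro off_diagonal_bound) auto
  finally show ?thesis by (simp add: sum_distrib_left mult_ac)
qed

section \<open>The mean square of the zeta function in the strip\<close>

lemma continuous_on_nat_powr:
  fixes f :: "'a::topological_space \<Rightarrow> complex"
  assumes "n \<ge> 1" "continuous_on S f"
  shows "continuous_on S (\<lambda>t. (of_nat n :: complex) powr f t)"
proof -
  have "(of_nat n :: complex) \<noteq> 0" using assms by simp
  then show ?thesis unfolding powr_def using assms(2) by (simp add: continuous_intros)
qed

section \<open>Mean squares of tails of Dirichlet series\<close>

text \<open>For \<delta> > 0 this is the number zeta(1 + \<delta>), kept as a real series.\<close>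

definition powr_series :: "real \<Rightarrow> real" where
  "powr_series \<delta> = (\<Sum>n. real (Suc n) powr (-1 - \<delta>))"

lemma powr_series_nonneg: "\<delta> > 0 \<Longrightarrow> powr_series \<delta> \<ge> 0"
  unfolding powr_series_def by (intro suminf_nonneg summable_Suc_powr) auto

text \<open>The exponent is split as (q + 1 + \<delta>) + (-1 - \<delta>): the first part is
  nonpositive and largest at N, the second is summable. This costs N^\<delta> against comparison
  with an integral, but needs no integral.\<close>

lemma tail_powr_le:
  assumes "N \<ge> 1" "\<delta> > 0" "q \<le> -1 - \<delta>"
  shows "(\<Sum>n. real (n + N) powr q) \<le> real N powr (q + 1 + \<delta>) * powr_series \<delta>"
proof -
  have "(\<Sum>n. real (n + N) powr q) \<le> (\<Sum>n. real N powr (q + 1 + \<delta>) * real (Suc n) powr (-1 - \<delta>))"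
  proof (rule suminf_le)
    fix n
    have "real (n + N) powr q = real (n + N) powr (q + 1 + \<delta>) * real (n + N) powr (-1 - \<delta>)"
      by (simp add: powr_add[symmetric])
    also have "\<dots> \<le> real N powr (q + 1 + \<delta>) * real (Suc n) powr (-1 - \<delta>)"
      using assms by (intro mult_mono powr_mono2') auto
    finally show "real (n + N) powr q \<le> real N powr (q + 1 + \<delta>) * real (Suc n) powr (-1 - \<delta>)" .
  qed (use assms in \<open>auto intro!: summable_shift_powr summable_mult summable_Suc_powr simp del: of_nat_Suc of_nat_add\<close>)
  also have "\<dots> = real N powr (q + 1 + \<delta>) * powr_series \<delta>"
    unfolding powr_series_def using assms by (intro suminf_mult summable_Suc_powr) auto
  finally show ?thesis .
qed

text \<open>Since q < -1 the series converges absolutely, so dominated convergence extends the mean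
  value theorem to it. \<open>T \<le> real N\<close> puts the diagonal factor T below n^(1+\<delta>)
  for every n of the tail, and both terms of the theorem merge into one.\<close>

lemma mean_value_dirichlet_tail:
  assumes "N \<ge> 1" "\<delta> > 0" "q \<le> -1 - \<delta>" "T \<ge> 0" "T \<le> real N"
  shows "integral {-T..T} (\<lambda>t. (norm (\<Sum>n. (of_nat (n + N) :: complex) powr (of_real q - \<i> * of_real t)))\<^sup>2)
      \<le> (2 + mv_const \<delta>) * powr_series \<delta> * real N powr (2 + 2 * \<delta> + 2 * q)"
proof -
  define f where "f = (\<lambda>M t. (norm (\<Sum>n<M. (of_nat (n + N) :: complex) powr (of_real q - \<i> * of_real t)))\<^sup>2)"
  define g where "g = (\<lambda>t. (norm (\<Sum>n. (of_nat (n + N) :: complex) powr (of_real q - \<i> * of_real t)))\<^sup>2)"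
  define B where "B = (2 + mv_const \<delta>) * powr_series \<delta> * real N powr (2 + 2 * \<delta> + 2 * q)"
  have nrm: "norm ((of_nat (n + N) :: complex) powr (of_real q - \<i> * of_real t)) = real (n + N) powr q" for n t
    using assms by (subst norm_nat_powr) auto
  have sm: "summable (\<lambda>n. (of_nat (n + N) :: complex) powr (of_real q - \<i> * of_real t))" for t
    using assms by (intro zeta_tail_summable) auto
  have smr: "summable (\<lambda>n. real (n + N) powr q)" using assms by (intro summable_shift_powr) auto
  have bound: "integral {-T..T} (f M) \<le> B" for M
  proof -
    have eq: "(\<Sum>n<M. (of_nat (n + N) :: complex) powr (of_real q - \<i> * of_real t)) =
        (\<Sum>n\<in>{N..<N+M}. of_real (real n powr q) * of_nat n powr (- (\<i> * of_real t)))" for t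
    proof -
      have "(\<Sum>n<M. (of_nat (n + N) :: complex) powr (of_real q - \<i> * of_real t)) =
        (\<Sum>n\<in>{N..<N+M}. (of_nat n :: complex) powr (of_real q - \<i> * of_real t))"
        by (rule sum.reindex_bij_witness[of _ "\<lambda>n. n - N" "\<lambda>n. n + N"]) auto
      also have "\<dots> = (\<Sum>n\<in>{N..<N+M}. of_real (real n powr q) * of_nat n powr (- (\<i> * of_real t)))"
      proof (intro sum.cong refl)
        fix n assume "n \<in> {N..<N+M}"
        then have "of_nat n powr (of_real q) = complex_of_real (real n powr q)"
          using powr_of_real[of "real n" q] by simp
        then show "(of_nat n :: complex) powr (of_real q - \<i> * of_real t) = of_real (real n powr q) * of_nat n powr (- (\<i> * of_real t))"
          using powr_add[of "of_nat n :: complex" "of_real q" "- (\<i> * of_real t)"] by simp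
      qed
      finally show ?thesis .
    qed
    have "integral {-T..T} (f M) \<le> 2 * T * (\<Sum>n\<in>{N..<N+M}. (norm (complex_of_real (real n powr q)))\<^sup>2)
      + mv_const \<delta> * (\<Sum>n\<in>{N..<N+M}. real n powr (1 + \<delta>) * (norm (complex_of_real (real n powr q)))\<^sup>2)"
      unfolding f_def eq using assms by (intro mean_value_dirichlet_polynomial) auto
    also have "\<dots> = (\<Sum>n\<in>{N..<N+M}. 2 * T * (real n powr q)\<^sup>2)
      + mv_const \<delta> * (\<Sum>n\<in>{N..<N+M}. real n powr (1 + \<delta>) * (real n powr q)\<^sup>2)"
      by (simp add: sum_distrib_left)
    also have "(\<Sum>n\<in>{N..<N+M}. 2 * T * (real n powr q)\<^sup>2) \<le> (\<Sum>n\<in>{N..<N+M}. 2 * (real n powr (1 + \<delta>) * (real n powr q)\<^sup>2))"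
    proof (intro sum_mono)
      fix n assume n: "n \<in> {N..<N+M}"
      have "T \<le> real n powr 1" using n assms by auto
      also have "\<dots> \<le> real n powr (1 + \<delta>)" using n assms by (intro powr_mono) auto
      finally show "2 * T * (real n powr q)\<^sup>2 \<le> 2 * (real n powr (1 + \<delta>) * (real n powr q)\<^sup>2)"
        by (simp add: mult_right_mono)
    qed
    also have "(\<Sum>n\<in>{N..<N+M}. 2 * (real n powr (1 + \<delta>) * (real n powr q)\<^sup>2)) + mv_const \<delta> * (\<Sum>n\<in>{N..<N+M}. real n powr (1 + \<delta>) * (real n powr q)\<^sup>2)
       = (2 + mv_const \<delta>) * (\<Sum>n\<in>{N..<N+M}. real n powr (1 + \<delta>) * (real n powr q)\<^sup>2)"
      by (simp add: sum_distrib_left[symmetric] algebra_simps)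
    also have "(\<Sum>n\<in>{N..<N+M}. real n powr (1 + \<delta>) * (real n powr q)\<^sup>2) = (\<Sum>n<M. real (n + N) powr (1 + \<delta> + 2 * q))"
      by (rule sum.reindex_bij_witness[of _ "\<lambda>n. n + N" "\<lambda>n. n - N"]) (auto simp: power2_eq_square powr_add[symmetric] algebra_simps)
    also have "(2 + mv_const \<delta>) * \<dots> \<le> (2 + mv_const \<delta>) * (\<Sum>n. real (n + N) powr (1 + \<delta> + 2 * q))"
      using assms mv_const_nonneg[of \<delta>] by (intro mult_left_mono sum_le_suminf summable_shift_powr) auto
    also have "(\<Sum>n. real (n + N) powr (1 + \<delta> + 2 * q)) \<le> real N powr (1 + \<delta> + 2 * q + 1 + \<delta>) * powr_series \<delta>"
      using assms by (intro tail_powr_le) auto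
    also have "1 + \<delta> + 2 * q + 1 + \<delta> = 2 + 2 * \<delta> + 2 * q" by simp
    finally show ?thesis using assms mv_const_nonneg[of \<delta>] by (simp add: B_def mult_ac)
  qed
  have dom: "norm (f M t) \<le> (\<Sum>n. real (n + N) powr q)\<^sup>2" for M t
  proof -
    have "norm (\<Sum>n<M. (of_nat (n + N) :: complex) powr (of_real q - \<i> * of_real t)) \<le> (\<Sum>n<M. real (n + N) powr q)"
      by (intro order.trans[OF norm_sum]) (simp only: nrm order.refl)
    also have "\<dots> \<le> (\<Sum>n. real (n + N) powr q)" by (intro sum_le_suminf smr) auto
    finally show ?thesis unfolding f_def by (simp add: power_mono)
  qed
  have "(\<lambda>M. integral {-T..T} (f M)) \<longlonglongrightarrow> integral {-T..T} g"
  proof (rule dominated_convergence(2))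
    show "f M integrable_on {-T..T}" for M
    proof -
      have "continuous_on {-T..T} (\<lambda>t. \<Sum>n<M. (of_nat (n + N) :: complex) powr (of_real q - \<i> * of_real t))"
        using assms by (intro continuous_on_sum continuous_on_nat_powr continuous_intros) auto
      then show ?thesis unfolding f_def by (intro integrable_continuous_interval continuous_on_power continuous_on_norm)
    qed
    show "(\<lambda>t. (\<Sum>n. real (n + N) powr q)\<^sup>2) integrable_on {-T..T}" by (intro integrable_continuous_interval continuous_intros)
    show "norm (f M t) \<le> (\<Sum>n. real (n + N) powr q)\<^sup>2" for M t by (rule dom)
    show "(\<lambda>M. f M t) \<longlonglongrightarrow> g t" for t
      unfolding f_def g_def by (intro tendsto_intros summable_LIMSEQ sm)
  qed
  then have "integral {-T..T} g \<le> B"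
    by (rule LIMSEQ_le_const2) (use bound in auto)
  then show ?thesis by (simp add: g_def B_def)
qed

section \<open>Pole term, Taylor coefficients and remainder\<close>

text \<open>Meant for the term N^(1-s)/(s-1), whose square is integrable over a whole vertical line
  and so contributes no factor T. The comparison c^2 (1 + t^2) \<le> c^2 + t^2 reduces the integral
  to arctan.\<close>

lemma integral_inverse_square_le:
  fixes c T :: real
  assumes "0 < c" "c \<le> 1" "T \<ge> 0"
  shows "integral {-T..T} (\<lambda>t. 1 / (c\<^sup>2 + t\<^sup>2)) \<le> pi / c\<^sup>2"
proof -
  have "(arctan has_vector_derivative (1 / (1 + t\<^sup>2))) (at t within {-T..T})" for t
    using DERIV_arctan[of t]
    by (simp add: has_real_derivative_iff_has_vector_derivative[symmetric] has_field_derivative_at_within inverse_eq_divide)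
  then have "((\<lambda>t. 1 / (1 + t\<^sup>2)) has_integral (arctan T - arctan (- T))) {-T..T}"
    using assms by (intro fundamental_theorem_of_calculus) auto
  then have hi: "((\<lambda>t. 1 / c\<^sup>2 * (1 / (1 + t\<^sup>2))) has_integral (1 / c\<^sup>2 * (arctan T - arctan (- T)))) {-T..T}"
    by (rule has_integral_mult_right)
  have nz: "c\<^sup>2 + t\<^sup>2 \<noteq> 0" for t :: real using assms sum_power2_gt_zero_iff[of c t] by auto
  have "integral {-T..T} (\<lambda>t. 1 / (c\<^sup>2 + t\<^sup>2)) \<le> integral {-T..T} (\<lambda>t. 1 / c\<^sup>2 * (1 / (1 + t\<^sup>2)))"
  proof (rule integral_le)
    show "(\<lambda>t. 1 / (c\<^sup>2 + t\<^sup>2)) integrable_on {-T..T}"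
      using nz by (intro integrable_continuous_interval continuous_intros) auto
    show "(\<lambda>t. 1 / c\<^sup>2 * (1 / (1 + t\<^sup>2))) integrable_on {-T..T}" using hi by blast
    fix t :: real
    have "c\<^sup>2 \<le> 1" using assms by (simp add: power_le_one)
    then have "c\<^sup>2 * t\<^sup>2 \<le> t\<^sup>2" by (intro mult_left_le_one_le) auto
    then have "c\<^sup>2 * (1 + t\<^sup>2) \<le> c\<^sup>2 + t\<^sup>2" by (simp add: distrib_left)
    then have "1 / (c\<^sup>2 + t\<^sup>2) \<le> 1 / (c\<^sup>2 * (1 + t\<^sup>2))"
      using assms by (intro divide_left_mono mult_pos_pos add_pos_nonneg) (auto simp: add_pos_nonneg)
    then show "1 / (c\<^sup>2 + t\<^sup>2) \<le> 1 / c\<^sup>2 * (1 / (1 + t\<^sup>2))" by simp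
  qed
  also have "\<dots> = 1 / c\<^sup>2 * (arctan T - arctan (- T))" using hi by (rule integral_unique)
  also have "\<dots> \<le> 1 / c\<^sup>2 * pi"
    using arctan_bounded[of T] by (intro mult_left_mono) (auto simp: arctan_minus)
  finally show ?thesis by simp
qed

text \<open>The factor i = 0 is |1 - s| and cancels the denominator, so the bound stays uniform near
  the pole; each of the k remaining factors is at most k + 1 + T.\<close>

lemma norm_prod_ratio_le:
  fixes s :: complex
  assumes "0 \<le> Re s" "Re s \<le> 1" "\<bar>Im s\<bar> \<le> T" "T \<ge> 1" "s \<noteq> 1"
  shows "(\<Prod>i<Suc k. norm (1 - s - of_nat i)) / norm (s - 1) \<le> (real (k + 2) * T) ^ k"
proof -
  have "(\<Prod>i<Suc k. norm (1 - s - of_nat i)) = norm (s - 1) * (\<Prod>i<k. norm (1 - s - of_nat (Suc i)))"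
    by (subst prod.lessThan_Suc_shift) (simp add: norm_minus_commute)
  then have "(\<Prod>i<Suc k. norm (1 - s - of_nat i)) / norm (s - 1) = (\<Prod>i<k. norm (1 - s - of_nat (Suc i)))"
    using assms by simp
  also have "\<dots> \<le> (\<Prod>i<k. real (k + 2) * T)"
  proof (intro prod_mono conjI)
    fix i assume i: "i \<in> {..<k}"
    have "norm (1 - s - of_nat (Suc i)) \<le> \<bar>Re (1 - s - of_nat (Suc i))\<bar> + \<bar>Im (1 - s - of_nat (Suc i))\<bar>"
      by (rule cmod_le)
    also have "\<dots> \<le> real (k + 1) + T" using assms i by auto
    also have "\<dots> \<le> real (k + 1) * T + T" using assms mult_left_mono[of 1 T "real (k+1)"] by simp
    finally show "norm (1 - s - of_nat (Suc i)) \<le> real (k + 2) * T" by (simp add: algebra_simps)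
  qed auto
  finally show ?thesis by simp
qed

lemma norm_gchoose_ratio_le:
  fixes s :: complex
  assumes "0 \<le> Re s" "Re s \<le> 1" "\<bar>Im s\<bar> \<le> T" "T \<ge> 1" "s \<noteq> 1"
  shows "norm (((1 - s) gchoose Suc k) / (s - 1)) \<le> (real (k + 2) * T) ^ k"
proof -
  have "norm (((1 - s) gchoose Suc k) / (s - 1)) = (\<Prod>i<Suc k. norm (1 - s - of_nat i)) / norm (s - 1) / fact (Suc k)"
    unfolding gbinomial_prod_rev by (simp only: norm_divide prod_norm atLeast0LessThan norm_fact) simp
  also have "\<dots> \<le> (\<Prod>i<Suc k. norm (1 - s - of_nat i)) / norm (s - 1) / 1"
    using fact_ge_1[of "Suc k", where 'a = real] by (intro divide_left_mono divide_nonneg_nonneg prod_nonneg) auto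
  also have "\<dots> \<le> (real (k + 2) * T) ^ k" using norm_prod_ratio_le[OF assms] by simp
  finally show ?thesis .
qed

lemma norm_zeta_rem_sum_le:
  assumes "1/2 \<le> Re s" "Re s \<le> 1" "\<bar>Im s\<bar> \<le> T" "T \<ge> 1" "s \<noteq> 1" "N \<ge> 1" "0 < \<delta>" "\<delta> \<le> 1/2" "m \<ge> 1"
  shows "norm ((\<Sum>n. zeta_rem m s (n + N)) / (s - 1)) \<le> (real (m + 2) * T) ^ m * (real N powr (1 + \<delta> - Re s - real m) * powr_series \<delta>)"
proof -
  let ?P = "\<Prod>i\<le>m. norm (1 - s - of_nat i)"
  have b: "norm (zeta_rem m s (n + N)) \<le> ?P * real (n + N) powr (- Re s - real m)" for n
    using assms by (intro norm_zeta_rem_le) auto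
  have sm: "summable (\<lambda>n. ?P * real (n + N) powr (- Re s - real m))"
    using assms by (intro summable_mult summable_shift_powr) auto
  have "norm (\<Sum>n. zeta_rem m s (n + N)) \<le> (\<Sum>n. ?P * real (n + N) powr (- Re s - real m))"
    by (rule norm_suminf_le[OF b sm])
  also have "\<dots> = ?P * (\<Sum>n. real (n + N) powr (- Re s - real m))"
    using assms by (intro suminf_mult summable_shift_powr) auto
  also have "\<dots> \<le> ?P * (real N powr (- Re s - real m + 1 + \<delta>) * powr_series \<delta>)"
    using assms by (intro mult_left_mono tail_powr_le prod_nonneg) auto
  finally have "norm ((\<Sum>n. zeta_rem m s (n + N)) / (s - 1)) \<le> ?P * (real N powr (- Re s - real m + 1 + \<delta>) * powr_series \<delta>) / norm (s - 1)"
    unfolding norm_divide by (intro divide_right_mono) auto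
  also have "\<dots> = ?P / norm (s - 1) * (real N powr (1 + \<delta> - Re s - real m) * powr_series \<delta>)"
    by (simp add: algebra_simps)
  also have "\<dots> \<le> (real (m + 2) * T) ^ m * (real N powr (1 + \<delta> - Re s - real m) * powr_series \<delta>)"
    using norm_prod_ratio_le[of s T m] assms powr_series_nonneg[of \<delta>]
    by (intro mult_right_mono) (auto simp: lessThan_Suc_atMost)
  finally show ?thesis .
qed


lemma norm_add4_square_le:
  fixes w x y z :: complex
  shows "(norm (w + (x + y + z)))\<^sup>2 \<le> 4 * ((norm w)\<^sup>2 + (norm x)\<^sup>2 + (norm y)\<^sup>2 + (norm z)\<^sup>2)"
proof -
  have "norm (w + (x + y + z)) \<le> norm w + norm x + norm y + norm z"
    using norm_triangle_ineq[of w "x + y + z"] norm_triangle_ineq[of "x + y" z] norm_triangle_ineq[of x y] by linarith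
  then have "(norm (w + (x + y + z)))\<^sup>2 \<le> (norm w + norm x + norm y + norm z)\<^sup>2" by (intro power_mono) auto
  also have "\<dots> \<le> 4 * ((norm w)\<^sup>2 + (norm x)\<^sup>2 + (norm y)\<^sup>2 + (norm z)\<^sup>2)"
  proof -
    have "(p + q + r + u)\<^sup>2 \<le> 4 * (p\<^sup>2 + q\<^sup>2 + r\<^sup>2 + u\<^sup>2)" for p q r u :: real
    proof -
      have "0 \<le> (p-q)\<^sup>2 + (p-r)\<^sup>2 + (p-u)\<^sup>2 + (q-r)\<^sup>2 + (q-u)\<^sup>2 + (r-u)\<^sup>2" by simp
      then show ?thesis by (simp add: power2_eq_square algebra_simps)
    qed
    then show ?thesis .
  qed
  finally show ?thesis .
qed

section \<open>Assembly of the mean square estimate\<close>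

text \<open>The diagonal gives T times a tail that is small for large N0. In the error term
  n^(1+\<delta>-2a) is written as n^(-1-\<delta>) n^(2+2\<delta>-2a): the first factor is summable,
  the second has positive exponent and is largest at N.\<close>

lemma main_part_mean_square:
  assumes "1/2 < a" "a \<le> \<sigma>" "\<sigma> < 1" "0 < \<delta>" "1 \<le> N0" "T \<ge> 0"
  shows "integral {-T..T} (\<lambda>t. (norm (\<Sum>n\<in>{N0..<N}. (of_nat n :: complex) powr (- (of_real \<sigma> + \<i> * of_real t))))\<^sup>2)
     \<le> 2 * T * (\<Sum>n. real (n + N0) powr (- 2 * a)) + mv_const \<delta> * powr_series \<delta> * real N powr (2 + 2 * \<delta> - 2 * a)"
proof -
  have eq: "(\<Sum>n\<in>{N0..<N}. (of_nat n :: complex) powr (- (of_real \<sigma> + \<i> * of_real t))) =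
      (\<Sum>n\<in>{N0..<N}. of_real (real n powr (-\<sigma>)) * of_nat n powr (- (\<i> * of_real t)))" for t
  proof (intro sum.cong refl)
    fix n assume "n \<in> {N0..<N}"
    have "of_nat n powr (of_real (-\<sigma>)) = complex_of_real (real n powr (-\<sigma>))"
      using powr_of_real[of "real n" "-\<sigma>"] by simp
    then show "(of_nat n :: complex) powr (- (of_real \<sigma> + \<i> * of_real t)) = of_real (real n powr (-\<sigma>)) * of_nat n powr (- (\<i> * of_real t))"
      using powr_add[of "of_nat n :: complex" "of_real (-\<sigma>)" "- (\<i> * of_real t)"] by simp
  qed
  have le: "(real n powr (-\<sigma>))\<^sup>2 \<le> real n powr (- 2 * a)" if "n \<ge> 1" for n
  proof -
    have "(real n powr (-\<sigma>))\<^sup>2 = real n powr (- 2 * \<sigma>)" by (simp add: power2_eq_square powr_add[symmetric])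
    also have "\<dots> \<le> real n powr (- 2 * a)" using that assms by (intro powr_mono) auto
    finally show ?thesis .
  qed
  have "integral {-T..T} (\<lambda>t. (norm (\<Sum>n\<in>{N0..<N}. (of_nat n :: complex) powr (- (of_real \<sigma> + \<i> * of_real t))))\<^sup>2)
    \<le> 2 * T * (\<Sum>n\<in>{N0..<N}. (norm (complex_of_real (real n powr (-\<sigma>))))\<^sup>2)
      + mv_const \<delta> * (\<Sum>n\<in>{N0..<N}. real n powr (1 + \<delta>) * (norm (complex_of_real (real n powr (-\<sigma>))))\<^sup>2)"
    unfolding eq using assms by (intro mean_value_dirichlet_polynomial) auto
  also have "\<dots> = 2 * T * (\<Sum>n\<in>{N0..<N}. (real n powr (-\<sigma>))\<^sup>2)
      + mv_const \<delta> * (\<Sum>n\<in>{N0..<N}. real n powr (1 + \<delta>) * (real n powr (-\<sigma>))\<^sup>2)" by simp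
  also have "(\<Sum>n\<in>{N0..<N}. (real n powr (-\<sigma>))\<^sup>2) \<le> (\<Sum>n. real (n + N0) powr (- 2 * a))"
  proof -
    have "(\<Sum>n\<in>{N0..<N}. (real n powr (-\<sigma>))\<^sup>2) \<le> (\<Sum>n\<in>{N0..<N}. real n powr (- 2 * a))"
      using assms by (intro sum_mono le) auto
    also have "\<dots> = (\<Sum>n<N-N0. real (n + N0) powr (- 2 * a))"
      by (rule sum.reindex_bij_witness[of _ "\<lambda>n. n + N0" "\<lambda>n. n - N0"]) auto
    also have "\<dots> \<le> (\<Sum>n. real (n + N0) powr (- 2 * a))"
      using assms by (intro sum_le_suminf summable_shift_powr) auto
    finally show ?thesis .
  qed
  also have "(\<Sum>n\<in>{N0..<N}. real n powr (1 + \<delta>) * (real n powr (-\<sigma>))\<^sup>2) \<le> powr_series \<delta> * real N powr (2 + 2 * \<delta> - 2 * a)"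
  proof -
    have "(\<Sum>n\<in>{N0..<N}. real n powr (1 + \<delta>) * (real n powr (-\<sigma>))\<^sup>2) \<le>
       (\<Sum>n\<in>{N0..<N}. real n powr (-1 - \<delta>) * real N powr (2 + 2 * \<delta> - 2 * a))"
    proof (intro sum_mono)
      fix n assume n: "n \<in> {N0..<N}"
      have "real n powr (1 + \<delta>) * (real n powr (-\<sigma>))\<^sup>2 \<le> real n powr (1 + \<delta>) * real n powr (- 2 * a)"
        using n assms by (intro mult_left_mono le) auto
      also have "\<dots> = real n powr (-1 - \<delta>) * real n powr (2 + 2 * \<delta> - 2 * a)"
        by (simp add: powr_add[symmetric] algebra_simps)
      also have "\<dots> \<le> real n powr (-1 - \<delta>) * real N powr (2 + 2 * \<delta> - 2 * a)"
        using n assms by (intro mult_left_mono powr_mono2) auto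
      finally show "real n powr (1 + \<delta>) * (real n powr (-\<sigma>))\<^sup>2 \<le> real n powr (-1 - \<delta>) * real N powr (2 + 2 * \<delta> - 2 * a)" .
    qed
    also have "\<dots> = (\<Sum>n\<in>{N0..<N}. real n powr (-1 - \<delta>)) * real N powr (2 + 2 * \<delta> - 2 * a)"
      by (simp add: sum_distrib_right)
    also have "(\<Sum>n\<in>{N0..<N}. real n powr (-1 - \<delta>)) = (\<Sum>n\<in>{N0-1..<N-1}. real (Suc n) powr (-1 - \<delta>))"
      using assms by (intro sum.reindex_bij_witness[of _ Suc "\<lambda>n. n - 1"]) auto
    also have "\<dots> \<le> powr_series \<delta>"
      unfolding powr_series_def using assms by (intro sum_le_suminf summable_Suc_powr) auto
    finally show ?thesis by (simp add: mult_right_mono)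
  qed
  finally show ?thesis using assms mv_const_nonneg[of \<delta>] by (simp add: mult_left_mono mult.assoc)
qed

text \<open>Zeta minus its sum below N0 is the block from N0 to N, plus the pole term, the Taylor
  terms and the remainder. The condition T (T/N)^(2m) \<le> 1 is what the remainder requires: its
  square, integrated over an interval of length 2T, is of order T (T/N)^(2m)
  N^(2+2\<delta>-2\<sigma>).\<close>

lemma zeta_mean_square_aux:
  assumes ab: "1/2 < a" "a \<le> b" "b < 1" and d: "0 < \<delta>" "\<delta> \<le> 1/2" and m: "m \<ge> 1"
  shows "\<exists>C\<ge>0. \<forall>\<sigma>\<in>{a..b}. \<forall>T\<ge>1. \<forall>N0\<ge>1. \<forall>N\<ge>N0. T \<le> real N \<longrightarrow> T * (T / real N) ^ (2 * m) \<le> 1 \<longrightarrow>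
    integral {-T..T} (\<lambda>t. (norm (riemann_zeta (of_real \<sigma> + \<i> * of_real t)
        - (\<Sum>n\<in>{1..<N0}. of_nat n powr (- (of_real \<sigma> + \<i> * of_real t)))))\<^sup>2)
     \<le> C * (T * (\<Sum>n. real (n + N0) powr (- 2 * a)) + real N powr (2 + 2 * \<delta> - 2 * a))"
proof -
  define \<beta> where "\<beta> = 2 + 2 * \<delta> - 2 * a"
  define E where "E = (2 + mv_const \<delta>) * powr_series \<delta>"
  define C1 where "C1 = pi / (1 - b)\<^sup>2"
  define C2 where "C2 = real m * (\<Sum>k=2..m. (real (k + 1)) ^ (2 * (k - 1)) * E)"
  define C3 where "C3 = 2 * (real (m + 2) ^ m * powr_series \<delta>)\<^sup>2"
  \<comment> \<open>\<open>C1\<close>, \<open>C2\<close>, \<open>C3\<close> belong to the pole term,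
    the Taylor terms and the remainder. The 4 comes from squaring a sum of four terms, and 8 is this
    4 times the 2 of the diagonal 2T.\<close>
  define C where "C = 8 + 4 * (mv_const \<delta> * powr_series \<delta> + C1 + C2 + C3)"
  have mp: "mv_const \<delta> \<ge> 0" "powr_series \<delta> \<ge> 0"
    using d mv_const_nonneg powr_series_nonneg by auto
  have E0: "E \<ge> 0" using mp by (simp add: E_def)
  have C123: "C1 \<ge> 0" "C2 \<ge> 0" "C3 \<ge> 0"
    using E0 mp by (auto simp: C1_def C2_def C3_def intro!: sum_nonneg mult_nonneg_nonneg)
  have "C \<ge> 0" using C123 mp by (simp add: C_def)
  moreover have "integral {-T..T} (\<lambda>t. (norm (riemann_zeta (of_real \<sigma> + \<i> * of_real t)
        - (\<Sum>n\<in>{1..<N0}. of_nat n powr (- (of_real \<sigma> + \<i> * of_real t)))))\<^sup>2)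
     \<le> C * (T * (\<Sum>n. real (n + N0) powr (- 2 * a)) + real N powr \<beta>)"
    if \<sigma>: "\<sigma> \<in> {a..b}" and T: "T \<ge> 1" and N0: "N0 \<ge> 1" "N \<ge> N0" and TN: "T \<le> real N" and TN2: "T * (T / real N) ^ (2 * m) \<le> 1"
    for \<sigma> T :: real and N0 N :: nat
  proof -
    define s where "s = (\<lambda>t. complex_of_real \<sigma> + \<i> * of_real t)"
    have s: "Re (s t) = \<sigma>" "Im (s t) = t" "s t \<noteq> 1" for t
      using \<sigma> ab by (auto simp: s_def complex_eq_iff)
    have cs: "continuous_on A s" for A unfolding s_def by (intro continuous_intros)
    define D where "D = (\<lambda>k t. \<Sum>n. (of_nat (n + N) :: complex) powr (of_real (1 - \<sigma> - real k) - \<i> * of_real t))"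
    have D: "(\<Sum>n. (of_nat (n + N) :: complex) powr (1 - s t - of_nat k)) = D k t" for k t
      by (simp add: D_def s_def algebra_simps)
    have contD: "continuous_on {-T..T} (D k)" if "k \<ge> 2" for k
    proof -
      have c: "continuous_on {z. Re z > 2 - real k} (\<lambda>z. \<Sum>n. (of_nat (n + N) :: complex) powr (1 - z - of_nat k))"
        using N0 by (intro holomorphic_on_imp_continuous_on zeta_tail_holomorphic) auto
      have sub: "s ` {-T..T} \<subseteq> {z. Re z > 2 - real k}" using \<sigma> ab that by (auto simp: s)
      have "continuous_on {-T..T} (\<lambda>t. \<Sum>n. (of_nat (n + N) :: complex) powr (1 - s t - of_nat k))"
        by (rule continuous_on_compose2[OF c cs sub])
      then show ?thesis by (simp only: D)
    qed
    define M where "M = (\<lambda>t. \<Sum>n\<in>{N0..<N}. (of_nat n :: complex) powr (- s t))"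
    have contM: "continuous_on {-T..T} M"
      unfolding M_def using N0 cs by (intro continuous_on_sum continuous_on_nat_powr continuous_intros) auto
    define Rm where "Rm = (real (m + 2) * T) ^ m * (real N powr (1 + \<delta> - \<sigma> - real m) * powr_series \<delta>)"
    \<comment> \<open>Pointwise majorant with explicit integral: 4 for the four parts, and a factor
      m from Cauchy-Schwarz over the Taylor terms.\<close>
    define U where "U = (\<lambda>t. 4 * ((norm (M t))\<^sup>2 + real N powr (2 - 2 * a) * (1 / ((1 - b)\<^sup>2 + t\<^sup>2))
        + real m * (\<Sum>k=2..m. ((real (k + 1) * T) ^ (k - 1))\<^sup>2 * (norm (D k t))\<^sup>2) + Rm\<^sup>2))"
    have Npos: "real N \<ge> 1" using N0 by simp
    have pw: "(norm (riemann_zeta (s t) - (\<Sum>n\<in>{1..<N0}. of_nat n powr (- s t))))\<^sup>2 \<le> U t" if t: "t \<in> {-T..T}" for t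
    proof -
      have "{1..<N} = {1..<N0} \<union> {N0..<N}" using N0 by auto
      then have "(\<Sum>n\<in>{1..<N}. (of_nat n :: complex) powr (- s t)) = (\<Sum>n\<in>{1..<N0}. of_nat n powr (- s t)) + M t"
        unfolding M_def by (simp only:) (rule sum.union_disjoint, auto)
      moreover have "riemann_zeta (s t) - (\<Sum>n\<in>{1..<N}. of_nat n powr (- s t)) = of_nat N powr (1 - s t) / (s t - 1)
          + (\<Sum>k=2..m. ((1 - s t) gchoose k) / (s t - 1) * D k t)
          + (\<Sum>n. zeta_rem m (s t) (n + N)) / (s t - 1)"
        using riemann_zeta_approximation[of N m "s t"] N0 m \<sigma> ab s unfolding D by simp
      ultimately have eq: "riemann_zeta (s t) - (\<Sum>n\<in>{1..<N0}. of_nat n powr (- s t)) = M t +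
         (of_nat N powr (1 - s t) / (s t - 1)
          + (\<Sum>k=2..m. ((1 - s t) gchoose k) / (s t - 1) * D k t)
          + (\<Sum>n. zeta_rem m (s t) (n + N)) / (s t - 1))"
        by (simp add: algebra_simps)
      have "(norm (riemann_zeta (s t) - (\<Sum>n\<in>{1..<N0}. of_nat n powr (- s t))))\<^sup>2 \<le>
         4 * ((norm (M t))\<^sup>2 + (norm (of_nat N powr (1 - s t) / (s t - 1)))\<^sup>2
           + (norm (\<Sum>k=2..m. ((1 - s t) gchoose k) / (s t - 1) * D k t))\<^sup>2
           + (norm ((\<Sum>n. zeta_rem m (s t) (n + N)) / (s t - 1)))\<^sup>2)"
        unfolding eq by (rule norm_add4_square_le)
      also have "\<dots> \<le> U t"
        unfolding U_def
      proof (intro mult_left_mono add_mono order.refl)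
        have "(norm (of_nat N powr (1 - s t) / (s t - 1)))\<^sup>2 = (real N powr (1 - \<sigma>))\<^sup>2 * (1 / (norm (s t - 1))\<^sup>2)"
          using N0 s by (simp add: norm_divide norm_nat_powr power_divide)
        also have "(norm (s t - 1))\<^sup>2 = (1 - \<sigma>)\<^sup>2 + t\<^sup>2"
          by (simp add: cmod_power2 s power2_commute)
        also have "(real N powr (1 - \<sigma>))\<^sup>2 * (1 / ((1 - \<sigma>)\<^sup>2 + t\<^sup>2)) \<le> real N powr (2 - 2 * a) * (1 / ((1 - b)\<^sup>2 + t\<^sup>2))"
        proof (intro mult_mono divide_left_mono add_right_mono)
          have "(real N powr (1 - \<sigma>))\<^sup>2 = real N powr (2 - 2 * \<sigma>)" by (simp add: power2_eq_square powr_add[symmetric])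
          also have "\<dots> \<le> real N powr (2 - 2 * a)" using \<sigma> Npos by (intro powr_mono) auto
          finally show "(real N powr (1 - \<sigma>))\<^sup>2 \<le> real N powr (2 - 2 * a)" .
          show "(1 - b)\<^sup>2 \<le> (1 - \<sigma>)\<^sup>2" using \<sigma> ab by (intro power_mono) auto
        qed (use \<sigma> ab in \<open>auto intro!: mult_pos_pos add_pos_nonneg\<close>)
        finally show "(norm (of_nat N powr (1 - s t) / (s t - 1)))\<^sup>2 \<le> real N powr (2 - 2 * a) * (1 / ((1 - b)\<^sup>2 + t\<^sup>2))" .
        have "(norm (\<Sum>k=2..m. ((1 - s t) gchoose k) / (s t - 1) * D k t))\<^sup>2 \<le> (\<Sum>k=2..m. norm (((1 - s t) gchoose k) / (s t - 1) * D k t))\<^sup>2"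
          by (intro power_mono norm_sum) auto
        also have "\<dots> \<le> (\<Sum>k=2..m. (norm (((1 - s t) gchoose k) / (s t - 1) * D k t))\<^sup>2) * real (card {2..m})"
          by (rule sum_squared_le_sum_of_squares)
        also have "\<dots> \<le> (\<Sum>k=2..m. ((real (k + 1) * T) ^ (k - 1))\<^sup>2 * (norm (D k t))\<^sup>2) * real m"
        proof (intro mult_mono sum_mono)
          fix k assume k: "k \<in> {2..m}"
          have "norm (((1 - s t) gchoose Suc (k - 1)) / (s t - 1)) \<le> (real ((k - 1) + 2) * T) ^ (k - 1)"
            using \<sigma> ab t T s by (intro norm_gchoose_ratio_le) auto
          moreover have "Suc (k - 1) = k" "real ((k - 1) + 2) = real (k + 1)" using k by auto
          ultimately have h: "norm (((1 - s t) gchoose k) / (s t - 1)) \<le> (real (k + 1) * T) ^ (k - 1)" by simp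
          have "(norm (((1 - s t) gchoose k) / (s t - 1) * D k t))\<^sup>2 = (norm (((1 - s t) gchoose k) / (s t - 1)))\<^sup>2 * (norm (D k t))\<^sup>2"
            by (simp only: norm_mult power_mult_distrib)
          also have "\<dots> \<le> ((real (k + 1) * T) ^ (k - 1))\<^sup>2 * (norm (D k t))\<^sup>2"
            by (intro mult_right_mono power_mono[OF h]) auto
          finally show "(norm (((1 - s t) gchoose k) / (s t - 1) * D k t))\<^sup>2 \<le> ((real (k + 1) * T) ^ (k - 1))\<^sup>2 * (norm (D k t))\<^sup>2"
            .
        qed (auto intro!: sum_nonneg)
        finally show "(norm (\<Sum>k=2..m. ((1 - s t) gchoose k) / (s t - 1) * D k t))\<^sup>2 \<le> real m * (\<Sum>k=2..m. ((real (k + 1) * T) ^ (k - 1))\<^sup>2 * (norm (D k t))\<^sup>2)"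
          by (simp add: mult.commute)
        have "norm ((\<Sum>n. zeta_rem m (s t) (n + N)) / (s t - 1)) \<le> Rm"
          unfolding Rm_def using norm_zeta_rem_sum_le[of "s t" T N \<delta> m] \<sigma> ab t T s N0 d m by auto
        then show "(norm ((\<Sum>n. zeta_rem m (s t) (n + N)) / (s t - 1)))\<^sup>2 \<le> Rm\<^sup>2"
          by (intro power_mono) auto
      qed auto
      finally show ?thesis .
    qed
    have cz: "continuous_on {-T..T} (\<lambda>t. riemann_zeta (s t) - (\<Sum>n\<in>{1..<N0}. of_nat n powr (- s t)))"
    proof (intro continuous_on_diff continuous_on_sum continuous_on_nat_powr continuous_on_minus cs)
      show "continuous_on {-T..T} (\<lambda>t. riemann_zeta (s t))"
        by (rule continuous_on_compose2[OF holomorphic_on_imp_continuous_on[OF riemann_zeta_properties(1)] cs])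
           (use s in auto)
    qed auto
    have iM: "(\<lambda>t. (norm (M t))\<^sup>2) integrable_on {-T..T}"
      using contM by (intro integrable_continuous_interval continuous_intros)
    have iD: "(\<lambda>t. (norm (D k t))\<^sup>2) integrable_on {-T..T}" if "k \<in> {2..m}" for k
      using contD[of k] that by (intro integrable_continuous_interval continuous_intros) auto
    have nz: "(1 - b)\<^sup>2 + t\<^sup>2 \<noteq> 0" for t :: real using ab sum_power2_gt_zero_iff[of "1 - b" t] by auto
    have iI: "(\<lambda>t. 1 / ((1 - b)\<^sup>2 + t\<^sup>2)) integrable_on {-T..T}"
      using nz by (intro integrable_continuous_interval continuous_intros) auto
    define V where "V = 4 * (integral {-T..T} (\<lambda>t. (norm (M t))\<^sup>2) + real N powr (2 - 2 * a) * integral {-T..T} (\<lambda>t. 1 / ((1 - b)\<^sup>2 + t\<^sup>2))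
        + real m * (\<Sum>k=2..m. ((real (k + 1) * T) ^ (k - 1))\<^sup>2 * integral {-T..T} (\<lambda>t. (norm (D k t))\<^sup>2)) + 2 * T * Rm\<^sup>2)"
    have "((\<lambda>t. Rm\<^sup>2) has_integral (2 * T * Rm\<^sup>2)) {-T..T}"
      using has_integral_const_real[of "Rm\<^sup>2" "-T" T] T by simp
    then have hU: "(U has_integral V) {-T..T}"
      unfolding U_def V_def
      by (intro has_integral_mult_right has_integral_add has_integral_sum integrable_integral iM iD iI finite_atLeastAtMost)
    have "integral {-T..T} (\<lambda>t. (norm (riemann_zeta (s t) - (\<Sum>n\<in>{1..<N0}. of_nat n powr (- s t))))\<^sup>2) \<le> integral {-T..T} U"
    proof (rule integral_le)
      show "(\<lambda>t. (norm (riemann_zeta (s t) - (\<Sum>n\<in>{1..<N0}. of_nat n powr (- s t))))\<^sup>2) integrable_on {-T..T}"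
        by (intro integrable_continuous_interval continuous_on_power continuous_on_norm cz)
      show "U integrable_on {-T..T}" using hU by blast
    qed (rule pw)
    also have "\<dots> = V" using hU by (rule integral_unique)
    also have "V \<le> C * (T * (\<Sum>n. real (n + N0) powr (- 2 * a)) + real N powr \<beta>)"
    proof -
      have q1: "integral {-T..T} (\<lambda>t. (norm (M t))\<^sup>2) \<le> 2 * T * (\<Sum>n. real (n + N0) powr (- 2 * a)) + mv_const \<delta> * powr_series \<delta> * real N powr \<beta>"
        unfolding M_def s_def \<beta>_def using ab \<sigma> d N0 T by (intro main_part_mean_square) auto
      have q2: "real N powr (2 - 2 * a) * integral {-T..T} (\<lambda>t. 1 / ((1 - b)\<^sup>2 + t\<^sup>2)) \<le> real N powr \<beta> * C1"
        unfolding C1_def \<beta>_def using ab d T Npos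
        by (intro mult_mono powr_mono integral_inverse_square_le) (auto intro!: integral_nonneg iI)
      have q3: "real m * (\<Sum>k=2..m. ((real (k + 1) * T) ^ (k - 1))\<^sup>2 * integral {-T..T} (\<lambda>t. (norm (D k t))\<^sup>2)) \<le> C2 * real N powr \<beta>"
      proof -
        \<comment> \<open>The squared coefficient grows like T^(2(k-1)), while the mean square of
          the tail gains N^(-2(k-1)) over the case k = 1. As T \<le> N, every k contributes the same
          order N^\<beta>.\<close>
        have "((real (k + 1) * T) ^ (k - 1))\<^sup>2 * integral {-T..T} (\<lambda>t. (norm (D k t))\<^sup>2) \<le> (real (k + 1)) ^ (2 * (k - 1)) * E * real N powr \<beta>"
          if k: "k \<in> {2..m}" for k
        proof -
          have "integral {-T..T} (\<lambda>t. (norm (D k t))\<^sup>2) \<le> E * real N powr (2 + 2 * \<delta> + 2 * (1 - \<sigma> - real k))"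
            unfolding D_def E_def using k N0 d T TN \<sigma> ab by (intro mean_value_dirichlet_tail) auto
          also have "\<dots> \<le> E * real N powr (\<beta> + - real (2 * (k - 1)))"
            using \<sigma> Npos E0 k by (intro mult_left_mono powr_mono) (auto simp: \<beta>_def of_nat_diff)
          also have "real N powr (\<beta> + - real (2 * (k - 1))) = real N powr \<beta> * inverse (real N ^ (2 * (k - 1)))"
            using Npos powr_realpow[of "real N" "2 * (k - 1)"] by (simp only: powr_add powr_minus)
          finally have "((real (k + 1) * T) ^ (k - 1))\<^sup>2 * integral {-T..T} (\<lambda>t. (norm (D k t))\<^sup>2)
             \<le> ((real (k + 1) * T) ^ (k - 1))\<^sup>2 * (E * (real N powr \<beta> * inverse (real N ^ (2 * (k - 1)))))"
            by (intro mult_left_mono) auto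
          also have pe: "((real (k + 1) * T) ^ (k - 1))\<^sup>2 = real (k + 1) ^ (2 * (k - 1)) * T ^ (2 * (k - 1))"
            by (simp add: power_mult_distrib power_mult[symmetric] mult.commute)
          also have "\<dots> * (E * (real N powr \<beta> * inverse (real N ^ (2 * (k - 1))))) =
             real (k + 1) ^ (2 * (k - 1)) * E * real N powr \<beta> * (T / real N) ^ (2 * (k - 1))"
            by (simp add: power_divide field_simps)
          also have "\<dots> \<le> real (k + 1) ^ (2 * (k - 1)) * E * real N powr \<beta> * 1"
            using E0 T TN Npos by (intro mult_left_mono power_le_one mult_nonneg_nonneg) auto
          finally show ?thesis by (simp only: pe mult_1_right)
        qed
        then have "(\<Sum>k=2..m. ((real (k + 1) * T) ^ (k - 1))\<^sup>2 * integral {-T..T} (\<lambda>t. (norm (D k t))\<^sup>2)) \<le> (\<Sum>k=2..m. (real (k + 1)) ^ (2 * (k - 1)) * E * real N powr \<beta>)"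
          by (intro sum_mono)
        then have "real m * (\<Sum>k=2..m. ((real (k + 1) * T) ^ (k - 1))\<^sup>2 * integral {-T..T} (\<lambda>t. (norm (D k t))\<^sup>2)) \<le> real m * (\<Sum>k=2..m. (real (k + 1)) ^ (2 * (k - 1)) * E * real N powr \<beta>)"
          by (intro mult_left_mono) auto
        then show ?thesis by (simp add: C2_def sum_distrib_right mult.assoc)
      qed
      have q4: "2 * T * Rm\<^sup>2 \<le> C3 * real N powr \<beta>"
      proof -
        have e1: "(real N powr (1 + \<delta> - \<sigma> - real m))\<^sup>2 = real N powr (2 + 2 * \<delta> - 2 * \<sigma> + - real (2 * m))"
          by (simp add: power2_eq_square powr_add[symmetric] algebra_simps)
        have "2 * T * Rm\<^sup>2 = C3 * (T * T ^ (2 * m) * (real N powr (1 + \<delta> - \<sigma> - real m))\<^sup>2)"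
          unfolding Rm_def C3_def by (simp add: power_mult_distrib power_mult[symmetric] mult_ac)
        also have "\<dots> = C3 * (T * T ^ (2 * m) * (real N powr (2 + 2 * \<delta> - 2 * \<sigma>) * inverse (real N ^ (2 * m))))"
          unfolding e1 using Npos powr_realpow[of "real N" "2 * m"] by (simp only: powr_add powr_minus)
        also have "\<dots> = C3 * (real N powr (2 + 2 * \<delta> - 2 * \<sigma>) * (T * (T / real N) ^ (2 * m)))"
          by (simp add: power_divide field_simps)
        also have "\<dots> \<le> C3 * (real N powr \<beta> * 1)"
          using TN2 C123 \<sigma> Npos T by (intro mult_left_mono mult_mono powr_mono) (auto simp: \<beta>_def)
        finally show ?thesis by simp
      qed
      have "V \<le> 4 * ((2 * T * (\<Sum>n. real (n + N0) powr (- 2 * a)) + mv_const \<delta> * powr_series \<delta> * real N powr \<beta>)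
          + real N powr \<beta> * C1 + C2 * real N powr \<beta> + C3 * real N powr \<beta>)"
        unfolding V_def by (intro mult_left_mono add_mono q1 q2 q3 q4) auto
      also have "\<dots> = 8 * (T * (\<Sum>n. real (n + N0) powr (- 2 * a))) + (C - 8) * real N powr \<beta>"
        unfolding C_def by (simp add: algebra_simps)
      also have "\<dots> \<le> C * (T * (\<Sum>n. real (n + N0) powr (- 2 * a))) + C * real N powr \<beta>"
        using T C123 mp ab N0 by (intro add_mono mult_right_mono mult_nonneg_nonneg suminf_nonneg summable_shift_powr) (auto simp: C_def)
      finally show ?thesis by (simp add: distrib_left)
    qed
    finally show ?thesis by (simp add: s_def)
  qed
  ultimately show ?thesis unfolding \<beta>_def by (intro exI[of _ C]) blast
qed

text \<open>The partial sum has length \<open>N \<ge> T\<^bsup>1+\<eta>\<^esup>\<close>: longer than \<open>T\<close>, so that finitely many Taylor terms suffice, but short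
  enough for the contribution \<open>N\<^bsup>2+2\<delta>-2a\<^esup>\<close> of the off-diagonal terms to be \<open>o(T)\<close>.\<close>

lemma zeta_mean_square:
  assumes ab: "1/2 < a" "a \<le> b" "b < 1"
  obtains C \<kappa> where "C \<ge> 0" "\<kappa> < 1" "\<And>\<sigma> T N0. a \<le> \<sigma> \<Longrightarrow> \<sigma> \<le> b \<Longrightarrow> T \<ge> 1 \<Longrightarrow> N0 \<ge> 1 \<Longrightarrow> real N0 \<le> T \<Longrightarrow>
    integral {-T..T} (\<lambda>t. (norm (riemann_zeta (of_real \<sigma> + \<i> * of_real t)
        - (\<Sum>n\<in>{1..<N0}. of_nat n powr (- (of_real \<sigma> + \<i> * of_real t)))))\<^sup>2)
     \<le> C * (T * (\<Sum>n. real (n + N0) powr (- 2 * a)) + T powr \<kappa>)"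
proof -
  \<comment> \<open>This \<delta> makes \<beta> = 3/2 - a, which is below 1. With \<eta> = (1 -
    \<beta>)/2 the exponent \<kappa> = (1 + \<eta>) \<beta> of the error N^\<beta> is still below 1,
    as 1 - \<kappa> = (1 - \<beta>)(2 - \<beta>)/2. The order m is chosen with 2 m \<eta> \<ge> 1,
    so that T (T/N)^(2m) \<le> 1 for N \<ge> T^(1+\<eta>).\<close>
  define \<delta> where "\<delta> = (2 * a - 1) / 4"
  define \<beta> where "\<beta> = 2 + 2 * \<delta> - 2 * a"
  define \<eta> where "\<eta> = (1 - \<beta>) / 2"
  define m where "m = nat \<lceil>1 / (2 * \<eta>)\<rceil>"
  have d: "0 < \<delta>" "\<delta> \<le> 1/2" using ab by (auto simp: \<delta>_def)
  have \<beta>: "0 < \<beta>" "\<beta> < 1" using ab by (auto simp: \<beta>_def \<delta>_def field_simps)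
  have \<eta>: "\<eta> > 0" using \<beta> by (simp add: \<eta>_def)
  have "1 / (2 * \<eta>) > 0" using \<eta> by simp
  then have m: "m \<ge> 1" "real m \<ge> 1 / (2 * \<eta>)" unfolding m_def by linarith+
  have m2: "1 - 2 * real m * \<eta> \<le> 0" using m(2) \<eta> by (simp add: field_simps)
  define \<kappa> where "\<kappa> = (1 + \<eta>) * \<beta>"
  have \<kappa>: "\<kappa> < 1"
  proof -
    have "1 - \<kappa> = (1 - \<beta>) * (2 - \<beta>) / 2" by (simp add: \<kappa>_def \<eta>_def field_simps power2_eq_square)
    also have "\<dots> > 0" using \<beta> by simp
    finally show ?thesis by simp
  qed
  obtain C where C: "C \<ge> 0" "\<forall>\<sigma>\<in>{a..b}. \<forall>T\<ge>1. \<forall>N0\<ge>1. \<forall>N\<ge>N0. T \<le> real N \<longrightarrow> T * (T / real N) ^ (2 * m) \<le> 1 \<longrightarrow>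
    integral {-T..T} (\<lambda>t. (norm (riemann_zeta (of_real \<sigma> + \<i> * of_real t)
        - (\<Sum>n\<in>{1..<N0}. of_nat n powr (- (of_real \<sigma> + \<i> * of_real t)))))\<^sup>2)
     \<le> C * (T * (\<Sum>n. real (n + N0) powr (- 2 * a)) + real N powr \<beta>)"
    using zeta_mean_square_aux[OF ab d m(1)] unfolding \<beta>_def by blast
  show ?thesis
  proof (rule that[of "C * 2" \<kappa>])
    show "C * 2 \<ge> 0" "\<kappa> < 1" using C \<kappa> by auto
    fix \<sigma> T :: real and N0 :: nat
    assume \<sigma>: "a \<le> \<sigma>" "\<sigma> \<le> b" and T: "T \<ge> 1" and N0: "N0 \<ge> 1" "real N0 \<le> T"
    define N where "N = nat \<lceil>T powr (1 + \<eta>)\<rceil>"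
    have N: "T powr (1 + \<eta>) \<le> real N" "real N \<le> T powr (1 + \<eta>) + 1"
    proof -
      have "real N = of_int \<lceil>T powr (1 + \<eta>)\<rceil>" unfolding N_def by (simp add: ceiling_mono[of 0, simplified])
      then show "T powr (1 + \<eta>) \<le> real N" "real N \<le> T powr (1 + \<eta>) + 1"
        using ceiling_correct[of "T powr (1 + \<eta>)"] by linarith+
    qed
    have "T = T powr 1" using T by simp
    also have "\<dots> \<le> T powr (1 + \<eta>)" using T \<eta> by (intro powr_mono) auto
    finally have TN: "T \<le> T powr (1 + \<eta>)" .
    have N2: "real N \<le> 2 * T powr (1 + \<eta>)" using N TN T by linarith
    have c1: "N \<ge> N0" "T \<le> real N" using N(1) TN N0 by linarith+
    have "T / real N \<le> T / T powr (1 + \<eta>)" using N(1) T TN by (intro divide_left_mono mult_pos_pos) auto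
    also have "\<dots> = T powr (- \<eta>)" using T by (simp add: powr_add powr_minus field_simps)
    finally have "(T / real N) ^ (2 * m) \<le> (T powr (- \<eta>)) ^ (2 * m)" using T by (intro power_mono) auto
    also have "\<dots> = T powr (- \<eta> * real (2 * m))" using T by (simp add: powr_power mult_ac)
    finally have "T * (T / real N) ^ (2 * m) \<le> T powr 1 * T powr (- \<eta> * real (2 * m))"
      using T by (intro mult_mono) auto
    also have "\<dots> = T powr (1 - 2 * real m * \<eta>)" unfolding powr_add[symmetric] by (simp add: mult_ac)
    also have "\<dots> \<le> T powr 0" using T m2 by (intro powr_mono) auto
    finally have c2: "T * (T / real N) ^ (2 * m) \<le> 1" using T by simp
    have "real N powr \<beta> \<le> (2 * T powr (1 + \<eta>)) powr \<beta>" using N2 \<beta> by (intro powr_mono2) auto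
    also have "\<dots> = 2 powr \<beta> * T powr \<kappa>" by (simp add: powr_mult powr_powr \<kappa>_def)
    also have "\<dots> \<le> 2 powr 1 * T powr \<kappa>" using \<beta> by (intro mult_right_mono powr_mono) auto
    finally have N3: "real N powr \<beta> \<le> 2 * T powr \<kappa>" by simp
    have S: "(\<Sum>n. real (n + N0) powr (- 2 * a)) \<ge> 0" using ab by (intro suminf_nonneg summable_shift_powr) auto
    have "integral {-T..T} (\<lambda>t. (norm (riemann_zeta (of_real \<sigma> + \<i> * of_real t)
        - (\<Sum>n\<in>{1..<N0}. of_nat n powr (- (of_real \<sigma> + \<i> * of_real t)))))\<^sup>2)
     \<le> C * (T * (\<Sum>n. real (n + N0) powr (- 2 * a)) + real N powr \<beta>)"
      using C(2) \<sigma> T N0 c1 c2 by auto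
    also have "\<dots> \<le> C * (2 * (T * (\<Sum>n. real (n + N0) powr (- 2 * a))) + 2 * T powr \<kappa>)"
    proof (intro mult_left_mono add_mono N3 C(1))
      have "0 \<le> T * (\<Sum>n. real (n + N0) powr (- 2 * a))" using S T by simp
      then show "T * (\<Sum>n. real (n + N0) powr (- 2 * a)) \<le> 2 * (T * (\<Sum>n. real (n + N0) powr (- 2 * a)))" by linarith
    qed
    finally show "integral {-T..T} (\<lambda>t. (norm (riemann_zeta (of_real \<sigma> + \<i> * of_real t)
        - (\<Sum>n\<in>{1..<N0}. of_nat n powr (- (of_real \<sigma> + \<i> * of_real t)))))\<^sup>2)
     \<le> C * 2 * (T * (\<Sum>n. real (n + N0) powr (- 2 * a)) + T powr \<kappa>)"
      by (simp add: algebra_simps)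
  qed
qed

section \<open>The infinite torus and its Haar measure\<close>

definition torus :: "(nat \<Rightarrow> complex) set" where
  "torus = PiE {p. prime p} (\<lambda>_. sphere 0 1)"

lemma topspace_Omega_top: "topspace Omega_top = torus"
  by (simp add: Omega_top_def torus_def)

text \<open>Off the primes every point of the torus has the fixed value \<open>undefined\<close>, so
  those coordinates are constant and the product topology over the primes is the trace of the
  product topology on all functions. This gives access to \<open>continuous_on\<close>,
  \<open>compact\<close> and Stone-Weierstrass.\<close>

lemma Omega_top_eq: "Omega_top = top_of_set torus"
proof -
  have 1: "continuous_map (top_of_set torus) Omega_top id"
    unfolding Omega_top_def continuous_map_componentwise
  proof (intro conjI ballI)
    show "id ` topspace (top_of_set torus) \<subseteq> extensional {p. prime p}"
      by (auto simp: torus_def PiE_def)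
    fix p :: nat assume "p \<in> {p. prime p}"
    then show "continuous_map (top_of_set torus) (top_of_set (sphere 0 1)) (\<lambda>x. id x p)"
      by (auto simp: continuous_map_in_subtopology torus_def intro: continuous_on_product_then_coordinatewise)
  qed
  have "continuous_map Omega_top (product_topology (\<lambda>_. euclidean) UNIV) id"
    unfolding continuous_map_componentwise
  proof (intro conjI ballI)
    fix p :: nat
    show "continuous_map Omega_top euclidean (\<lambda>x. id x p)"
    proof (cases "prime p")
      case True
      then have "continuous_map Omega_top (top_of_set (sphere 0 1)) (\<lambda>x. x p)"
        unfolding Omega_top_def by (intro continuous_map_product_projection) simp
      then show ?thesis by (simp add: continuous_map_in_subtopology)
    next
      case False
      have "continuous_map Omega_top euclidean (\<lambda>x. undefined :: complex)" by simp
      then show ?thesis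
        by (rule continuous_map_eq) (use False in \<open>auto simp: topspace_Omega_top torus_def PiE_def extensional_def\<close>)
    qed
  qed auto
  then have 2: "continuous_map Omega_top (top_of_set torus) id"
    by (simp add: euclidean_product_topology continuous_map_in_subtopology topspace_Omega_top)
  have sub: "U \<subseteq> torus" if "openin Omega_top U \<or> openin (top_of_set torus) U" for U
    using that openin_subset[of Omega_top U] openin_subset[of "top_of_set torus" U]
    by (auto simp: topspace_Omega_top)
  show ?thesis
  proof (rule topology_eq[THEN iffD2], intro allI iffI)
    fix U assume U: "openin Omega_top U"
    from openin_continuous_map_preimage[OF 1 this] show "openin (top_of_set torus) U"
      using sub[of U] U by (simp add: Int_absorb1 Collect_conj_eq)
  next
    fix U assume U: "openin (top_of_set torus) U"
    from openin_continuous_map_preimage[OF 2 this] show "openin Omega_top U"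
      using sub[of U] U by (simp add: Int_absorb1 Collect_conj_eq topspace_Omega_top)
  qed
qed

lemma compact_torus: "compact torus"
proof -
  have "compact_space Omega_top"
    unfolding Omega_top_def by (simp add: compact_space_product_topology compact_space_subtopology)
  then show ?thesis unfolding Omega_top_eq by (simp add: compact_space_def compactin_subtopology)
qed

lemma continuous_map_Omega_top [simp]:
  "continuous_map Omega_top euclidean f \<longleftrightarrow> continuous_on torus f"
  by (simp add: Omega_top_eq)

lemma space_borel_of [simp]: "space (borel_of X) = topspace X"
  unfolding borel_of_def by (rule space_measure_of) (use openin_subset in auto)

lemma sets_borel_of: "sets (borel_of X) = sigma_sets (topspace X) {U. openin X U}"
  unfolding borel_of_def by (rule sets_measure_of) (use openin_subset in auto)

lemma borel_of_openin: "openin X U \<Longrightarrow> U \<in> sets (borel_of X)"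
  by (auto simp: sets_borel_of)

lemma borel_of_closedin: "closedin X U \<Longrightarrow> U \<in> sets (borel_of X)"
proof -
  assume "closedin X U"
  then have "topspace X - U \<in> sets (borel_of X)" "U \<subseteq> topspace X"
    by (auto intro!: borel_of_openin simp: closedin_def)
  then have "space (borel_of X) - (topspace X - U) \<in> sets (borel_of X)" by (intro sets.compl_sets)
  then show ?thesis using \<open>U \<subseteq> topspace X\<close> by (simp add: double_diff)
qed

lemma borel_measurable_continuous_map:
  assumes "continuous_map X euclidean f"
  shows "f \<in> borel_measurable (borel_of X)"
proof (rule borel_measurableI)
  fix S :: "'b set" assume "open S"
  then have "openin X {x \<in> topspace X. f x \<in> S}"
    using openin_continuous_map_preimage[OF assms] by simp
  then show "f -` S \<inter> space (borel_of X) \<in> sets (borel_of X)"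
    using borel_of_openin by (simp add: vimage_def Int_def conj_commute)
qed

section \<open>The completely multiplicative extension of a point of the torus\<close>

lemma Omega_ext_superset:
  assumes "finite A" "prime_factors n \<subseteq> A" "\<And>p. p \<in> A \<Longrightarrow> prime p" "n > 0"
  shows "Omega_ext \<omega> n = (\<Prod>p\<in>A. \<omega> p ^ multiplicity p n)"
  unfolding Omega_ext_def
proof (rule prod.mono_neutral_left)
  show "\<forall>p\<in>A - prime_factors n. \<omega> p ^ multiplicity p n = 1"
  proof
    fix p assume "p \<in> A - prime_factors n"
    then have "prime p" "\<not> p dvd n" using assms by (auto simp: prime_factors_dvd)
    then show "\<omega> p ^ multiplicity p n = 1" by (simp add: not_dvd_imp_multiplicity_0)
  qed
qed (use assms in auto)

lemma Omega_ext_mult: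
  assumes "m > 0" "n > 0"
  shows "Omega_ext \<omega> (m * n) = Omega_ext \<omega> m * Omega_ext \<omega> n"
proof -
  define A where "A = prime_factors m \<union> prime_factors n"
  have A: "finite A" "prime_factors m \<subseteq> A" "prime_factors n \<subseteq> A" "prime_factors (m * n) \<subseteq> A" "\<And>p. p \<in> A \<Longrightarrow> prime p"
    using assms by (auto simp: A_def prime_factors_product)
  have "multiplicity p (m * n) = multiplicity p m + multiplicity p n" if "p \<in> A" for p
    using A(5)[OF that] assms by (intro prime_elem_multiplicity_mult_distrib) auto
  then show ?thesis
    using A assms by (simp add: Omega_ext_superset[of A] power_add prod.distrib)
qed

lemma Omega_ext_1 [simp]: "Omega_ext \<omega> (Suc 0) = 1" "Omega_ext \<omega> 1 = 1"
  by (auto simp: Omega_ext_def)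

lemma Omega_ext_prime: "prime p \<Longrightarrow> Omega_ext \<omega> p = \<omega> p"
  by (simp add: Omega_ext_def prime_factorization_prime)

lemma norm_Omega_ext: "\<omega> \<in> torus \<Longrightarrow> norm (Omega_ext \<omega> n) = 1"
  unfolding Omega_ext_def prod_norm[symmetric] norm_power
  by (intro prod.neutral) (auto simp: torus_def PiE_def Pi_def)

lemma Omega_ext_Omega_mult:
  "Omega_ext (Omega_mult \<alpha> \<omega>) n = Omega_ext \<alpha> n * Omega_ext \<omega> n"
  unfolding Omega_ext_def prod.distrib[symmetric]
  by (intro prod.cong refl) (auto simp: Omega_mult_def power_mult_distrib in_prime_factors_iff)

lemma Omega_power_Omega_mult:
  "Omega_power (Omega_mult \<alpha> \<omega>) j = Omega_mult (Omega_power \<alpha> j) (Omega_power \<omega> j)"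
  by (auto simp: Omega_power_def Omega_mult_def power_int_mult_distrib)

lemma Omega_power_torus: "\<omega> \<in> torus \<Longrightarrow> Omega_power \<omega> j \<in> torus"
  by (auto simp: torus_def Omega_power_def norm_power_int PiE_def Pi_def)

lemma Omega_mult_torus: "\<alpha> \<in> torus \<Longrightarrow> \<omega> \<in> torus \<Longrightarrow> Omega_mult \<alpha> \<omega> \<in> torus"
  by (auto simp: torus_def Omega_mult_def norm_mult PiE_def Pi_def)

lemma continuous_on_coord: "continuous_on S (\<lambda>\<omega> :: nat \<Rightarrow> complex. \<omega> p)"
  by (rule continuous_on_product_then_coordinatewise) (rule continuous_on_id)

lemma torus_nonzero: "\<omega> \<in> torus \<Longrightarrow> prime p \<Longrightarrow> \<omega> p \<noteq> 0"
  by (auto simp: torus_def PiE_def Pi_def)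

lemma continuous_on_Omega_ext_power:
  "continuous_on torus (\<lambda>\<omega>. Omega_ext (Omega_power \<omega> j) n)"
proof -
  have "continuous_on torus (\<lambda>\<omega>. \<Prod>p\<in>prime_factors n. (\<omega> p powi j) ^ multiplicity p n)"
  proof (intro continuous_on_prod continuous_on_power)
    fix p assume "p \<in> prime_factors n"
    then have "prime p" by auto
    \<comment> \<open>Negative j is covered, as coordinates at primes do not vanish on the
      torus.\<close>
    then show "continuous_on torus (\<lambda>\<omega>. \<omega> p powi j)"
      using torus_nonzero by (intro continuous_on_power_int continuous_on_coord) auto
  qed
  moreover have "Omega_ext (Omega_power \<omega> j) n = (\<Prod>p\<in>prime_factors n. (\<omega> p powi j) ^ multiplicity p n)" for \<omega>
    unfolding Omega_ext_def Omega_power_def by (intro prod.cong refl) (auto simp: in_prime_factors_iff)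
  ultimately show ?thesis by simp
qed

lemma Omega_power_1: "\<omega> \<in> torus \<Longrightarrow> Omega_power \<omega> 1 = \<omega>"
  by (auto simp: Omega_power_def torus_def PiE_def extensional_def)

lemma continuous_on_Omega_ext: "continuous_on torus (\<lambda>\<omega>. Omega_ext \<omega> n)"
  using continuous_on_Omega_ext_power[of 1 n]
  by (rule continuous_on_cong[THEN iffD1, rotated -1]) (simp_all add: Omega_power_1)

section \<open>The line of points p^(-i\<tau>)\<close>

definition torus_line :: "real \<Rightarrow> nat \<Rightarrow> complex" where
  "torus_line \<tau> = (\<lambda>p\<in>{p. prime p}. of_nat p powr (- (\<i> * of_real \<tau>)))"

lemma torus_line_torus: "torus_line \<tau> \<in> torus"
proof -
  have "norm ((of_nat p :: complex) powr (- (\<i> * of_real \<tau>))) = 1" if "prime p" for p :: nat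
    using prime_gt_0_nat[OF that] by (subst norm_nat_powr) auto
  then show ?thesis by (auto simp: torus_line_def torus_def)
qed

text \<open>This is why integers j and k matter: the shift by j\<tau> is the j-th power of the point
  belonging to \<tau>, so both shifts of zeta are functions of one point on the line.\<close>

lemma torus_line_power: "Omega_power (torus_line \<tau>) j = torus_line (of_int j * \<tau>)"
proof
  fix p
  show "Omega_power (torus_line \<tau>) j p = torus_line (of_int j * \<tau>) p"
    using prime_gt_0_nat[of p]
    by (auto simp: Omega_power_def torus_line_def powr_def exp_power_int mult_ac)
qed

text \<open>Unique factorization in the form ln n = sum of v(n;p) ln p. All powers are first written
  as \<open>cis\<close> of real numbers, so that no branch of the complex logarithm has to be
  followed.\<close>

lemma Omega_ext_torus_line:
  assumes "n \<ge> 1"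
  shows "Omega_ext (torus_line \<tau>) n = of_nat n powr (- (\<i> * of_real \<tau>))"
proof -
  have "Omega_ext (torus_line \<tau>) n = (\<Prod>p\<in>prime_factors n. cis (- \<tau> * (real (multiplicity p n) * ln (real p))))"
    unfolding Omega_ext_def
  proof (intro prod.cong refl)
    fix p assume "p \<in> prime_factors n"
    then have "prime p" by auto
    then have "torus_line \<tau> p = cis (- \<tau> * ln (real p))"
      using prime_gt_0_nat[of p] by (simp add: torus_line_def nat_powr_it)
    then show "torus_line \<tau> p ^ multiplicity p n = cis (- \<tau> * (real (multiplicity p n) * ln (real p)))"
      by (simp only: Complex.DeMoivre) (simp add: mult_ac)
  qed
  also have "\<dots> = cis (\<Sum>p\<in>prime_factors n. - \<tau> * (real (multiplicity p n) * ln (real p)))"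
    unfolding cis_conv_exp by (simp add: exp_sum sum_distrib_left)
  also have "(\<Sum>p\<in>prime_factors n. - \<tau> * (real (multiplicity p n) * ln (real p))) = - \<tau> * ln (real n)"
  proof -
    have "real n = (\<Prod>p\<in>prime_factors n. real p ^ multiplicity p n)"
      using prime_factorization_nat[of n] assms by (metis (no_types, lifting) of_nat_power of_nat_prod prod.cong not_one_le_zero gr0I)
    then have "ln (real n) = ln (\<Prod>p\<in>prime_factors n. real p ^ multiplicity p n)" by simp
    also have "\<dots> = (\<Sum>p\<in>prime_factors n. ln (real p ^ multiplicity p n))"
      by (rule ln_prod) (auto simp: in_prime_factors_iff prime_gt_0_nat)
    also have "\<dots> = (\<Sum>p\<in>prime_factors n. real (multiplicity p n) * ln (real p))"
      by (intro sum.cong refl ln_realpow)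
    finally show ?thesis by (simp add: sum_distrib_left)
  qed
  finally show ?thesis using assms by (simp add: nat_powr_it)
qed

section \<open>Integration against Haar measure\<close>

locale haar_torus =
  fixes M :: "(nat \<Rightarrow> complex) measure"
  assumes haar: "Omega_haar_prob M"
begin

sublocale prob_space M
  using haar by (simp add: Omega_haar_prob_def)

lemma sets_M: "sets M = sets (borel_of Omega_top)"
  using haar by (simp add: Omega_haar_prob_def)

lemma space_M: "space M = torus"
  using sets_eq_imp_space_eq[OF sets_M] by (simp add: topspace_Omega_top)

lemma measurable_continuous:
  fixes f :: "(nat \<Rightarrow> complex) \<Rightarrow> 'b::topological_space"
  assumes "continuous_on torus f"
  shows "f \<in> borel_measurable M"
  using borel_measurable_continuous_map[of Omega_top f] assms measurable_cong_sets[OF sets_M refl, of borel] by auto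

lemma integrable_continuous:
  fixes f :: "(nat \<Rightarrow> complex) \<Rightarrow> 'b::{banach, second_countable_topology}"
  assumes "continuous_on torus f"
  shows "integrable M f"
proof -
  have "bounded (f ` torus)" using assms compact_torus by (intro compact_imp_bounded compact_continuous_image)
  then obtain B where "\<And>\<omega>. \<omega> \<in> torus \<Longrightarrow> norm (f \<omega>) \<le> B" by (auto simp: bounded_iff)
  then show ?thesis
    using measurable_continuous[OF assms] by (intro integrable_const_bound[where B = B]) (auto simp: space_M)
qed

text \<open>Invariance is assumed for images of sets, whereas the image measure is computed from
  preimages. The pointwise inverse \<beta> of \<alpha> bridges this: the preimage of A under
  translation by \<alpha> is the image of A under translation by \<beta>.\<close>

lemma integral_translation:
  fixes f :: "(nat \<Rightarrow> complex) \<Rightarrow> complex"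
  assumes "\<alpha> \<in> torus" "continuous_on torus f"
  shows "(\<integral>\<omega>. f (Omega_mult \<alpha> \<omega>) \<partial>M) = (\<integral>\<omega>. f \<omega> \<partial>M)"
proof -
  define \<beta> where "\<beta> = Omega_power \<alpha> (-1)"
  have \<beta>: "\<beta> \<in> torus" using assms(1) by (simp add: \<beta>_def Omega_power_torus)
  have inv: "Omega_mult \<beta> (Omega_mult \<alpha> \<omega>) = \<omega>" "Omega_mult \<alpha> (Omega_mult \<beta> \<omega>) = \<omega>" if "\<omega> \<in> torus" for \<omega>
    using that torus_nonzero[OF assms(1)]
    by (auto simp: Omega_mult_def \<beta>_def Omega_power_def power_int_minus torus_def PiE_def extensional_def fun_eq_iff)
  have meas: "Omega_mult \<alpha> \<in> measurable M M"
  proof -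
    have "continuous_map (top_of_set torus) (top_of_set torus) (Omega_mult \<alpha>)"
      unfolding continuous_map_in_subtopology
    proof
      show "Omega_mult \<alpha> \<in> topspace (top_of_set torus) \<rightarrow> torus" using Omega_mult_torus assms(1) by auto
      have "continuous_on torus (Omega_mult \<alpha>)"
      proof (rule continuous_on_coordinatewise_then_product)
        fix p
        show "continuous_on torus (\<lambda>\<omega>. Omega_mult \<alpha> \<omega> p)"
          by (cases "prime p") (auto simp: Omega_mult_def intro!: continuous_intros continuous_on_coord)
      qed
      then show "continuous_map (top_of_set torus) euclidean (Omega_mult \<alpha>)" by simp
    qed
    then have c: "continuous_map Omega_top Omega_top (Omega_mult \<alpha>)" by (simp add: Omega_top_eq)
    have "Omega_mult \<alpha> \<in> measurable M (borel_of Omega_top)"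
      unfolding borel_of_def
    proof (rule measurable_measure_of)
      show "{U. openin Omega_top U} \<subseteq> Pow (topspace Omega_top)" using openin_subset by auto
      show "Omega_mult \<alpha> \<in> space M \<rightarrow> topspace Omega_top"
        using Omega_mult_torus assms(1) by (auto simp: space_M topspace_Omega_top)
      fix U assume "U \<in> {U. openin Omega_top U}"
      then have "openin Omega_top {x \<in> topspace Omega_top. Omega_mult \<alpha> x \<in> U}"
        using openin_continuous_map_preimage[OF c] by simp
      then show "Omega_mult \<alpha> -` U \<inter> space M \<in> sets M"
        using borel_of_openin by (simp add: sets_M vimage_def Int_def conj_commute space_M topspace_Omega_top)
    qed
    then show ?thesis using measurable_cong_sets[OF refl sets_M, of M] by simp
  qed
  have "distr M M (Omega_mult \<alpha>) = M"
  proof (rule measure_eqI)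
    fix A assume "A \<in> sets (distr M M (Omega_mult \<alpha>))"
    then have A: "A \<in> sets M" by simp
    then have sub: "A \<subseteq> torus" using sets.sets_into_space space_M by blast
    have "Omega_mult \<alpha> -` A \<inter> space M = Omega_mult \<beta> ` A"
    proof (intro equalityI subsetI)
      fix \<omega> assume "\<omega> \<in> Omega_mult \<alpha> -` A \<inter> space M"
      then show "\<omega> \<in> Omega_mult \<beta> ` A" using inv(1)[of \<omega>] by (auto simp: space_M image_iff intro!: bexI[of _ "Omega_mult \<alpha> \<omega>"])
    next
      fix \<omega> assume "\<omega> \<in> Omega_mult \<beta> ` A"
      then show "\<omega> \<in> Omega_mult \<alpha> -` A \<inter> space M" using sub inv(2) \<beta> Omega_mult_torus by (auto simp: space_M)
    qed
    moreover have "emeasure M (Omega_mult \<beta> ` A) = emeasure M A"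
      using haar \<beta> A by (auto simp: Omega_haar_prob_def topspace_Omega_top)
    ultimately show "emeasure (distr M M (Omega_mult \<alpha>)) A = emeasure M A"
      using meas A by (simp add: emeasure_distr)
  qed simp
  then show ?thesis
    using integral_distr[OF meas measurable_continuous[OF assms(2)]] by simp
qed

text \<open>For m \<noteq> n some prime p has different exponents in m and n. A translation that
  moves only the coordinate p multiplies the integrand by -1, so by invariance the integral equals
  its own negative.\<close>

lemma orthogonality:
  assumes "j \<noteq> 0" "m > 0" "n > 0"
  shows "(\<integral>\<omega>. Omega_ext (Omega_power \<omega> j) m * cnj (Omega_ext (Omega_power \<omega> j) n) \<partial>M) = (if m = n then 1 else 0)"
proof (cases "m = n")
  case True
  have "(\<integral>\<omega>. Omega_ext (Omega_power \<omega> j) m * cnj (Omega_ext (Omega_power \<omega> j) n) \<partial>M) = (\<integral>\<omega>. 1 \<partial>M)"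
  proof (rule Bochner_Integration.integral_cong[OF refl])
    fix \<omega> assume "\<omega> \<in> space M"
    then have "norm (Omega_ext (Omega_power \<omega> j) n) = 1" by (intro norm_Omega_ext Omega_power_torus) (simp add: space_M)
    then show "Omega_ext (Omega_power \<omega> j) m * cnj (Omega_ext (Omega_power \<omega> j) n) = 1"
      using True complex_norm_square[of "Omega_ext (Omega_power \<omega> j) n"] by simp
  qed
  then show ?thesis using True by (simp add: prob_space)
next
  case False
  then obtain p where p: "prime p" "multiplicity p m \<noteq> multiplicity p n"
    using multiplicity_eq_nat[of m n] assms by auto
  define d where "d = real (multiplicity p m) - real (multiplicity p n)"
  have d: "d \<noteq> 0" using p by (simp add: d_def)
  \<comment> \<open>The j-th power of this coordinate has angle pi/d, and d is the difference of the
    exponents of p, so the total angle is pi. Here j must be nonzero.\<close>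
  define \<alpha> where "\<alpha> = (\<lambda>q\<in>{q. prime q}. if q = p then cis (pi / (of_int j * d)) else 1)"
  have \<alpha>: "\<alpha> \<in> torus" by (auto simp: \<alpha>_def torus_def)
  have ext: "Omega_ext (Omega_power \<alpha> j) k = cis (real (multiplicity p k) * (pi / d))" if "k > 0" for k
  proof -
    have A: "finite (insert p (prime_factors k))" "prime_factors k \<subseteq> insert p (prime_factors k)"
      "\<And>q. q \<in> insert p (prime_factors k) \<Longrightarrow> prime q" using p by auto
    have pw: "Omega_power \<alpha> j q = (if q = p then cis (pi / d) else 1)" if "prime q" for q
    proof -
      have "cis (pi / (of_int j * d)) powi j = cis (pi / d)"
        using assms(1) unfolding cis_conv_exp exp_power_int by (simp add: field_simps)
      then show ?thesis using that by (simp add: Omega_power_def \<alpha>_def)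
    qed
    have "Omega_ext (Omega_power \<alpha> j) k = (\<Prod>q\<in>insert p (prime_factors k). Omega_power \<alpha> j q ^ multiplicity q k)"
      by (rule Omega_ext_superset[OF A that])
    also have "\<dots> = (\<Prod>q\<in>insert p (prime_factors k). if q = p then cis (pi / d) ^ multiplicity p k else 1)"
      using A(3) by (intro prod.cong refl) (auto simp: pw)
    also have "\<dots> = cis (pi / d) ^ multiplicity p k" using A(1) by (subst prod.delta) auto
    finally show ?thesis by (simp only: Complex.DeMoivre)
  qed
  let ?f = "\<lambda>\<omega>. Omega_ext (Omega_power \<omega> j) m * cnj (Omega_ext (Omega_power \<omega> j) n)"
  have tr: "?f (Omega_mult \<alpha> \<omega>) = - ?f \<omega>" for \<omega>
  proof -
    have "?f (Omega_mult \<alpha> \<omega>) = (cis (real (multiplicity p m) * (pi / d)) * cis (- (real (multiplicity p n) * (pi / d)))) * ?f \<omega>"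
      using assms by (simp add: Omega_power_Omega_mult Omega_ext_Omega_mult ext cis_cnj)
    also have "cis (real (multiplicity p m) * (pi / d)) * cis (- (real (multiplicity p n) * (pi / d))) = cis pi"
    proof -
      have "x * y + - (z * y) = (x - z) * y" for x y z :: real by (simp add: algebra_simps)
      then show ?thesis unfolding cis_mult using d by (simp only: d_def[symmetric]) simp
    qed
    finally show ?thesis by simp
  qed
  have "(\<integral>\<omega>. ?f (Omega_mult \<alpha> \<omega>) \<partial>M) = (\<integral>\<omega>. ?f \<omega> \<partial>M)"
    by (intro integral_translation \<alpha> continuous_intros continuous_on_Omega_ext_power)
  then have "- (\<integral>\<omega>. ?f \<omega> \<partial>M) = (\<integral>\<omega>. ?f \<omega> \<partial>M)" unfolding tr by simp
  then show ?thesis using False by simp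
qed

text \<open>Parseval's identity for the orthonormal family \<omega> ->
  \<open>Omega_ext (Omega_power \<omega> j) n\<close>.\<close>

lemma second_moment:
  assumes "j \<noteq> 0" "finite A" "\<And>n. n \<in> A \<Longrightarrow> n > 0"
  shows "(\<integral>\<omega>. (norm (\<Sum>n\<in>A. Omega_ext (Omega_power \<omega> j) n * c n))\<^sup>2 \<partial>M) = (\<Sum>n\<in>A. (norm (c n))\<^sup>2)"
proof -
  let ?X = "\<lambda>n \<omega>. Omega_ext (Omega_power \<omega> j) n"
  have eq: "complex_of_real ((norm (\<Sum>n\<in>A. ?X n \<omega> * c n))\<^sup>2) = (\<Sum>m\<in>A. \<Sum>n\<in>A. (c m * cnj (c n)) * (?X m \<omega> * cnj (?X n \<omega>)))" for \<omega>
    unfolding complex_norm_square by (simp add: sum_product mult_ac)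
  have "complex_of_real (\<integral>\<omega>. (norm (\<Sum>n\<in>A. ?X n \<omega> * c n))\<^sup>2 \<partial>M) = (\<integral>\<omega>. complex_of_real ((norm (\<Sum>n\<in>A. ?X n \<omega> * c n))\<^sup>2) \<partial>M)"
    by (rule integral_complex_of_real[symmetric])
  also have "\<dots> = (\<Sum>m\<in>A. \<Sum>n\<in>A. (c m * cnj (c n)) * (\<integral>\<omega>. ?X m \<omega> * cnj (?X n \<omega>) \<partial>M))"
  proof -
    have i: "integrable M (\<lambda>\<omega>. (c m * cnj (c n)) * (?X m \<omega> * cnj (?X n \<omega>)))" for m n
      by (intro integrable_continuous continuous_intros continuous_on_Omega_ext_power)
    have "(\<integral>\<omega>. (\<Sum>m\<in>A. \<Sum>n\<in>A. (c m * cnj (c n)) * (?X m \<omega> * cnj (?X n \<omega>))) \<partial>M) = (\<Sum>m\<in>A. \<Sum>n\<in>A. (\<integral>\<omega>. (c m * cnj (c n)) * (?X m \<omega> * cnj (?X n \<omega>)) \<partial>M))"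
    proof -
      have "(\<integral>\<omega>. (\<Sum>m\<in>A. \<Sum>n\<in>A. (c m * cnj (c n)) * (?X m \<omega> * cnj (?X n \<omega>))) \<partial>M) = (\<Sum>m\<in>A. (\<integral>\<omega>. (\<Sum>n\<in>A. (c m * cnj (c n)) * (?X m \<omega> * cnj (?X n \<omega>))) \<partial>M))"
        by (intro Bochner_Integration.integral_sum Bochner_Integration.integrable_sum i)
      also have "\<dots> = (\<Sum>m\<in>A. \<Sum>n\<in>A. (\<integral>\<omega>. (c m * cnj (c n)) * (?X m \<omega> * cnj (?X n \<omega>)) \<partial>M))"
        by (intro sum.cong refl Bochner_Integration.integral_sum i)
      finally show ?thesis .
    qed
    then show ?thesis unfolding eq by simp
  qed
  also have "\<dots> = (\<Sum>m\<in>A. \<Sum>n\<in>A. if m = n then complex_of_real ((norm (c m))\<^sup>2) else 0)"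
    using assms by (intro sum.cong refl) (auto simp: orthogonality complex_norm_square simp del: of_real_power)
  also have "\<dots> = complex_of_real (\<Sum>n\<in>A. (norm (c n))\<^sup>2)" using assms(2) by (simp add: sum.delta)
  finally show ?thesis by (simp only: of_real_eq_iff)
qed

end

text \<open>Rademacher--Menshov: because \<open>(x + y)\<^sup>2 \<le> (k + 2) x\<^sup>2 + (1 + 1/(k+1)) y\<^sup>2\<close>, splitting an interval of
  length \<open>2\<^bsup>k+1\<^esup>\<close> in halves bounds the maximal partial sum with second moment at most \<open>(k+1)\<^sup>2 2\<^sup>k\<close>.\<close>

primrec dyadic_majorant :: "int \<Rightarrow> nat \<Rightarrow> nat \<Rightarrow> (nat \<Rightarrow> complex) \<Rightarrow> real" where
  "dyadic_majorant j 0 a \<omega> = (norm (\<Sum>n\<in>{a..<a+1}. Omega_ext (Omega_power \<omega> j) n))\<^sup>2"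
| "dyadic_majorant j (Suc k) a \<omega> = real (k + 2) * (norm (\<Sum>n\<in>{a..<a+2^k}. Omega_ext (Omega_power \<omega> j) n))\<^sup>2
     + (1 + 1 / real (k + 1)) * (dyadic_majorant j k a \<omega> + dyadic_majorant j k (a + 2^k) \<omega>)"

lemma dyadic_majorant_nonneg: "dyadic_majorant j k a \<omega> \<ge> 0"
  by (induction k arbitrary: a) (auto intro!: add_nonneg_nonneg mult_nonneg_nonneg)

text \<open>A sum longer than half the dyadic interval is the complete first half plus an initial
  sum of the second half, to which induction applies. The majorant does not depend on L, so it
  controls all partial sums at once.\<close>

lemma dyadic_majorant_bound:
  "L \<le> 2 ^ k \<Longrightarrow> (norm (\<Sum>n\<in>{a..<a+L}. Omega_ext (Omega_power \<omega> j) n))\<^sup>2 \<le> dyadic_majorant j k a \<omega>"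
proof (induction k arbitrary: a L)
  case 0
  then have "L = 0 \<or> L = 1" by auto
  then show ?case by auto
next
  case (Suc k)
  let ?S = "\<lambda>a L. \<Sum>n\<in>{a..<a+L}. Omega_ext (Omega_power \<omega> j) n"
  have c: "1 + 1 / real (k + 1) \<ge> 1" by simp
  show ?case
  proof (cases "L \<le> 2 ^ k")
    case True
    have "(norm (?S a L))\<^sup>2 \<le> 1 * (dyadic_majorant j k a \<omega> + 0) + 0" using Suc.IH[OF True] by simp
    also have "\<dots> \<le> (1 + 1 / real (k + 1)) * (dyadic_majorant j k a \<omega> + dyadic_majorant j k (a + 2^k) \<omega>) + real (k + 2) * (norm (?S a (2^k)))\<^sup>2"
      using c by (intro add_mono mult_mono) (auto simp: dyadic_majorant_nonneg intro!: add_nonneg_nonneg)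
    finally show ?thesis by simp
  next
    case False
    define L' where "L' = L - 2 ^ k"
    have L': "L = 2 ^ k + L'" "L' \<le> 2 ^ k" using False Suc.prems by (auto simp: L'_def)
    have "{a..<a+L} = {a..<a+2^k} \<union> {a+2^k..<a+2^k+L'}" using L' by auto
    then have split: "?S a L = ?S a (2^k) + ?S (a+2^k) L'"
      using sum.union_disjoint[of "{a..<a+2^k}" "{a+2^k..<a+2^k+L'}"] by auto
    have ineq: "(x + y)\<^sup>2 \<le> real (k + 2) * x\<^sup>2 + (1 + 1 / real (k + 1)) * y\<^sup>2" for x y :: real
    proof -
      have "0 \<le> (real (k + 1) * x - y)\<^sup>2 / real (k + 1)" by simp
      also have "\<dots> = real (k + 1) * x\<^sup>2 - 2 * x * y + y\<^sup>2 / real (k + 1)"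
        by (simp add: power2_diff power_mult_distrib field_simps power2_eq_square del: of_nat_Suc of_nat_add)
      finally show ?thesis by (simp add: power2_sum algebra_simps)
    qed
    have "(norm (?S a L))\<^sup>2 \<le> (norm (?S a (2^k)) + norm (?S (a+2^k) L'))\<^sup>2"
      unfolding split by (intro power_mono norm_triangle_ineq) auto
    also have "\<dots> \<le> real (k + 2) * (norm (?S a (2^k)))\<^sup>2 + (1 + 1 / real (k + 1)) * (norm (?S (a+2^k) L'))\<^sup>2"
      by (rule ineq)
    also have "\<dots> \<le> real (k + 2) * (norm (?S a (2^k)))\<^sup>2 + (1 + 1 / real (k + 1)) * (dyadic_majorant j k a \<omega> + dyadic_majorant j k (a + 2^k) \<omega>)"
      using Suc.IH[OF L'(2), of "a + 2^k"] dyadic_majorant_nonneg[of j k a \<omega>]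
      by (intro add_mono mult_left_mono order.refl) auto
    finally show ?thesis by simp
  qed
qed

lemma dyadic_majorant_continuous: "continuous_on torus (dyadic_majorant j k a)"
proof (induction k arbitrary: a)
  case 0
  have "continuous_on torus (\<lambda>\<omega>. (norm (\<Sum>n\<in>{a..<a+1}. Omega_ext (Omega_power \<omega> j) n))\<^sup>2)"
    by (intro continuous_intros continuous_on_Omega_ext_power)
  then show ?case by simp
next
  case (Suc k)
  have "continuous_on torus (\<lambda>\<omega>. real (k + 2) * (norm (\<Sum>n\<in>{a..<a+2^k}. Omega_ext (Omega_power \<omega> j) n))\<^sup>2
     + (1 + 1 / real (k + 1)) * (dyadic_majorant j k a \<omega> + dyadic_majorant j k (a + 2^k) \<omega>))"
    by (intro continuous_on_add continuous_on_mult continuous_on_const continuous_on_power continuous_on_norm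
        continuous_on_sum continuous_on_Omega_ext_power Suc)
  then show ?case by simp
qed

context haar_torus
begin

text \<open>By orthogonality a full block of length 2^k has second moment 2^k. The weight fits since
  (1 + 1/(k+1)) (k+1)^2 = (k+1)(k+2), so the recursion gives (k+2)(2k+3) 2^k, below (k+2)^2
  2^(k+1).\<close>

lemma dyadic_majorant_expectation:
  assumes "j \<noteq> 0" "a \<ge> 1"
  shows "(\<integral>\<omega>. dyadic_majorant j k a \<omega> \<partial>M) \<le> (real k + 1)\<^sup>2 * 2 ^ k"
  using assms(2)
proof (induction k arbitrary: a)
  case 0
  then show ?case using second_moment[OF assms(1), of "{a..<a+1}" "\<lambda>_. 1"] by simp
next
  case (Suc k)
  have sm: "(\<integral>\<omega>. (norm (\<Sum>n\<in>{a..<a+2^k}. Omega_ext (Omega_power \<omega> j) n))\<^sup>2 \<partial>M) = 2 ^ k"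
    using second_moment[OF assms(1), of "{a..<a+2^k}" "\<lambda>_. 1"] Suc.prems by simp
  have i1: "integrable M (\<lambda>\<omega>. (norm (\<Sum>n\<in>{a..<a+2^k}. Omega_ext (Omega_power \<omega> j) n))\<^sup>2)"
    by (intro integrable_continuous continuous_intros continuous_on_Omega_ext_power)
  have i2: "integrable M (dyadic_majorant j k b)" for b
    by (intro integrable_continuous dyadic_majorant_continuous)
  have "(\<integral>\<omega>. dyadic_majorant j (Suc k) a \<omega> \<partial>M) = real (k + 2) * 2 ^ k + (1 + 1 / real (k + 1)) *
      ((\<integral>\<omega>. dyadic_majorant j k a \<omega> \<partial>M) + (\<integral>\<omega>. dyadic_majorant j k (a + 2^k) \<omega> \<partial>M))"
    using i1 i2 by (simp add: sm)
  also have "\<dots> \<le> real (k + 2) * 2 ^ k + (1 + 1 / real (k + 1)) * ((real k + 1)\<^sup>2 * 2 ^ k + (real k + 1)\<^sup>2 * 2 ^ k)"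
    using Suc.IH[of a] Suc.IH[of "a + 2^k"] Suc.prems by (intro add_left_mono mult_left_mono add_mono) auto
  also have "\<dots> = (real k + 2) * (2 * real k + 3) * 2 ^ k"
  proof -
    have "(1 + 1 / real (k + 1)) * (real k + 1)\<^sup>2 = (real k + 2) * (real k + 1)"
      by (simp add: field_simps power2_eq_square)
    then have "(1 + 1 / real (k + 1)) * ((real k + 1)\<^sup>2 * 2 ^ k + (real k + 1)\<^sup>2 * 2 ^ k) = 2 * ((real k + 2) * (real k + 1)) * 2 ^ k"
      by (metis (no_types, opaque_lifting) mult.assoc mult_2 mult.left_commute)
    then show ?thesis by (simp only:) (simp add: algebra_simps)
  qed
  also have "\<dots> \<le> (real k + 2) * (2 * real k + 4) * 2 ^ k" by (intro mult_right_mono mult_left_mono) auto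
  also have "\<dots> = (real (Suc k) + 1)\<^sup>2 * 2 ^ Suc k" by (simp add: power2_eq_square algebra_simps)
  finally show ?case .
qed

lemma AE_partial_sum_bound:
  assumes "j \<noteq> 0"
  shows "AE \<omega> in M. \<exists>C. \<forall>k L. L \<le> 2 ^ k \<longrightarrow> (norm (\<Sum>n\<in>{1..<1+L}. Omega_ext (Omega_power \<omega> j) n))\<^sup>2 \<le> C * ((real k + 1)^4 * 2 ^ k)"
proof -
  \<comment> \<open>The expectations (k+1)^2 2^k times this weight leave 1/(k+1)^2, which is
    summable. The series of weighted majorants is thus finite almost everywhere, and its value C
    bounds each of its terms.\<close>
  define w where "w = (\<lambda>k::nat. 1 / ((real k + 1)^4 * 2 ^ k))"
  have w: "w k > 0" for k by (simp add: w_def)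
  let ?G = "\<lambda>k \<omega>. w k * dyadic_majorant j k 1 \<omega>"
  have G0: "?G k \<omega> \<ge> 0" for k \<omega> using w[of k] dyadic_majorant_nonneg by simp
  have cont: "continuous_on torus (?G k)" for k
    by (intro continuous_on_mult continuous_on_const dyadic_majorant_continuous)
  have "(\<integral>\<^sup>+\<omega>. (\<Sum>k. ennreal (?G k \<omega>)) \<partial>M) = (\<Sum>k. \<integral>\<^sup>+\<omega>. ennreal (?G k \<omega>) \<partial>M)"
    using measurable_continuous[OF cont] by (intro nn_integral_suminf) auto
  also have "\<dots> \<le> (\<Sum>k. ennreal (1 / (real k + 1)\<^sup>2))"
  proof (intro suminf_le)
    fix k
    have "(\<integral>\<^sup>+\<omega>. ennreal (?G k \<omega>) \<partial>M) = ennreal (\<integral>\<omega>. ?G k \<omega> \<partial>M)"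
      using G0 integrable_continuous[OF cont] by (intro nn_integral_eq_integral) auto
    also have "(\<integral>\<omega>. ?G k \<omega> \<partial>M) \<le> w k * ((real k + 1)\<^sup>2 * 2 ^ k)"
      using dyadic_majorant_expectation[OF assms, of 1 k] w[of k] by (simp add: mult_left_mono)
    also have "\<dots> = 1 / (real k + 1)\<^sup>2"
    proof -
      have w_cancel: "1 / (x ^ 4 * y) * (x\<^sup>2 * y) = 1 / x\<^sup>2" if "x > 0" "y > 0" for x y :: real
        using that by (simp add: power4_eq_xxxx power2_eq_square)
      show ?thesis unfolding w_def by (rule w_cancel) auto
    qed
    finally show "(\<integral>\<^sup>+\<omega>. ennreal (?G k \<omega>) \<partial>M) \<le> ennreal (1 / (real k + 1)\<^sup>2)" by (simp add: ennreal_leI)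
  qed auto
  also have "\<dots> < \<infinity>"
  proof -
    have "summable (\<lambda>k. 1 / (real k + 1)\<^sup>2)"
      using inverse_power_summable[of 2] summable_Suc_iff[of "\<lambda>n. inverse (real n ^ 2)"]
      by (simp add: inverse_eq_divide add.commute)
    then have "(\<Sum>k. ennreal (1 / (real k + 1)\<^sup>2)) = ennreal (\<Sum>k. 1 / (real k + 1)\<^sup>2)"
      by (intro suminf_ennreal2) auto
    then show ?thesis by (metis ennreal_less_top infinity_ennreal_def)
  qed
  finally have fin: "(\<integral>\<^sup>+\<omega>. (\<Sum>k. ennreal (?G k \<omega>)) \<partial>M) \<noteq> \<infinity>" by simp
  have "AE \<omega> in M. (\<Sum>k. ennreal (?G k \<omega>)) \<noteq> \<infinity>"
  proof (intro nn_integral_PInf_AE fin)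
    have [measurable]: "dyadic_majorant j k 1 \<in> borel_measurable M" for k
      by (rule measurable_continuous[OF dyadic_majorant_continuous])
    show "(\<lambda>\<omega>. \<Sum>k. ennreal (?G k \<omega>)) \<in> borel_measurable M" by measurable
  qed
  then show ?thesis
  proof (rule eventually_mono)
    fix \<omega> assume "(\<Sum>k. ennreal (?G k \<omega>)) \<noteq> \<infinity>"
    then obtain C where C: "C \<ge> 0" "(\<Sum>k. ennreal (?G k \<omega>)) = ennreal C" by (cases "\<Sum>k. ennreal (?G k \<omega>)") auto
    have G: "?G k \<omega> \<le> C" for k
    proof -
      have "ennreal (?G k \<omega>) = (\<Sum>k\<in>{k}. ennreal (?G k \<omega>))" by simp
      also have "\<dots> \<le> ennreal C" unfolding C(2)[symmetric] by (intro sum_le_suminf) auto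
      finally show ?thesis using C by simp
    qed
    show "\<exists>C. \<forall>k L. L \<le> 2 ^ k \<longrightarrow> (norm (\<Sum>n\<in>{1..<1+L}. Omega_ext (Omega_power \<omega> j) n))\<^sup>2 \<le> C * ((real k + 1)^4 * 2 ^ k)"
    proof (intro exI[of _ C] allI impI)
      fix k L :: nat assume "L \<le> 2 ^ k"
      then have "(norm (\<Sum>n\<in>{1..<1+L}. Omega_ext (Omega_power \<omega> j) n))\<^sup>2 \<le> dyadic_majorant j k 1 \<omega>"
        by (rule dyadic_majorant_bound)
      also have "\<dots> \<le> C * ((real k + 1)^4 * 2 ^ k)"
        using G[of k] by (simp add: w_def divide_le_eq)
      finally show "(norm (\<Sum>n\<in>{1..<1+L}. Omega_ext (Omega_power \<omega> j) n))\<^sup>2 \<le> C * ((real k + 1)^4 * 2 ^ k)" .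
    qed
  qed
qed

end

section \<open>Almost sure convergence and equidistribution\<close>

lemma ex_dyadic_scale: "L \<ge> 1 \<Longrightarrow> \<exists>k. L \<le> 2 ^ k \<and> 2 ^ k \<le> 2 * (L::nat)"
proof (induction L rule: nat_induct_at_least)
  case base
  then show ?case by (auto intro!: exI[of _ 0])
next
  case (Suc L)
  then obtain k where k: "L \<le> 2 ^ k" "2 ^ k \<le> 2 * L" by blast
  show ?case
  proof (cases "Suc L \<le> 2 ^ k")
    case True
    then show ?thesis using k by (auto intro!: exI[of _ k])
  next
    case False
    then have "L = 2 ^ k" using k by simp
    then show ?thesis using Suc.hyps by (auto intro!: exI[of _ "Suc k"])
  qed
qed

text \<open>At the dyadic scale of L the power of k + 1 is only a power of log L, hence absorbed by
  L^\<epsilon>.\<close>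

lemma partial_sum_growth:
  fixes S :: "nat \<Rightarrow> complex"
  assumes S: "\<And>k L. L \<le> 2 ^ k \<Longrightarrow> (norm (S L))\<^sup>2 \<le> C * ((real k + 1)^4 * 2 ^ k)" and \<epsilon>: "\<epsilon> > 0"
  shows "\<exists>D\<ge>0. \<forall>L\<ge>1. norm (S L) \<le> D * real L powr (1/2 + \<epsilon>)"
proof -
  \<comment> \<open>Boundedness of (k+1) r^k says k + 1 \<le> B 2^(k\<epsilon>/2). The norm contains
    (k+1)^2, so the loss is 2^(k\<epsilon>).\<close>
  define r :: real where "r = 2 powr (- \<epsilon> / 2)"
  have r: "0 < r" "r < 1"
  proof -
    show "0 < r" by (simp add: r_def)
    have "2 powr (- \<epsilon> / 2) < 2 powr (0::real)" using \<epsilon> by (intro powr_less_mono) auto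
    then show "r < 1" by (simp add: r_def)
  qed
  have "(\<lambda>n. real n * r ^ n + r ^ n) \<longlonglongrightarrow> 0 + 0"
    using r by (intro tendsto_add powser_times_n_limit_0 LIMSEQ_power_zero) auto
  then have "Bseq (\<lambda>n. real n * r ^ n + r ^ n)" by (intro convergent_imp_Bseq) (auto simp: convergent_def)
  then obtain B where B: "B > 0" "\<And>n. norm (real n * r ^ n + r ^ n) \<le> B" by (auto simp: Bseq_def)
  have kB: "real k + 1 \<le> B * 2 powr (real k * \<epsilon> / 2)" for k
  proof -
    have "(real k + 1) * r ^ k \<le> B" using B(2)[of k] by (simp add: algebra_simps)
    moreover have "r ^ k = 1 / 2 powr (real k * \<epsilon> / 2)"
    proof -
      have "r ^ k = 2 powr (real k * (- \<epsilon> / 2))" unfolding r_def by (simp add: powr_power mult.commute)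
      also have "real k * (- \<epsilon> / 2) = - (real k * \<epsilon> / 2)" by simp
      finally show ?thesis by (simp add: powr_minus inverse_eq_divide)
    qed
    ultimately show ?thesis by (simp add: field_simps)
  qed
  define C' where "C' = max C 0"
  define D where "D = sqrt C' * B\<^sup>2 * 2 powr (1/2 + \<epsilon>)"
  show ?thesis
  proof (intro exI[of _ D] conjI allI impI)
    show "D \<ge> 0" by (simp add: D_def C'_def)
    fix L :: nat assume L: "L \<ge> 1"
    then obtain k where k: "L \<le> 2 ^ k" "2 ^ k \<le> 2 * L" using ex_dyadic_scale by blast
    have "(norm (S L))\<^sup>2 \<le> C * ((real k + 1)^4 * 2 ^ k)" by (rule S[OF k(1)])
    also have "\<dots> \<le> C' * ((real k + 1)^4 * 2 ^ k)" by (intro mult_right_mono) (auto simp: C'_def)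
    finally have "norm (S L) \<le> sqrt (C' * ((real k + 1)^4 * 2 ^ k))" by (simp add: real_le_rsqrt)
    also have "\<dots> = sqrt C' * (real k + 1)\<^sup>2 * sqrt (2 ^ k)"
    proof -
      have "sqrt ((real k + 1)^4) = (real k + 1)\<^sup>2"
        by (rule real_sqrt_unique) (simp_all flip: power_mult)
      then show ?thesis by (simp add: real_sqrt_mult)
    qed
    also have "sqrt (2 ^ k) = 2 powr (real k / 2)" by (simp add: powr_half_sqrt[symmetric] powr_realpow[symmetric] powr_powr)
    also have "sqrt C' * (real k + 1)\<^sup>2 * 2 powr (real k / 2) \<le> sqrt C' * (B * 2 powr (real k * \<epsilon> / 2))\<^sup>2 * 2 powr (real k / 2)"
      using kB[of k] by (intro mult_right_mono mult_left_mono power_mono) (auto simp: C'_def)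
    also have "\<dots> = sqrt C' * B\<^sup>2 * (2 powr real k) powr (1/2 + \<epsilon>)"
      by (simp add: power_mult_distrib power2_eq_square powr_powr powr_add[symmetric] algebra_simps)
    also have "2 powr real k = real (2 ^ k)" by (simp add: powr_realpow)
    also have "sqrt C' * B\<^sup>2 * real (2 ^ k) powr (1/2 + \<epsilon>) \<le> sqrt C' * B\<^sup>2 * real (2 * L) powr (1/2 + \<epsilon>)"
      using k(2) \<epsilon> by (intro mult_left_mono powr_mono2) (auto simp: C'_def simp flip: of_nat_le_iff[where 'a = real])
    also have "\<dots> = D * real L powr (1/2 + \<epsilon>)" by (simp add: D_def powr_mult)
    finally show "norm (S L) \<le> D * real L powr (1/2 + \<epsilon>)" .
  qed
qed

lemma norm_powr_diff_le:
  assumes "n \<ge> 1" "Re s \<ge> 0"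
  shows "norm ((of_nat n :: complex) powr (- s) - of_nat (Suc n) powr (- s)) \<le> norm s * real n powr (- Re s - 1)"
proof -
  have "of_nat n powr (- s) * (1 + of_real (1 / real n)) powr (- s) = (of_nat n * (1 + of_real (1 / real n))) powr (- s)"
    by (subst powr_times_real) auto
  also have "of_nat n * (1 + of_real (1 / real n)) = (of_nat (Suc n) :: complex)"
    using assms by (simp add: field_simps)
  finally have "(of_nat n :: complex) powr (- s) - of_nat (Suc n) powr (- s) = - (of_nat n powr (- s) * ((1 + of_real (1 / real n)) powr (- s) - 1))"
    by (simp add: algebra_simps)
  then have "norm ((of_nat n :: complex) powr (- s) - of_nat (Suc n) powr (- s)) = real n powr (- Re s) * norm ((1 + of_real (1 / real n)) powr (- s) - 1)"
    using assms by (simp add: norm_mult norm_nat_powr)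
  also have "\<dots> \<le> real n powr (- Re s) * (norm s * (1 / real n))"
    using powr_taylor_bound[of "1 / real n" "- s" 0] assms by (intro mult_left_mono) auto
  also have "\<dots> = norm s * (real n powr (- Re s) * real n powr (-1))"
    using assms by (simp add: powr_minus field_simps)
  also have "real n powr (- Re s) * real n powr (-1) = real n powr (- Re s - 1)"
    by (simp only: powr_add[symmetric]) simp
  finally show ?thesis .
qed

text \<open>Abel summation: the partial sums S grow like n^(1/2+\<epsilon>), while consecutive
  values of n^(-s) differ by O(n^(-Re s-1)), so the transformed series has a summable majorant and
  the boundary term tends to 0 uniformly.\<close>

lemma dirichlet_series_uniformly_convergent:
  fixes X :: "nat \<Rightarrow> complex"
  assumes growth: "\<And>\<epsilon>. \<epsilon> > 0 \<Longrightarrow> \<exists>D\<ge>0. \<forall>L\<ge>1. norm (\<Sum>n\<in>{1..<1+L}. X n) \<le> D * real L powr (1/2 + \<epsilon>)"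
    and K: "compact K" "K \<subseteq> {s. Re s > 1/2}"
  shows "uniformly_convergent_on K (\<lambda>N s. \<Sum>n=1..N. X n * of_nat n powr (- s))"
proof (cases "K = {}")
  case True
  then show ?thesis by (auto simp: uniformly_convergent_on_def)
next
  case False
  obtain z where z: "z \<in> K" "\<And>s. s \<in> K \<Longrightarrow> Re z \<le> Re s"
    using continuous_attains_inf[OF K(1) False continuous_on_Re[OF continuous_on_id]] by auto
  \<comment> \<open>Half the distance from K to the line Re s = 1/2: the growth of S takes one
    \<epsilon>, the other leaves the exponent -1 - \<epsilon>.\<close>
  define \<epsilon> where "\<epsilon> = (Re z - 1/2) / 2"
  have \<epsilon>: "\<epsilon> > 0" "Re z = 1/2 + 2 * \<epsilon>" using z(1) K by (auto simp: \<epsilon>_def field_simps)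
  obtain R where R: "\<And>s. s \<in> K \<Longrightarrow> norm s \<le> R" using compact_imp_bounded[OF K(1)] by (auto simp: bounded_iff)
  have R0: "R \<ge> 0" using R[OF z(1)] norm_ge_zero[of z] by linarith
  define S where "S = (\<lambda>L. \<Sum>n\<in>{1..<1+L}. X n)"
  obtain D where D: "D \<ge> 0" "\<And>L. L \<ge> 1 \<Longrightarrow> norm (S L) \<le> D * real L powr (1/2 + \<epsilon>)"
    using growth[OF \<epsilon>(1)] unfolding S_def by blast
  define g where "g = (\<lambda>n s. S n * (of_nat n powr (- s) - of_nat (Suc n) powr (- s)))"
  have abel: "(\<Sum>n=1..N. X n * of_nat n powr (- s)) = (\<Sum>n<N. g n s) + S N * of_nat N powr (- s)" for N s
  proof (induction N)
    case (Suc N)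
    have "S (Suc N) = S N + X (Suc N)" by (simp add: S_def)
    then show ?case using Suc by (simp add: g_def algebra_simps del: of_nat_Suc)
  qed (simp add: S_def)
  have "uniform_limit K (\<lambda>N s. \<Sum>n<N. g n s) (\<lambda>s. \<Sum>n. g n s) sequentially"
  proof (rule Weierstrass_m_test)
    show "summable (\<lambda>n. D * R * real n powr (-1 - \<epsilon>))"
      using \<epsilon> by (intro summable_mult) (simp add: summable_real_powr_iff)
    fix n s assume s: "s \<in> K"
    show "norm (g n s) \<le> D * R * real n powr (-1 - \<epsilon>)"
    \<comment> \<open>The term n = 0 vanishes, as \<open>S 0\<close> is an empty sum.\<close>
    proof (cases "n \<ge> 1")
      case True
      have "norm (g n s) \<le> (D * real n powr (1/2 + \<epsilon>)) * (norm s * real n powr (- Re s - 1))"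
        unfolding g_def norm_mult using D True s K by (intro mult_mono norm_powr_diff_le) auto
      also have "\<dots> \<le> (D * real n powr (1/2 + \<epsilon>)) * (R * real n powr (- Re z - 1))"
        using D True R[OF s] z(2)[OF s] R0 by (intro mult_mono powr_mono) auto
      also have "\<dots> = D * R * (real n powr (1/2 + \<epsilon>) * real n powr (- Re z - 1))" by simp
      also have "real n powr (1/2 + \<epsilon>) * real n powr (- Re z - 1) = real n powr (-1 - \<epsilon>)"
        by (simp add: powr_add[symmetric] \<epsilon>(2))
      finally show ?thesis .
    qed (simp add: g_def S_def not_le)
  qed
  moreover have "uniform_limit K (\<lambda>N s. S N * of_nat N powr (- s)) (\<lambda>s. 0) sequentially"
  proof (rule uniform_limitI)
    fix e :: real assume e: "e > 0"
    have "(\<lambda>N. D * real N powr (- \<epsilon>)) \<longlonglongrightarrow> D * 0"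
      using \<epsilon> by (intro tendsto_mult tendsto_const tendsto_neg_powr filterlim_real_sequentially) auto
    then have "eventually (\<lambda>N. D * real N powr (- \<epsilon>) < e) sequentially" using e by (intro order_tendstoD) auto
    then show "\<forall>\<^sub>F N in sequentially. \<forall>s\<in>K. dist (S N * of_nat N powr (- s)) 0 < e"
      using eventually_ge_at_top[of 1]
    proof eventually_elim
      case (elim N)
      show ?case
      proof
        fix s assume s: "s \<in> K"
        have "norm (S N * of_nat N powr (- s)) \<le> (D * real N powr (1/2 + \<epsilon>)) * real N powr (- Re z)"
          unfolding norm_mult using elim D z(2)[OF s] by (intro mult_mono) (auto simp: norm_nat_powr intro!: powr_mono)
        also have "\<dots> = D * real N powr (- \<epsilon>)" by (simp add: powr_add[symmetric] \<epsilon>(2))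
        finally show "dist (S N * of_nat N powr (- s)) 0 < e" using elim by simp
      qed
    qed
  qed
  ultimately have "uniform_limit K (\<lambda>N s. (\<Sum>n<N. g n s) + S N * of_nat N powr (- s)) (\<lambda>s. (\<Sum>n. g n s) + 0) sequentially"
    by (rule uniform_limit_add)
  then show ?thesis unfolding abel by (rule uniformly_convergentI)
qed

context haar_torus
begin

lemma AE_random_zeta_converges:
  assumes "j \<noteq> 0"
  shows "AE \<omega> in M. random_zeta_converges (Omega_power \<omega> j)"
  using AE_partial_sum_bound[OF assms]
proof (rule eventually_mono)
  fix \<omega> assume "\<exists>C. \<forall>k L. L \<le> 2 ^ k \<longrightarrow> (norm (\<Sum>n\<in>{1..<1+L}. Omega_ext (Omega_power \<omega> j) n))\<^sup>2 \<le> C * ((real k + 1)^4 * 2 ^ k)"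
  then obtain C where C: "\<And>k L. L \<le> 2 ^ k \<Longrightarrow> (norm (\<Sum>n\<in>{1..<1+L}. Omega_ext (Omega_power \<omega> j) n))\<^sup>2 \<le> C * ((real k + 1)^4 * 2 ^ k)"
    by auto
  show "random_zeta_converges (Omega_power \<omega> j)"
    unfolding random_zeta_converges_def random_zeta_term_def
    by (intro allI impI dirichlet_series_uniformly_convergent partial_sum_growth[OF C]) (auto simp: strip_def)
qed

end

section \<open>Equidistribution of the line in the torus\<close>

text \<open>Trigonometric polynomials. The dual group of the torus is the group of positive
  rationals, and the character of m/n is \<omega>(m) times the conjugate of \<omega>(n); positive m
  and n keep the characters closed under products through \<open>Omega_ext_mult\<close>.\<close>

inductive torus_poly :: "((nat \<Rightarrow> complex) \<Rightarrow> complex) \<Rightarrow> bool" where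
  monom: "m > 0 \<Longrightarrow> n > 0 \<Longrightarrow> torus_poly (\<lambda>\<omega>. c * (Omega_ext \<omega> m * cnj (Omega_ext \<omega> n)))"
| add: "torus_poly f \<Longrightarrow> torus_poly g \<Longrightarrow> torus_poly (\<lambda>\<omega>. f \<omega> + g \<omega>)"

lemma torus_poly_mult:
  assumes "torus_poly f" "torus_poly g"
  shows "torus_poly (\<lambda>\<omega>. f \<omega> * g \<omega>)"
  using assms
proof (induction arbitrary: g)
  case (monom m n c)
  from monom.prems show ?case
  proof induction
    case (monom m' n' c')
    have "torus_poly (\<lambda>\<omega>. (c * c') * (Omega_ext \<omega> (m * m') * cnj (Omega_ext \<omega> (n * n'))))"
      using \<open>m > 0\<close> \<open>n > 0\<close> monom by (intro torus_poly.monom) auto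
    then show ?case
      using \<open>m > 0\<close> \<open>n > 0\<close> monom by (simp add: Omega_ext_mult mult_ac)
  next
    case (add f g)
    then show ?case using torus_poly.add by (simp add: distrib_left)
  qed
next
  case (add f h)
  then show ?case using torus_poly.add by (simp add: distrib_right)
qed

lemma torus_poly_const: "torus_poly (\<lambda>\<omega>. c)"
  using torus_poly.monom[of 1 1 c] by simp

lemma torus_poly_continuous: "torus_poly f \<Longrightarrow> continuous_on torus f"
  by (induction rule: torus_poly.induct) (auto intro!: continuous_intros continuous_on_Omega_ext)

text \<open>Stone-Weierstrass is applied to real functions, so R collects the real functions that
  coincide on the torus with some trigonometric polynomial. Points are separated by real and
  imaginary parts of a prime coordinate.\<close>

lemma torus_poly_dense:
  fixes h :: "(nat \<Rightarrow> complex) \<Rightarrow> real"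
  assumes "continuous_on torus h" "e > 0"
  shows "\<exists>f g. torus_poly g \<and> (\<forall>\<omega>\<in>torus. complex_of_real (f \<omega>) = g \<omega> \<and> \<bar>h \<omega> - f \<omega>\<bar> < e)"
proof -
  define R where "R = {f :: (nat \<Rightarrow> complex) \<Rightarrow> real. \<exists>g. torus_poly g \<and> (\<forall>\<omega>\<in>torus. complex_of_real (f \<omega>) = g \<omega>)}"
  interpret function_ring_on R torus
  proof
    show "compact torus" by (rule compact_torus)
    fix f assume "f \<in> R"
    then obtain g where g: "torus_poly g" "\<forall>\<omega>\<in>torus. complex_of_real (f \<omega>) = g \<omega>" by (auto simp: R_def)
    have "continuous_on torus (\<lambda>\<omega>. Re (g \<omega>))" by (intro continuous_intros torus_poly_continuous g)
    then show "continuous_on torus f"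
      by (rule continuous_on_cong[THEN iffD1, rotated -1]) (use g(2) in \<open>auto, metis Re_complex_of_real\<close>)
  next
    fix f g assume "f \<in> R" "g \<in> R"
    then obtain f' g' where "torus_poly f'" "torus_poly g'" "\<forall>\<omega>\<in>torus. complex_of_real (f \<omega>) = f' \<omega>" "\<forall>\<omega>\<in>torus. complex_of_real (g \<omega>) = g' \<omega>"
      by (auto simp: R_def)
    note fg = this
    show "(\<lambda>x. f x + g x) \<in> R"
      unfolding R_def using fg by (auto intro!: exI[of _ "\<lambda>x. f' x + g' x"] torus_poly.add)
    show "(\<lambda>x. f x * g x) \<in> R"
      unfolding R_def using fg by (auto intro!: exI[of _ "\<lambda>x. f' x * g' x"] torus_poly_mult)
  next
    fix c show "(\<lambda>_. c) \<in> R" unfolding R_def using torus_poly_const[of "of_real c"] by auto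
  next
    fix x y assume xy: "x \<in> torus" "y \<in> torus" "x \<noteq> y"
    then obtain p where p2: "x p \<noteq> y p" by (auto simp: fun_eq_iff)
    have p1: "prime p"
    proof (rule ccontr)
      assume "\<not> prime p"
      then show False using p2 xy by (auto simp: torus_def PiE_def extensional_def)
    qed
    note p = p1 p2
    have re: "(\<lambda>\<omega>. Re (\<omega> p)) \<in> R"
    proof -
      have "torus_poly (\<lambda>\<omega>. 1/2 * (Omega_ext \<omega> p * cnj (Omega_ext \<omega> 1)) + 1/2 * (Omega_ext \<omega> 1 * cnj (Omega_ext \<omega> p)))"
        using p prime_gt_0_nat by (intro torus_poly.intros) auto
      moreover have "complex_of_real (Re z) = 1/2 * (z * cnj 1) + 1/2 * (1 * cnj z)" for z
        by (simp add: complex_eq_iff)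
      ultimately show ?thesis unfolding R_def using p by (auto simp: Omega_ext_prime simp del: complex_cnj_one)
    qed
    have im: "(\<lambda>\<omega>. Im (\<omega> p)) \<in> R"
    proof -
      have "torus_poly (\<lambda>\<omega>. (-\<i>/2) * (Omega_ext \<omega> p * cnj (Omega_ext \<omega> 1)) + (\<i>/2) * (Omega_ext \<omega> 1 * cnj (Omega_ext \<omega> p)))"
        using p prime_gt_0_nat by (intro torus_poly.intros) auto
      moreover have "complex_of_real (Im z) = (-\<i>/2) * (z * cnj 1) + (\<i>/2) * (1 * cnj z)" for z
        by (simp add: complex_eq_iff)
      ultimately show ?thesis unfolding R_def using p by (auto simp: Omega_ext_prime simp del: complex_cnj_one)
    qed
    show "\<exists>f\<in>R. f x \<noteq> f y"
      using re im p(2) by (metis complex_eq_iff)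
  qed
  obtain f where f: "f \<in> R" "\<forall>\<omega>\<in>torus. \<bar>h \<omega> - f \<omega>\<bar> < e" using Stone_Weierstrass_basic[OF assms] by blast
  then show ?thesis unfolding R_def by blast
qed

lemma integral_uniform_measure_interval:
  fixes f :: "real \<Rightarrow> 'b::euclidean_space"
  assumes "T > 0" "continuous_on UNIV f"
  shows "(\<integral>t. f t \<partial>uniform_measure lborel {0..T}) = integral {0..T} f /\<^sub>R T"
proof -
  have [measurable]: "f \<in> borel_measurable borel" by (rule borel_measurable_continuous_onI[OF assms(2)])
  have "uniform_measure lborel {0..T} = density lborel (\<lambda>x. ennreal (indicator {0..T} x / T))"
    unfolding uniform_measure_def using assms(1)
    by (intro density_cong) (auto simp: indicator_def divide_ennreal[symmetric] ennreal_1[symmetric] simp del: ennreal_1)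
  then have "(\<integral>t. f t \<partial>uniform_measure lborel {0..T}) = (\<integral>t. (indicator {0..T} t / T) *\<^sub>R f t \<partial>lborel)"
    using assms(1) by (simp add: integral_density)
  also have "\<dots> = (\<integral>t. (1 / T) *\<^sub>R (indicator {0..T} t *\<^sub>R f t) \<partial>lborel)" by simp
  also have "\<dots> = (1 / T) *\<^sub>R (\<integral>t. indicator {0..T} t *\<^sub>R f t \<partial>lborel)" by (rule integral_scaleR_right)
  also have "(\<integral>t. indicator {0..T} t *\<^sub>R f t \<partial>lborel) = integral {0..T} f"
  proof -
    have "set_integrable lborel {0..T} f"
      by (intro borel_integrable_atLeastAtMost') (rule continuous_on_subset[OF assms(2)], simp)
    from set_borel_integral_eq_integral(2)[OF this] show ?thesis by (simp add: set_lebesgue_integral_def)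
  qed
  finally show ?thesis by (simp add: inverse_eq_divide)
qed

lemma prob_space_uniform_interval: "T > 0 \<Longrightarrow> prob_space (uniform_measure lborel {0..T::real})"
  by (rule prob_space_uniform_measure) auto

lemma continuous_on_torus_line: "continuous_on UNIV torus_line"
proof (rule continuous_on_coordinatewise_then_product)
  fix p
  show "continuous_on UNIV (\<lambda>\<tau>. torus_line \<tau> p)"
  proof (cases "prime p")
    case True
    then have "p \<ge> 1" using prime_gt_0_nat by (simp add: Suc_leI)
    then show ?thesis using True unfolding torus_line_def by (auto intro!: continuous_on_nat_powr continuous_intros)
  qed (simp add: torus_line_def)
qed

context haar_torus
begin

text \<open>Along the line a character is \<open>cis\<close> of t (ln n - ln m). For m \<noteq> n
  this frequency is nonzero and the mean over [0,T] is O(1/T); this is where the rational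
  independence of the logarithms of primes is hidden.\<close>

lemma torus_poly_equidistributed:
  assumes "torus_poly f"
  shows "((\<lambda>T. \<integral>t. f (torus_line t) \<partial>uniform_measure lborel {0..T}) \<longlongrightarrow> (\<integral>\<omega>. f \<omega> \<partial>M)) at_top"
  using assms
proof induction
  case (monom m n c)
  have lim: "(\<integral>\<omega>. c * (Omega_ext \<omega> m * cnj (Omega_ext \<omega> n)) \<partial>M) = c * (if m = n then 1 else 0)"
  proof -
    have "(\<integral>\<omega>. Omega_ext \<omega> m * cnj (Omega_ext \<omega> n) \<partial>M) = (\<integral>\<omega>. Omega_ext (Omega_power \<omega> 1) m * cnj (Omega_ext (Omega_power \<omega> 1) n) \<partial>M)"
      by (intro Bochner_Integration.integral_cong refl) (simp add: space_M Omega_power_1)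
    also have "\<dots> = (if m = n then 1 else 0)" using monom by (intro orthogonality) auto
    finally show ?thesis by simp
  qed
  have eq: "c * (Omega_ext (torus_line t) m * cnj (Omega_ext (torus_line t) n)) = c * cis (t * (ln (real n) - ln (real m)))" for t
    using monom by (simp add: Omega_ext_torus_line nat_powr_it cis_cnj cis_mult algebra_simps)
  show ?case
  proof (cases "m = n")
    case True
    have "eventually (\<lambda>T. (\<integral>t. c * (Omega_ext (torus_line t) m * cnj (Omega_ext (torus_line t) n)) \<partial>uniform_measure lborel {0..T}) = c) at_top"
      using eventually_gt_at_top[of "0::real"]
    proof eventually_elim
      case (elim T)
      interpret U: prob_space "uniform_measure lborel {0..T}" using elim by (rule prob_space_uniform_interval)
      show ?case unfolding eq using True U.prob_space by simp
    qed
    from tendsto_eventually[OF this] show ?thesis unfolding lim using True by simp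
  next
    case False
    define x where "x = ln (real n) - ln (real m)"
    have x: "x \<noteq> 0" using False monom by (simp add: x_def)
    have "((\<lambda>T. \<integral>t. c * cis (t * x) \<partial>uniform_measure lborel {0..T}) \<longlongrightarrow> 0) at_top"
    proof (rule Lim_null_comparison)
      show "\<forall>\<^sub>F T in at_top. norm (\<integral>t. c * cis (t * x) \<partial>uniform_measure lborel {0..T}) \<le> norm c * (2 / \<bar>x\<bar>) / T"
        using eventually_gt_at_top[of "0::real"]
      proof eventually_elim
        case (elim T)
        have "(\<integral>t. c * cis (t * x) \<partial>uniform_measure lborel {0..T}) = c * (integral {0..T} (\<lambda>t. cis (t * x)) /\<^sub>R T)"
          using integral_uniform_measure_interval[OF elim, of "\<lambda>t. cis (t * x)"] by (simp add: continuous_intros)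
        then have "norm (\<integral>t. c * cis (t * x) \<partial>uniform_measure lborel {0..T}) = norm c * norm (integral {0..T} (\<lambda>t. cis (t * x))) / T"
          using elim by (simp add: norm_mult field_simps)
        also have "\<dots> \<le> norm c * (2 / \<bar>x\<bar>) / T"
          using elim x by (intro divide_right_mono mult_left_mono oscillatory_integral_bound) auto
        finally show ?case .
      qed
      show "((\<lambda>T. norm c * (2 / \<bar>x\<bar>) / T) \<longlongrightarrow> 0) at_top"
        by (intro tendsto_divide_0[OF tendsto_const] filterlim_at_top_imp_at_infinity filterlim_ident)
    qed
    then show ?thesis unfolding lim eq x_def using False by simp
  qed
next
  case (add f g)
  have cont: "continuous_on UNIV (\<lambda>t. h (torus_line t))" if "torus_poly h" for h
    by (rule continuous_on_compose2[OF torus_poly_continuous[OF that] continuous_on_torus_line]) (auto simp: torus_line_torus)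
  have int: "integrable (uniform_measure lborel {0..T}) (\<lambda>t. h (torus_line t))" if h: "torus_poly h" and T: "T > 0" for h and T :: real
  proof -
    interpret U: prob_space "uniform_measure lborel {0..T}" using T by (rule prob_space_uniform_interval)
    have "bounded (h ` torus)" using compact_torus torus_poly_continuous[OF h] by (intro compact_imp_bounded compact_continuous_image)
    then obtain B where "\<And>\<omega>. \<omega> \<in> torus \<Longrightarrow> norm (h \<omega>) \<le> B" by (auto simp: bounded_iff)
    then show ?thesis
      using borel_measurable_continuous_onI[OF cont[OF h]] torus_line_torus
      by (intro U.integrable_const_bound[where B = B]) (auto simp: measurable_def)
  qed
  have "\<forall>\<^sub>F T in at_top. (\<integral>t. f (torus_line t) \<partial>uniform_measure lborel {0..T}) + (\<integral>t. g (torus_line t) \<partial>uniform_measure lborel {0..T})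
     = (\<integral>t. f (torus_line t) + g (torus_line t) \<partial>uniform_measure lborel {0..T})"
    using eventually_gt_at_top[of "0::real"] by eventually_elim (use int add in simp)
  moreover have "(\<integral>\<omega>. f \<omega> + g \<omega> \<partial>M) = (\<integral>\<omega>. f \<omega> \<partial>M) + (\<integral>\<omega>. g \<omega> \<partial>M)"
    using add by (intro Bochner_Integration.integral_add integrable_continuous torus_poly_continuous)
  ultimately show ?case using Lim_transform_eventually[OF tendsto_add[OF add.IH]] by simp
qed

lemma torus_line_equidistributed:
  fixes h :: "(nat \<Rightarrow> complex) \<Rightarrow> real"
  assumes h: "continuous_on torus h"
  shows "((\<lambda>T. \<integral>t. h (torus_line t) \<partial>uniform_measure lborel {0..T}) \<longlongrightarrow> (\<integral>\<omega>. h \<omega> \<partial>M)) at_top"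
proof (rule tendstoI)
  fix e :: real assume e: "e > 0"
  obtain f g where fg: "torus_poly g" "\<And>\<omega>. \<omega> \<in> torus \<Longrightarrow> complex_of_real (f \<omega>) = g \<omega>" "\<And>\<omega>. \<omega> \<in> torus \<Longrightarrow> \<bar>h \<omega> - f \<omega>\<bar> < e / 3"
    using torus_poly_dense[OF h, of "e / 3"] e by auto
  have fRe: "f \<omega> = Re (g \<omega>)" if "\<omega> \<in> torus" for \<omega> using fg(2)[OF that] by (metis Re_complex_of_real)
  have contf: "continuous_on torus f"
  proof -
    have "continuous_on torus (\<lambda>\<omega>. Re (g \<omega>))" by (intro continuous_intros torus_poly_continuous fg)
    then show ?thesis by (rule continuous_on_cong[THEN iffD1, rotated -1]) (auto simp: fRe)
  qed
  have contl: "continuous_on UNIV (\<lambda>t. k (torus_line t))" if "continuous_on torus k" for k :: "_ \<Rightarrow> real"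
    by (rule continuous_on_compose2[OF that continuous_on_torus_line]) (auto simp: torus_line_torus)
  have intl: "integrable (uniform_measure lborel {0..T}) (\<lambda>t. k (torus_line t))" if k: "continuous_on torus k" and T: "T > 0" for T and k :: "_ \<Rightarrow> real"
  proof -
    interpret U: prob_space "uniform_measure lborel {0..T}" using T by (rule prob_space_uniform_interval)
    have "bounded (k ` torus)" using compact_torus k by (intro compact_imp_bounded compact_continuous_image)
    then obtain B where "\<And>\<omega>. \<omega> \<in> torus \<Longrightarrow> norm (k \<omega>) \<le> B" by (auto simp: bounded_iff)
    then show ?thesis
      using borel_measurable_continuous_onI[OF contl[OF k]] torus_line_torus
      by (intro U.integrable_const_bound[where B = B]) (auto simp: measurable_def)
  qed
  have "((\<lambda>T. Re (\<integral>t. g (torus_line t) \<partial>uniform_measure lborel {0..T})) \<longlongrightarrow> Re (\<integral>\<omega>. g \<omega> \<partial>M)) at_top"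
    by (intro tendsto_Re torus_poly_equidistributed fg)
  moreover have "(\<integral>t. g (torus_line t) \<partial>uniform_measure lborel {0..T}) = complex_of_real (\<integral>t. f (torus_line t) \<partial>uniform_measure lborel {0..T})" for T
    using fg(2) torus_line_torus by (simp flip: integral_complex_of_real)
  moreover have "(\<integral>\<omega>. g \<omega> \<partial>M) = complex_of_real (\<integral>\<omega>. f \<omega> \<partial>M)"
    unfolding integral_complex_of_real[symmetric] by (intro Bochner_Integration.integral_cong refl) (simp add: fg(2) space_M)
  ultimately have "((\<lambda>T. \<integral>t. f (torus_line t) \<partial>uniform_measure lborel {0..T}) \<longlongrightarrow> (\<integral>\<omega>. f \<omega> \<partial>M)) at_top" by simp
  from tendstoD[OF this, of "e / 3"] e
  have "\<forall>\<^sub>F T in at_top. dist (\<integral>t. f (torus_line t) \<partial>uniform_measure lborel {0..T}) (\<integral>\<omega>. f \<omega> \<partial>M) < e / 3" by simp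
  then show "\<forall>\<^sub>F T in at_top. dist (\<integral>t. h (torus_line t) \<partial>uniform_measure lborel {0..T}) (\<integral>\<omega>. h \<omega> \<partial>M) < e"
    using eventually_gt_at_top[of "0::real"]
  proof eventually_elim
    case (elim T)
    interpret U: prob_space "uniform_measure lborel {0..T}" using elim by (intro prob_space_uniform_interval)
    \<comment> \<open>Stated for arbitrary probability spaces, since it serves both on [0,T] and on
      the torus.\<close>
    have close: "\<bar>(\<integral>x. u x \<partial>N) - (\<integral>x. v x \<partial>N)\<bar> \<le> e / 3"
      if "prob_space N" "integrable N u" "integrable N v" "\<And>x. x \<in> space N \<Longrightarrow> \<bar>u x - v x\<bar> < e / 3" for N :: "'z measure" and u v
    proof -
      interpret N: prob_space N by fact
      have "\<bar>(\<integral>x. u x \<partial>N) - (\<integral>x. v x \<partial>N)\<bar> = \<bar>\<integral>x. u x - v x \<partial>N\<bar>" using that by simp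
      also have "\<dots> \<le> (\<integral>x. \<bar>u x - v x\<bar> \<partial>N)" by (rule integral_abs_bound)
      also have "\<dots> \<le> (\<integral>x. e / 3 \<partial>N)" using that by (intro integral_mono) (auto intro: less_imp_le)
      finally show ?thesis by (simp add: N.prob_space)
    qed
    have "\<bar>(\<integral>t. h (torus_line t) \<partial>uniform_measure lborel {0..T}) - (\<integral>t. f (torus_line t) \<partial>uniform_measure lborel {0..T})\<bar> \<le> e / 3"
      using elim fg(3) torus_line_torus by (intro close U.prob_space_axioms intl h contf) auto
    moreover have "\<bar>(\<integral>\<omega>. h \<omega> \<partial>M) - (\<integral>\<omega>. f \<omega> \<partial>M)\<bar> \<le> e / 3"
      using fg(3) by (intro close prob_space_axioms integrable_continuous h contf) (auto simp: space_M)
    ultimately show ?case using elim(1) unfolding dist_real_def by linarith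
  qed
qed

end

section \<open>The space of analytic functions\<close>

lemma analytic_functionsI:
  assumes "open D" "f holomorphic_on D"
  shows "restrict f D \<in> analytic_functions D"
  unfolding analytic_functions_def using assms
  by (auto simp: analytic_on_open intro: holomorphic_transform)

lemma analytic_functions_holomorphic:
  assumes "f \<in> analytic_functions D"
  shows "f holomorphic_on D"
  using assms analytic_imp_holomorphic by (auto simp: analytic_functions_def)

lemma measurable_continuous_map:
  assumes "continuous_map X Y f" "sets M = sets (borel_of X)"
  shows "f \<in> measurable M (borel_of Y)"
  unfolding borel_of_def[of Y]
proof (rule measurable_measure_of)
  have sp: "space M = topspace X" using sets_eq_imp_space_eq[OF assms(2)] by simp
  show "{U. openin Y U} \<subseteq> Pow (topspace Y)" using openin_subset by auto
  show "f \<in> space M \<rightarrow> topspace Y" using continuous_map_image_subset_topspace[OF assms(1)] by (auto simp: sp)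
  fix U assume "U \<in> {U. openin Y U}"
  then have "openin X {x \<in> topspace X. f x \<in> U}"
    using openin_continuous_map_preimage[OF assms(1)] by simp
  then show "f -` U \<inter> space M \<in> sets M"
    using borel_of_openin by (simp add: assms(2) vimage_def Int_def conj_commute sp)
qed

text \<open>Joint continuity near {x0} x K with K compact gives closeness uniformly on K (tube
  lemma), which is what a basic neighbourhood in H(D) asks for.\<close>

lemma continuous_map_into_hol_space:
  fixes F :: "'a::metric_space \<Rightarrow> complex \<Rightarrow> complex"
  assumes cont: "continuous_on (S \<times> D) (\<lambda>(x, s). F x s)" and F: "\<And>x. x \<in> S \<Longrightarrow> F x \<in> analytic_functions D"
  shows "continuous_map (top_of_set S) (hol_space D) F"
  unfolding continuous_map_def
proof (intro conjI allI impI)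
  show "F \<in> topspace (top_of_set S) \<rightarrow> topspace (hol_space D)" using F by (auto simp: topspace_hol_space)
  fix U assume "openin (hol_space D) U"
  then have U: "compact_convergence_open D U" by (simp add: openin_hol_space)
  show "openin (top_of_set S) {x \<in> topspace (top_of_set S). F x \<in> U}"
  proof (subst openin_subopen, intro ballI)
    fix x0 assume "x0 \<in> {x \<in> topspace (top_of_set S). F x \<in> U}"
    then have x0: "x0 \<in> S" "F x0 \<in> U" by auto
    then obtain K e where K: "compact K" "K \<subseteq> D" "e > 0" "{g \<in> analytic_functions D. \<forall>z\<in>K. dist (F x0 z) (g z) < e} \<subseteq> U"
      using U unfolding compact_convergence_open_def by blast
    have "continuous_on (S \<times> K) (\<lambda>(x, s). F x s)" by (rule continuous_on_subset[OF cont]) (use K(2) in auto)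
    then obtain X0 where X0: "x0 \<in> X0" "open X0" "\<forall>x\<in>X0 \<inter> S. \<forall>t\<in>K. dist ((\<lambda>(x, s). F x s) (x, t)) ((\<lambda>(x, s). F x s) (x0, t)) \<le> e / 2"
      using K(3) by (elim continuous_on_prod_compactE[OF _ K(1) x0(1), of _ "e / 2"]) auto
    have "F x \<in> U" if "x \<in> S \<inter> X0" for x
    proof -
      have "dist (F x0 z) (F x z) < e" if "z \<in> K" for z
        using X0(3) \<open>x \<in> S \<inter> X0\<close> that K(3) by (force simp: dist_commute)
      then show ?thesis using K(4) F[of x] that by auto
    qed
    moreover have "openin (top_of_set S) (S \<inter> X0)" using X0(2) by (simp add: openin_open_Int)
    ultimately show "\<exists>T. openin (top_of_set S) T \<and> x0 \<in> T \<and> T \<subseteq> {x \<in> topspace (top_of_set S). F x \<in> U}"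
      using x0 X0 by (intro exI[of _ "S \<inter> X0"]) auto
  qed
qed

lemma continuous_map_eval:
  assumes "z \<in> D"
  shows "continuous_map (hol_space D) euclidean (\<lambda>f. f z)"
  unfolding continuous_map_def
proof (intro conjI allI impI)
  fix U :: "complex set" assume "openin euclidean U"
  then have U: "open U" by simp
  show "openin (hol_space D) {f \<in> topspace (hol_space D). f z \<in> U}"
    unfolding openin_hol_space compact_convergence_open_def topspace_hol_space
  proof (intro conjI ballI)
    fix f assume "f \<in> {f \<in> analytic_functions D. f z \<in> U}"
    then obtain e where "e > 0" "ball (f z) e \<subseteq> U" using U by (auto simp: open_contains_ball)
    then show "\<exists>K \<epsilon>. compact K \<and> K \<subseteq> D \<and> \<epsilon> > 0 \<and> {g \<in> analytic_functions D. \<forall>z\<in>K. dist (f z) (g z) < \<epsilon>} \<subseteq> {f \<in> analytic_functions D. f z \<in> U}"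
      using assms by (intro exI[of _ "{z}"] exI[of _ e]) auto
  qed auto
qed auto

lemma compact_exhaustion:
  assumes "open (D :: complex set)"
  shows "\<exists>K. (\<forall>n. compact (K n)) \<and> (\<forall>n. K n \<subseteq> D) \<and>
    (\<forall>C. compact C \<longrightarrow> C \<subseteq> D \<longrightarrow> (\<exists>N::nat. \<forall>n\<ge>N. C \<subseteq> K n))"
proof (rule open_Union_compact_subsets[OF assms])
  fix C :: "nat \<Rightarrow> complex set"
  assume C: "\<And>n. compact (C n)" "\<And>n. C n \<subseteq> D"
    and ev: "\<And>K. \<lbrakk>compact K; K \<subseteq> D\<rbrakk> \<Longrightarrow> \<exists>N. \<forall>n\<ge>N. K \<subseteq> C n"
  then show ?thesis by (intro exI[of _ C]) simp
qed

text \<open>By Montel's theorem a locally bounded family is relatively compact, so a continuous functional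
  is uniformly continuous near it; this replaces the metric on the space of analytic functions.\<close>

lemma hol_space_uniformly_continuous:
  fixes K :: "nat \<Rightarrow> complex set"
  assumes D: "open D" and g: "continuous_map (hol_space D) euclideanreal g"
    and K: "\<And>n. compact (K n)" "\<And>n. K n \<subseteq> D" "\<And>C. compact C \<Longrightarrow> C \<subseteq> D \<Longrightarrow> \<exists>N. \<forall>n\<ge>N. C \<subseteq> K n"
    and e: "e > 0"
  shows "\<exists>n \<delta>. \<delta> > 0 \<and> (\<forall>f\<in>analytic_functions D. \<forall>h\<in>analytic_functions D.
    (\<forall>l. \<forall>z\<in>K l. norm (f z) \<le> B l) \<longrightarrow> (\<forall>z\<in>K n. norm (f z - h z) < \<delta>) \<longrightarrow> \<bar>g f - g h\<bar> < e)"
proof (rule ccontr)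
  assume "\<not> ?thesis"
  then have "\<forall>n. \<exists>f h. f \<in> analytic_functions D \<and> h \<in> analytic_functions D \<and> (\<forall>l. \<forall>z\<in>K l. norm (f z) \<le> B l) \<and>
     (\<forall>z\<in>K n. norm (f z - h z) < inverse (real (Suc n))) \<and> \<not> \<bar>g f - g h\<bar> < e"
    by (metis inverse_positive_iff_positive of_nat_0_less_iff zero_less_Suc)
  then obtain f h where fh: "\<And>n. f n \<in> analytic_functions D" "\<And>n. h n \<in> analytic_functions D"
     "\<And>n l z. z \<in> K l \<Longrightarrow> norm (f n z) \<le> B l" "\<And>n z. z \<in> K n \<Longrightarrow> norm (f n z - h n z) < inverse (real (Suc n))"
     "\<And>n. \<not> \<bar>g (f n) - g (h n)\<bar> < e" by metis
  define \<H> where "\<H> = {f \<in> analytic_functions D. \<forall>l. \<forall>z\<in>K l. norm (f z) \<le> B l}"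
  obtain \<phi> r where \<phi>: "\<phi> holomorphic_on D" and r: "strict_mono (r :: nat \<Rightarrow> nat)"
    and lim: "\<And>C. \<lbrakk>compact C; C \<subseteq> D\<rbrakk> \<Longrightarrow> uniform_limit C (f \<circ> r) \<phi> sequentially"
  proof (rule Montel[OF D, of \<H> f])
    show "h holomorphic_on D" if "h \<in> \<H>" for h using that analytic_functions_holomorphic by (auto simp: \<H>_def)
    show "\<exists>B. \<forall>h\<in>\<H>. \<forall>z\<in>C. norm (h z) \<le> B" if C: "compact C" "C \<subseteq> D" for C
    proof -
      obtain N where "C \<subseteq> K N" using K(3)[OF C] by blast
      then show ?thesis by (intro exI[of _ "B N"]) (auto simp: \<H>_def)
    qed
    show "range f \<subseteq> \<H>" using fh by (auto simp: \<H>_def)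
  qed blast
  define \<psi> where "\<psi> = restrict \<phi> D"
  have \<psi>: "\<psi> \<in> analytic_functions D" unfolding \<psi>_def by (rule analytic_functionsI[OF D \<phi>])
  have "openin (hol_space D) {x \<in> topspace (hol_space D). g x \<in> ball (g \<psi>) (e / 2)}"
    using g by (rule openin_continuous_map_preimage) simp
  then have "compact_convergence_open D {x \<in> analytic_functions D. g x \<in> ball (g \<psi>) (e / 2)}"
    by (simp add: openin_hol_space topspace_hol_space)
  then obtain C \<epsilon> where C: "compact C" "C \<subseteq> D" "\<epsilon> > 0"
     "{x \<in> analytic_functions D. \<forall>z\<in>C. dist (\<psi> z) (x z) < \<epsilon>} \<subseteq> {x \<in> analytic_functions D. g x \<in> ball (g \<psi>) (e / 2)}"
    using \<psi> e unfolding compact_convergence_open_def by auto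
  \<comment> \<open>Only f is assumed bounded. A subsequence of f converges by Montel, and h follows
    it on C once C lies in \<open>K (r n)\<close>, so both end in the neighbourhood of \<psi> where
    g varies by less than e.\<close>
  have "eventually (\<lambda>n. \<forall>z\<in>C. dist ((f \<circ> r) n z) (\<phi> z) < \<epsilon> / 2) sequentially"
    using uniform_limitD[OF lim[OF C(1,2)], of "\<epsilon> / 2"] C(3) by simp
  moreover have "eventually (\<lambda>n. C \<subseteq> K (r n)) sequentially"
  proof -
    obtain N where N: "\<forall>n\<ge>N. C \<subseteq> K n" using K(3)[OF C(1,2)] by blast
    have "C \<subseteq> K (r n)" if "n \<ge> N" for n using N seq_suble[OF r, of n] that by auto
    then show ?thesis by (auto simp: eventually_sequentially)
  qed
  moreover have "eventually (\<lambda>n. inverse (real (Suc n)) < \<epsilon> / 2) sequentially"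
    using order_tendstoD(2)[OF LIMSEQ_inverse_real_of_nat, of "\<epsilon> / 2"] C(3) by simp
  ultimately have "eventually (\<lambda>n. False) sequentially"
  proof eventually_elim
    case (elim n)
    have 1: "dist (\<psi> z) (f (r n) z) < \<epsilon> / 2" if "z \<in> C" for z
      using elim(1) that C(2) by (auto simp: \<psi>_def dist_commute)
    have 2: "dist (f (r n) z) (h (r n) z) < \<epsilon> / 2" if "z \<in> C" for z
    proof -
      have "dist (f (r n) z) (h (r n) z) < inverse (real (Suc (r n)))"
        using fh(4)[of z "r n"] that elim(2) by (auto simp: dist_norm)
      also have "\<dots> \<le> inverse (real (Suc n))" using seq_suble[OF r, of n] by (intro le_imp_inverse_le) auto
      finally show ?thesis using elim(3) by simp
    qed
    have "\<forall>z\<in>C. dist (\<psi> z) (f (r n) z) < \<epsilon>" using 1 C(3) by (auto intro: less_trans[of _ "\<epsilon> / 2"])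
    moreover have "\<forall>z\<in>C. dist (\<psi> z) (h (r n) z) < \<epsilon>"
    proof
      fix z assume z: "z \<in> C"
      show "dist (\<psi> z) (h (r n) z) < \<epsilon>" using 1[OF z] 2[OF z] dist_triangle[of "\<psi> z" "h (r n) z" "f (r n) z"] by linarith
    qed
    ultimately have "f (r n) \<in> {x \<in> analytic_functions D. \<forall>z\<in>C. dist (\<psi> z) (x z) < \<epsilon>}"
      "h (r n) \<in> {x \<in> analytic_functions D. \<forall>z\<in>C. dist (\<psi> z) (x z) < \<epsilon>}" using fh(1,2) by auto
    from this[THEN subsetD[OF C(4)]]
    have "g (f (r n)) \<in> ball (g \<psi>) (e / 2)" "g (h (r n)) \<in> ball (g \<psi>) (e / 2)" by auto
    then have "\<bar>g (f (r n)) - g (h (r n))\<bar> < e" by (simp add: dist_real_def abs_if split: if_splits)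
    then show False using fh(5) by blast
  qed
  then show False by simp
qed

section \<open>From pointwise second moments to bounds on compact sets\<close>

lemma nn_integral_interval:
  fixes f :: "real \<Rightarrow> real"
  assumes "continuous_on {a..b} f" "\<And>x. x \<in> {a..b} \<Longrightarrow> 0 \<le> f x"
  shows "(\<integral>\<^sup>+x. ennreal (f x) * indicator {a..b} x \<partial>lborel) = ennreal (integral {a..b} f)"
proof -
  have si: "set_integrable lborel {a..b} f" by (rule borel_integrable_atLeastAtMost'[OF assms(1)])
  have "(\<integral>\<^sup>+x. ennreal (f x) * indicator {a..b} x \<partial>lborel) = (\<integral>\<^sup>+x. ennreal (indicator {a..b} x *\<^sub>R f x) \<partial>lborel)"
    by (intro nn_integral_cong) (auto simp: indicator_def)
  also have "\<dots> = ennreal (\<integral>x. indicator {a..b} x *\<^sub>R f x \<partial>lborel)"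
    using si assms(2) by (intro nn_integral_eq_integral) (auto simp: set_integrable_def indicator_def)
  also have "(\<integral>x. indicator {a..b} x *\<^sub>R f x \<partial>lborel) = integral {a..b} f"
    using set_borel_integral_eq_integral(2)[OF si] by (simp add: set_lebesgue_integral_def)
  finally show ?thesis .
qed

text \<open>Cauchy's formula is applied to the square of F, which bounds |F z|^2 directly by a mean
  of |F|^2. Points of the circle of radius 2r stay at distance at least r from z, whence the factor
  2.\<close>

lemma norm_square_le_circle_mean:
  assumes F: "F holomorphic_on cball c (2 * r)" and r: "r > 0" and z: "z \<in> ball c r"
  shows "(norm (F z))\<^sup>2 \<le> 2 * integral {0..1} (\<lambda>t. (norm (F (circlepath c (2 * r) t)))\<^sup>2)"
proof -
  let ?\<gamma> = "circlepath c (2 * r)"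
  have "norm (z - c) < r" using z by (simp add: dist_norm norm_minus_commute)
  then have "norm (z - c) < 2 * r" using r by simp
  moreover have "(\<lambda>u. (F u)\<^sup>2) holomorphic_on cball c (2 * r)" using F by (intro holomorphic_intros)
  ultimately have "((\<lambda>u. (F u)\<^sup>2 / (u - z)) has_contour_integral (2 * of_real pi * \<i> * (F z)\<^sup>2)) ?\<gamma>"
    by (intro Cauchy_integral_circlepath_simple)
  then have hi: "((\<lambda>t. (F (?\<gamma> t))\<^sup>2 / (?\<gamma> t - z) * vector_derivative ?\<gamma> (at t within {0..1})) has_integral (2 * of_real pi * \<i> * (F z)\<^sup>2)) {0..1}"
    by (simp add: has_contour_integral_def)
  have sph: "?\<gamma> t \<in> sphere c (2 * r)" for t
    using r by (auto simp: circlepath dist_norm norm_mult norm_exp_eq_Re)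
  have cF: "continuous_on {0..1} (\<lambda>t. F (?\<gamma> t))"
    by (rule continuous_on_compose2[OF holomorphic_on_imp_continuous_on[OF F]])
       (use sph in \<open>auto simp: circlepath intro!: continuous_intros\<close>)
  have "norm (2 * of_real pi * \<i> * (F z)\<^sup>2) \<le> integral {0..1} (\<lambda>t. 4 * pi * (norm (F (?\<gamma> t)))\<^sup>2)"
    unfolding integral_unique[OF hi, symmetric]
  proof (rule integral_norm_bound_integral)
    show "(\<lambda>t. (F (?\<gamma> t))\<^sup>2 / (?\<gamma> t - z) * vector_derivative ?\<gamma> (at t within {0..1})) integrable_on {0..1}" using hi by blast
    show "(\<lambda>t. 4 * pi * (norm (F (?\<gamma> t)))\<^sup>2) integrable_on {0..1}"
      by (intro integrable_continuous_interval continuous_intros cF)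
    fix t :: real assume t: "t \<in> {0..1}"
    have "2 * r = norm (?\<gamma> t - c)" using sph[of t] by (simp add: dist_norm norm_minus_commute)
    also have "\<dots> \<le> norm (?\<gamma> t - z) + norm (z - c)" using norm_triangle_ineq[of "?\<gamma> t - z" "z - c"] by simp
    finally have ge: "norm (?\<gamma> t - z) \<ge> r" using \<open>norm (z - c) < r\<close> by linarith
    have nv: "norm (vector_derivative ?\<gamma> (at t within {0..1})) = 4 * pi * r"
      using t r by (simp add: vector_derivative_circlepath01 norm_mult norm_exp_eq_Re)
    have "norm ((F (?\<gamma> t))\<^sup>2 / (?\<gamma> t - z) * vector_derivative ?\<gamma> (at t within {0..1})) = (norm (F (?\<gamma> t)))\<^sup>2 / norm (?\<gamma> t - z) * (4 * pi * r)"
      by (simp add: norm_mult norm_divide norm_power nv)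
    also have "\<dots> \<le> (norm (F (?\<gamma> t)))\<^sup>2 / r * (4 * pi * r)"
      using r ge by (intro mult_right_mono divide_left_mono mult_pos_pos) auto
    also have "\<dots> = 4 * pi * (norm (F (?\<gamma> t)))\<^sup>2" using r by simp
    finally show "norm ((F (?\<gamma> t))\<^sup>2 / (?\<gamma> t - z) * vector_derivative ?\<gamma> (at t within {0..1})) \<le> 4 * pi * (norm (F (?\<gamma> t)))\<^sup>2" .
  qed
  also have "\<dots> = 4 * pi * integral {0..1} (\<lambda>t. (norm (F (?\<gamma> t)))\<^sup>2)" by simp
  finally have "2 * pi * (norm (F z))\<^sup>2 \<le> 2 * pi * (2 * integral {0..1} (\<lambda>t. (norm (F (?\<gamma> t)))\<^sup>2))"
    by (simp add: norm_mult norm_power)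
  then show ?thesis by (subst (asm) mult_le_cancel_left_pos) auto
qed

text \<open>Balls of radius r cover K, while the closed discs of twice the radius still lie in D:
  the outer circles are the contours for Cauchy's formula.\<close>

definition disc_cover :: "complex set \<Rightarrow> complex set \<Rightarrow> (complex \<times> real) set \<Rightarrow> bool" where
  "disc_cover D K P \<longleftrightarrow> finite P \<and> (\<forall>(c, r)\<in>P. r > 0 \<and> cball c (2 * r) \<subseteq> D) \<and> K \<subseteq> (\<Union>(c, r)\<in>P. ball c r)"

lemma disc_cover_exists:
  assumes "open D" "compact K" "K \<subseteq> D"
  shows "\<exists>P. disc_cover D K P"
proof -
  have "\<forall>z\<in>K. \<exists>r>0. cball z (2 * r) \<subseteq> D"
  proof
    fix z assume "z \<in> K"
    then obtain e where "e > 0" "cball z e \<subseteq> D" using assms open_contains_cball by blast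
    then show "\<exists>r>0. cball z (2 * r) \<subseteq> D" by (intro exI[of _ "e / 2"]) auto
  qed
  then obtain r where r: "\<And>z. z \<in> K \<Longrightarrow> r z > 0" "\<And>z. z \<in> K \<Longrightarrow> cball z (2 * r z) \<subseteq> D" by metis
  show ?thesis
  proof (rule compactE_image[OF assms(2), of K "\<lambda>z. ball z (r z)"])
    show "K \<subseteq> (\<Union>z\<in>K. ball z (r z))" using r(1) by force
    fix K' assume K': "K' \<subseteq> K" "finite K'" "K \<subseteq> (\<Union>z\<in>K'. ball z (r z))"
    have "disc_cover D K ((\<lambda>z. (z, r z)) ` K')"
      unfolding disc_cover_def
    proof (intro conjI)
      show "\<forall>(c, s)\<in>(\<lambda>z. (z, r z)) ` K'. 0 < s \<and> cball c (2 * s) \<subseteq> D" using K'(1) r by fast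
      show "K \<subseteq> (\<Union>(c, s)\<in>(\<lambda>z. (z, r z)) ` K'. ball c s)" using K'(3) by simp
    qed (simp add: K')
    then show ?thesis by blast
  qed simp
qed

text \<open>Joint measurability for Fubini. Rounding t down to a multiple of 1/(n+1) leaves
  countably many values of t, where measurability in \<omega> suffices; continuity in t gives the
  limit.\<close>

lemma borel_measurable_caratheodory:
  fixes f :: "'a \<Rightarrow> real \<Rightarrow> complex"
  assumes m: "\<And>t. (\<lambda>\<omega>. f \<omega> t) \<in> borel_measurable N" and c: "\<And>\<omega>. \<omega> \<in> space N \<Longrightarrow> continuous_on UNIV (f \<omega>)"
  shows "(\<lambda>(\<omega>, t). f \<omega> t) \<in> borel_measurable (N \<Otimes>\<^sub>M lborel)"
proof (rule borel_measurable_LIMSEQ_metric)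
  fix n :: nat
  have [measurable]: "(\<lambda>\<omega>. f \<omega> t) \<in> borel_measurable N" for t by (rule m)
  show "(\<lambda>(\<omega>, t). f \<omega> (of_int \<lfloor>real (Suc n) * t\<rfloor> / real (Suc n))) \<in> borel_measurable (N \<Otimes>\<^sub>M lborel)"
    unfolding split_beta
  proof (rule measurable_compose_countable[where g = "\<lambda>x. \<lfloor>real (Suc n) * snd x\<rfloor>"])
    show "(\<lambda>x. f (fst x) (of_int i / real (Suc n))) \<in> borel_measurable (N \<Otimes>\<^sub>M lborel)" for i :: int
      by measurable
    show "(\<lambda>x. \<lfloor>real (Suc n) * snd x\<rfloor>) \<in> measurable (N \<Otimes>\<^sub>M lborel) (count_space UNIV)" by measurable
  qed
next
  fix x :: "'a \<times> real" assume "x \<in> space (N \<Otimes>\<^sub>M lborel)"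
  then obtain \<omega> and t :: real where x: "x = (\<omega>, t)" "\<omega> \<in> space N" by (auto simp: space_pair_measure)
  have "(\<lambda>n. of_int \<lfloor>real (Suc n) * t\<rfloor> / real (Suc n)) \<longlonglongrightarrow> t"
  proof (rule real_tendsto_sandwich)
    show "\<forall>\<^sub>F n in sequentially. t - inverse (real (Suc n)) \<le> of_int \<lfloor>real (Suc n) * t\<rfloor> / real (Suc n)"
    proof (intro always_eventually allI)
      fix n
      have "real (Suc n) * t - 1 \<le> of_int \<lfloor>real (Suc n) * t\<rfloor>" by linarith
      then have "(real (Suc n) * t - 1) / real (Suc n) \<le> of_int \<lfloor>real (Suc n) * t\<rfloor> / real (Suc n)" by (intro divide_right_mono) auto
      then show "t - inverse (real (Suc n)) \<le> of_int \<lfloor>real (Suc n) * t\<rfloor> / real (Suc n)"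
        by (simp add: diff_divide_distrib inverse_eq_divide del: of_nat_Suc)
    qed
    show "\<forall>\<^sub>F n in sequentially. of_int \<lfloor>real (Suc n) * t\<rfloor> / real (Suc n) \<le> t"
    proof (intro always_eventually allI)
      fix n
      have "of_int \<lfloor>real (Suc n) * t\<rfloor> \<le> real (Suc n) * t" by linarith
      then have "of_int \<lfloor>real (Suc n) * t\<rfloor> / real (Suc n) \<le> real (Suc n) * t / real (Suc n)" by (intro divide_right_mono) auto
      then show "of_int \<lfloor>real (Suc n) * t\<rfloor> / real (Suc n) \<le> t" by (simp del: of_nat_Suc)
    qed
    show "(\<lambda>n. t - inverse (real (Suc n))) \<longlonglongrightarrow> t"
      using tendsto_diff[OF tendsto_const[of t] LIMSEQ_inverse_real_of_nat] by simp
  qed auto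
  then have "(\<lambda>n. f \<omega> (of_int \<lfloor>real (Suc n) * t\<rfloor> / real (Suc n))) \<longlonglongrightarrow> f \<omega> t"
    using c[OF x(2)] by (intro continuous_on_tendsto_compose[where s = UNIV and f = "f \<omega>"]) auto
  then show "(\<lambda>n. case x of (\<omega>, t) \<Rightarrow> f \<omega> (of_int \<lfloor>real (Suc n) * t\<rfloor> / real (Suc n))) \<longlonglongrightarrow> (case x of (\<omega>, t) \<Rightarrow> f \<omega> t)"
    by (simp add: x)
qed

text \<open>The supremum over K is replaced by a measurable majorant, twice the sum of the means of
  |F|^2 over the finitely many outer circles. By Fubini its expectation needs only second moments at
  single points, and Markov's inequality produces the exceptional set.\<close>

lemma sup_markov:
  fixes N :: "'a measure"
  assumes N: "sigma_finite_measure N" and cover: "disc_cover D K P"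
    and hol: "\<And>\<omega>. \<omega> \<in> space N \<Longrightarrow> F \<omega> holomorphic_on D"
    and meas: "\<And>z. z \<in> D \<Longrightarrow> (\<lambda>\<omega>. F \<omega> z) \<in> borel_measurable N"
    and b: "\<And>c r z. (c, r) \<in> P \<Longrightarrow> z \<in> sphere c (2 * r) \<Longrightarrow> (\<integral>\<^sup>+\<omega>. ennreal ((norm (F \<omega> z))\<^sup>2) \<partial>N) \<le> ennreal b"
    and "b \<ge> 0" "\<delta> > 0"
  shows "\<exists>A\<in>sets N. emeasure N A \<le> ennreal (2 * real (card P) * b / \<delta>\<^sup>2) \<and> (\<forall>\<omega>\<in>space N - A. \<forall>z\<in>K. norm (F \<omega> z) < \<delta>)"
proof -
  interpret N: sigma_finite_measure N by (rule N)
  interpret pair_sigma_finite N lborel ..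
  have P: "finite P" "\<And>c r. (c, r) \<in> P \<Longrightarrow> r > 0" "\<And>c r. (c, r) \<in> P \<Longrightarrow> cball c (2 * r) \<subseteq> D" "K \<subseteq> (\<Union>(c, r)\<in>P. ball c r)"
    using cover by (auto simp: disc_cover_def)
  have sph: "circlepath c (2 * r) t \<in> sphere c (2 * r)" if "(c, r) \<in> P" for c r t
    using P(2)[OF that] by (auto simp: circlepath dist_norm norm_mult norm_exp_eq_Re)
  have sphD: "circlepath c (2 * r) t \<in> D" if "(c, r) \<in> P" for c r t
    using sph[OF that, of t] P(3)[OF that] by auto
  have jm: "(\<lambda>(\<omega>, t). F \<omega> (circlepath c (2 * r) t)) \<in> borel_measurable (N \<Otimes>\<^sub>M lborel)" if p: "(c, r) \<in> P" for c r
  proof (rule borel_measurable_caratheodory)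
    show "(\<lambda>\<omega>. F \<omega> (circlepath c (2 * r) t)) \<in> borel_measurable N" for t
      by (intro meas sphD p)
    show "continuous_on UNIV (\<lambda>t. F \<omega> (circlepath c (2 * r) t))" if "\<omega> \<in> space N" for \<omega>
      by (rule continuous_on_compose2[OF holomorphic_on_imp_continuous_on[OF hol[OF that]]])
         (use sphD[OF p] in \<open>auto simp: circlepath intro!: continuous_intros\<close>)
  qed
  define \<phi> where "\<phi> = (\<lambda>p \<omega>. \<integral>\<^sup>+t. ennreal ((norm (F \<omega> (circlepath (fst p) (2 * snd p) t)))\<^sup>2) * indicator {0..1} t \<partial>lborel)"
  define \<Phi> where "\<Phi> = (\<lambda>\<omega>. 2 * (\<Sum>p\<in>P. \<phi> p \<omega>))"
  have jm2: "(\<lambda>(\<omega>, t). ennreal ((norm (F \<omega> (circlepath (fst p) (2 * snd p) t)))\<^sup>2) * indicator {0..1} t) \<in> borel_measurable (N \<Otimes>\<^sub>M lborel)"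
    if "p \<in> P" for p
  proof -
    have [measurable]: "(\<lambda>x. F (fst x) (circlepath (fst p) (2 * snd p) (snd x))) \<in> borel_measurable (N \<Otimes>\<^sub>M lborel)"
      using jm[of "fst p" "snd p"] that by (simp add: split_beta)
    show ?thesis unfolding split_beta by measurable
  qed
  have \<phi>m: "\<phi> p \<in> borel_measurable N" if "p \<in> P" for p
    unfolding \<phi>_def using lborel.borel_measurable_nn_integral_fst[OF jm2[OF that]] by simp
  then have \<Phi>m: "\<Phi> \<in> borel_measurable N" unfolding \<Phi>_def by measurable
  have "(\<integral>\<^sup>+\<omega>. \<phi> p \<omega> \<partial>N) \<le> ennreal b" if p: "p \<in> P" for p
  proof -
    have "(\<integral>\<^sup>+\<omega>. \<phi> p \<omega> \<partial>N) = (\<integral>\<^sup>+t. (\<integral>\<^sup>+\<omega>. ennreal ((norm (F \<omega> (circlepath (fst p) (2 * snd p) t)))\<^sup>2) * indicator {0..1} t \<partial>N) \<partial>lborel)"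
      unfolding \<phi>_def using Fubini[OF jm2[OF p], symmetric] by simp
    also have "\<dots> \<le> (\<integral>\<^sup>+t. ennreal b * indicator {0..1} (t::real) \<partial>lborel)"
    proof (intro nn_integral_mono)
      fix t :: real
      have "(\<integral>\<^sup>+\<omega>. ennreal ((norm (F \<omega> (circlepath (fst p) (2 * snd p) t)))\<^sup>2) * indicator {0..1} t \<partial>N) =
         (\<integral>\<^sup>+\<omega>. ennreal ((norm (F \<omega> (circlepath (fst p) (2 * snd p) t)))\<^sup>2) \<partial>N) * indicator {0..1} t"
        by (cases "t \<in> {0..1}") auto
      also have "\<dots> \<le> ennreal b * indicator {0..1} t"
        using p sph[of "fst p" "snd p" t] by (intro mult_right_mono b[of "fst p" "snd p"]) auto
      finally show "(\<integral>\<^sup>+\<omega>. ennreal ((norm (F \<omega> (circlepath (fst p) (2 * snd p) t)))\<^sup>2) * indicator {0..1} t \<partial>N) \<le> ennreal b * indicator {0..1} t" .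
    qed
    also have "\<dots> = ennreal b" by (simp add: nn_integral_cmult)
    finally show ?thesis .
  qed
  then have "(\<Sum>p\<in>P. \<integral>\<^sup>+\<omega>. \<phi> p \<omega> \<partial>N) \<le> (\<Sum>p\<in>P. ennreal b)" by (intro sum_mono)
  moreover have "(\<integral>\<^sup>+\<omega>. \<Phi> \<omega> \<partial>N) = 2 * (\<Sum>p\<in>P. \<integral>\<^sup>+\<omega>. \<phi> p \<omega> \<partial>N)"
    unfolding \<Phi>_def using \<phi>m by (subst nn_integral_cmult) (auto intro!: arg_cong[where f = "\<lambda>x. 2 * x"] nn_integral_sum)
  ultimately have "(\<integral>\<^sup>+\<omega>. \<Phi> \<omega> \<partial>N) \<le> 2 * (\<Sum>p\<in>P. ennreal b)" by (simp add: mult_left_mono)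
  also have "\<dots> = ennreal (2 * real (card P) * b)"
    using \<open>b \<ge> 0\<close> by (simp add: ennreal_mult ennreal_of_nat_eq_real_of_nat mult.assoc)
  finally have E\<Phi>: "(\<integral>\<^sup>+\<omega>. \<Phi> \<omega> \<partial>N) \<le> ennreal (2 * real (card P) * b)" .
  have dom: "ennreal ((norm (F \<omega> z))\<^sup>2) \<le> \<Phi> \<omega>" if \<omega>: "\<omega> \<in> space N" and z: "z \<in> K" for \<omega> z
  proof -
    obtain c r where p: "(c, r) \<in> P" "z \<in> ball c r" using P(4) z by auto
    have h: "F \<omega> holomorphic_on cball c (2 * r)" using hol[OF \<omega>] P(3)[OF p(1)] by (rule holomorphic_on_subset)
    have cF: "continuous_on {0..1} (\<lambda>t. F \<omega> (circlepath c (2 * r) t))"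
      by (rule continuous_on_compose2[OF holomorphic_on_imp_continuous_on[OF hol[OF \<omega>]]])
         (use sphD[OF p(1)] in \<open>auto simp: circlepath intro!: continuous_intros\<close>)
    have "ennreal ((norm (F \<omega> z))\<^sup>2) \<le> ennreal (2 * integral {0..1} (\<lambda>t. (norm (F \<omega> (circlepath c (2 * r) t)))\<^sup>2))"
      by (intro ennreal_leI norm_square_le_circle_mean[OF h P(2)[OF p(1)] p(2)])
    also have "\<dots> = 2 * \<phi> (c, r) \<omega>"
      unfolding \<phi>_def fst_conv snd_conv by (subst nn_integral_interval) (auto intro!: continuous_intros cF simp: ennreal_mult')
    also have "\<dots> \<le> \<Phi> \<omega>"
      unfolding \<Phi>_def using P(1) p(1) by (intro mult_left_mono member_le_sum) auto
    finally show ?thesis .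
  qed
  \<comment> \<open>The event \<Phi> \<ge> \<delta>^2, in the shape that Markov's inequality
    expects.\<close>
  define A where "A = {\<omega> \<in> space N. 1 \<le> ennreal (1 / \<delta>\<^sup>2) * \<Phi> \<omega>}"
  have "A \<in> sets N" unfolding A_def using \<Phi>m by measurable
  moreover have "emeasure N A \<le> ennreal (2 * real (card P) * b / \<delta>\<^sup>2)"
  proof -
    have "emeasure N A \<le> ennreal (1 / \<delta>\<^sup>2) * (\<integral>\<^sup>+\<omega>. \<Phi> \<omega> * indicator (space N) \<omega> \<partial>N)"
      unfolding A_def using \<Phi>m by (intro nn_integral_Markov_inequality) auto
    also have "(\<integral>\<^sup>+\<omega>. \<Phi> \<omega> * indicator (space N) \<omega> \<partial>N) = (\<integral>\<^sup>+\<omega>. \<Phi> \<omega> \<partial>N)" by (intro nn_integral_cong) auto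
    also have "ennreal (1 / \<delta>\<^sup>2) * \<dots> \<le> ennreal (1 / \<delta>\<^sup>2) * ennreal (2 * real (card P) * b)" by (intro mult_left_mono E\<Phi>) auto
    also have "\<dots> = ennreal (2 * real (card P) * b / \<delta>\<^sup>2)" using \<open>b \<ge> 0\<close> by (simp flip: ennreal_mult)
    finally show ?thesis .
  qed
  moreover have "norm (F \<omega> z) < \<delta>" if \<omega>: "\<omega> \<in> space N - A" and z: "z \<in> K" for \<omega> z
  proof -
    have lt: "ennreal (1 / \<delta>\<^sup>2) * \<Phi> \<omega> < 1" using \<omega> by (auto simp: A_def not_le)
    have le: "ennreal (1 / \<delta>\<^sup>2) * ennreal ((norm (F \<omega> z))\<^sup>2) \<le> ennreal (1 / \<delta>\<^sup>2) * \<Phi> \<omega>"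
      using \<omega> z by (intro mult_left_mono dom) auto
    have "ennreal (1 / \<delta>\<^sup>2 * (norm (F \<omega> z))\<^sup>2) < ennreal 1"
      using le_less_trans[OF le lt] by (simp only: ennreal_mult''[OF zero_le_power2] ennreal_1)
    then have "1 / \<delta>\<^sup>2 * (norm (F \<omega> z))\<^sup>2 < 1" by (subst (asm) ennreal_less_iff) auto
    then have "(norm (F \<omega> z))\<^sup>2 < \<delta>\<^sup>2" using \<open>\<delta> > 0\<close> by (simp add: field_simps)
    from power2_less_imp_less[OF this] \<open>\<delta> > 0\<close> show ?thesis by simp
  qed
  ultimately show ?thesis by blast
qed

section \<open>Comparison of expectations of a continuous functional\<close>

lemma expectation_close_off_set:
  fixes u v :: "'a \<Rightarrow> real"
  assumes "prob_space N" "u \<in> borel_measurable N" "v \<in> borel_measurable N"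
    and B: "\<And>\<omega>. \<omega> \<in> space N \<Longrightarrow> \<bar>u \<omega>\<bar> \<le> B" "\<And>\<omega>. \<omega> \<in> space N \<Longrightarrow> \<bar>v \<omega>\<bar> \<le> B"
    and A: "A \<in> sets N" "emeasure N A \<le> ennreal \<eta>" and "0 \<le> \<eta>" "0 \<le> e" "0 \<le> B"
    and close: "\<And>\<omega>. \<omega> \<in> space N - A \<Longrightarrow> \<bar>u \<omega> - v \<omega>\<bar> \<le> e"
  shows "\<bar>(\<integral>\<omega>. u \<omega> \<partial>N) - (\<integral>\<omega>. v \<omega> \<partial>N)\<bar> \<le> e + 2 * B * \<eta>"
proof -
  interpret prob_space N by fact
  have iu: "integrable N u" "integrable N v"
    using assms by (auto intro!: integrable_const_bound[where B = B])
  have "\<bar>(\<integral>\<omega>. u \<omega> \<partial>N) - (\<integral>\<omega>. v \<omega> \<partial>N)\<bar> = \<bar>\<integral>\<omega>. u \<omega> - v \<omega> \<partial>N\<bar>" using iu by simp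
  also have "\<dots> \<le> (\<integral>\<omega>. \<bar>u \<omega> - v \<omega>\<bar> \<partial>N)" by (rule integral_abs_bound)
  also have "\<dots> \<le> (\<integral>\<omega>. e + 2 * B * indicator A \<omega> \<partial>N)"
  proof (rule integral_mono)
    show "integrable N (\<lambda>\<omega>. \<bar>u \<omega> - v \<omega>\<bar>)" using iu by simp
    show "integrable N (\<lambda>\<omega>. e + 2 * B * indicator A \<omega>)"
      using A by (intro Bochner_Integration.integrable_add integrable_mult_right integrable_real_indicator) (auto simp: less_top[symmetric])
    fix \<omega> assume \<omega>: "\<omega> \<in> space N"
    show "\<bar>u \<omega> - v \<omega>\<bar> \<le> e + 2 * B * indicator A \<omega>"
    proof (cases "\<omega> \<in> A")
      case True
      have "\<bar>u \<omega> - v \<omega>\<bar> \<le> 2 * B" using B[OF \<omega>] by linarith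
      then show ?thesis using True \<open>0 \<le> e\<close> by simp
    next
      case False
      then show ?thesis using close[of \<omega>] \<omega> by simp
    qed
  qed
  also have "\<dots> = e + 2 * B * measure N A"
  proof -
    have "integrable N (\<lambda>\<omega>. 2 * B * indicator A \<omega>)"
      using A by (intro integrable_mult_right integrable_real_indicator) (auto simp: less_top[symmetric])
    then have "(\<integral>\<omega>. e + 2 * B * indicator A \<omega> \<partial>N) = (\<integral>\<omega>. e \<partial>N) + (\<integral>\<omega>. 2 * B * indicator A \<omega> \<partial>N)"
      by (intro Bochner_Integration.integral_add) auto
    then show ?thesis using A(1) sets.sets_into_space[OF A(1)] by (simp add: prob_space Int_absorb2)
  qed
  also have "\<dots> \<le> e + 2 * B * \<eta>"
    using A(2) assms by (intro add_left_mono mult_left_mono) (auto simp: emeasure_eq_measure)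
  finally show ?thesis .
qed

text \<open>The probabilities that X exceeds \<open>R l\<close> on \<open>K l\<close> are at most
  \<eta>/2^(l+1) and add up to \<eta>; failure of closeness on \<open>K n\<close> costs another
  \<eta>. Elsewhere \<open>uc\<close> applies, and on a set of measure 2\<eta> the difference is at
  most 2B. Moment bounds are demanded of X alone, in line with the one-sided boundedness in
  \<open>uc\<close>.\<close>

lemma hol_expectation_close:
  fixes N :: "'a measure"
  assumes N: "prob_space N" and D: "open D"
    and X: "X \<in> measurable N (borel_of (hol_space D))" and Y: "Y \<in> measurable N (borel_of (hol_space D))"
    and cover: "\<And>l. disc_cover D (K l) (P l)"
    and bX: "\<And>l c r z. (c, r) \<in> P l \<Longrightarrow> z \<in> sphere c (2 * r) \<Longrightarrow> (\<integral>\<^sup>+\<omega>. ennreal ((norm (X \<omega> z))\<^sup>2) \<partial>N) \<le> ennreal (b l)"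
    and b: "\<And>l. b l \<ge> 0" and R: "\<And>l. R l > 0" "\<And>l. 2 * real (card (P l)) * b l / (R l)\<^sup>2 \<le> \<eta> * (1/2) ^ Suc l"
    and bD: "\<And>c r z. (c, r) \<in> P n \<Longrightarrow> z \<in> sphere c (2 * r) \<Longrightarrow> (\<integral>\<^sup>+\<omega>. ennreal ((norm (X \<omega> z - Y \<omega> z))\<^sup>2) \<partial>N) \<le> ennreal b'"
    and b': "b' \<ge> 0" "2 * real (card (P n)) * b' / \<delta>\<^sup>2 \<le> \<eta>" and \<delta>: "\<delta> > 0" and \<eta>: "\<eta> \<ge> 0" and e: "e \<ge> 0"
    and uc: "\<And>f h. f \<in> analytic_functions D \<Longrightarrow> h \<in> analytic_functions D \<Longrightarrow>
       (\<And>l z. z \<in> K l \<Longrightarrow> norm (f z) \<le> R l) \<Longrightarrow> (\<And>z. z \<in> K n \<Longrightarrow> norm (f z - h z) < \<delta>) \<Longrightarrow> \<bar>g f - g h\<bar> < e"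
    and g: "continuous_map (hol_space D) euclideanreal g" and B: "\<And>f. f \<in> analytic_functions D \<Longrightarrow> \<bar>g f\<bar> \<le> B" "B \<ge> 0"
  shows "\<bar>(\<integral>\<omega>. g (X \<omega>) \<partial>N) - (\<integral>\<omega>. g (Y \<omega>) \<partial>N)\<bar> \<le> e + 4 * B * \<eta>"
proof -
  interpret prob_space N by (rule N)
  have AF: "X \<omega> \<in> analytic_functions D" "Y \<omega> \<in> analytic_functions D" if "\<omega> \<in> space N" for \<omega>
    using measurable_space[OF X that] measurable_space[OF Y that] by (auto simp: topspace_hol_space)
  have hol: "X \<omega> holomorphic_on D" "Y \<omega> holomorphic_on D" if "\<omega> \<in> space N" for \<omega>
    using AF[OF that] analytic_functions_holomorphic by auto
  have ev: "(\<lambda>\<omega>. X \<omega> z) \<in> borel_measurable N" "(\<lambda>\<omega>. Y \<omega> z) \<in> borel_measurable N" if "z \<in> D" for z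
    using measurable_compose[OF X borel_measurable_continuous_map[OF continuous_map_eval[OF that]]]
      measurable_compose[OF Y borel_measurable_continuous_map[OF continuous_map_eval[OF that]]] by auto
  have "\<exists>A\<in>sets N. emeasure N A \<le> ennreal (\<eta> * (1/2) ^ Suc l) \<and> (\<forall>\<omega>\<in>space N - A. \<forall>z\<in>K l. norm (X \<omega> z) < R l)" for l
  proof -
    have "\<exists>A\<in>sets N. emeasure N A \<le> ennreal (2 * real (card (P l)) * b l / (R l)\<^sup>2) \<and> (\<forall>\<omega>\<in>space N - A. \<forall>z\<in>K l. norm (X \<omega> z) < R l)"
      by (rule sup_markov[OF sigma_finite_measure_axioms cover hol(1) ev(1) bX b R(1)])
    then show ?thesis using R(2)[of l] by (meson ennreal_leI order_trans)
  qed
  then obtain A where A: "\<And>l. A l \<in> sets N" "\<And>l. emeasure N (A l) \<le> ennreal (\<eta> * (1/2) ^ Suc l)"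
     "\<And>l \<omega> z. \<omega> \<in> space N - A l \<Longrightarrow> z \<in> K l \<Longrightarrow> norm (X \<omega> z) < R l" by metis
  have "\<exists>A\<in>sets N. emeasure N A \<le> ennreal (2 * real (card (P n)) * b' / \<delta>\<^sup>2) \<and> (\<forall>\<omega>\<in>space N - A. \<forall>z\<in>K n. norm (X \<omega> z - Y \<omega> z) < \<delta>)"
    using sup_markov[OF sigma_finite_measure_axioms cover[of n], of "\<lambda>\<omega> z. X \<omega> z - Y \<omega> z" b' \<delta>] hol ev bD b'(1) \<delta>
    by (auto intro: holomorphic_intros borel_measurable_diff)
  then obtain A' where A': "A' \<in> sets N" "emeasure N A' \<le> ennreal \<eta>" "\<And>\<omega> z. \<omega> \<in> space N - A' \<Longrightarrow> z \<in> K n \<Longrightarrow> norm (X \<omega> z - Y \<omega> z) < \<delta>"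
    using b'(2) by (meson ennreal_leI order_trans)
  define E where "E = (\<Union>l. A l) \<union> A'"
  have "emeasure N (\<Union>l. A l) \<le> (\<Sum>l. emeasure N (A l))" using A(1) by (intro emeasure_subadditive_countably) auto
  also have "\<dots> \<le> (\<Sum>l. ennreal (\<eta> * (1/2) ^ Suc l))" by (intro suminf_le A) auto
  also have "\<dots> = ennreal (\<Sum>l. \<eta> * (1/2) ^ Suc l)"
    using \<eta> sums_summable[OF power_half_series] by (intro suminf_ennreal2 summable_mult) auto
  also have "(\<Sum>l. \<eta> * (1/2) ^ Suc l) = \<eta>"
    using sums_mult[OF power_half_series, of \<eta>] by (simp add: sums_iff)
  finally have EA: "emeasure N (\<Union>l. A l) \<le> ennreal \<eta>" .
  have "emeasure N E \<le> emeasure N (\<Union>l. A l) + emeasure N A'"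
    unfolding E_def using A(1) A'(1) by (intro emeasure_subadditive) auto
  also have "\<dots> \<le> ennreal \<eta> + ennreal \<eta>" by (intro add_mono EA A')
  also have "\<dots> = ennreal (2 * \<eta>)" using \<eta> by (simp flip: ennreal_plus)
  finally have EE: "emeasure N E \<le> ennreal (2 * \<eta>)" .
  have gm: "g \<in> borel_measurable (borel_of (hol_space D))" by (rule borel_measurable_continuous_map[OF g])
  have "\<bar>(\<integral>\<omega>. g (X \<omega>) \<partial>N) - (\<integral>\<omega>. g (Y \<omega>) \<partial>N)\<bar> \<le> e + 2 * B * (2 * \<eta>)"
  proof (rule expectation_close_off_set[OF N _ _ _ _ _ EE])
    show "(\<lambda>\<omega>. g (X \<omega>)) \<in> borel_measurable N" "(\<lambda>\<omega>. g (Y \<omega>)) \<in> borel_measurable N"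
      using measurable_compose[OF X gm] measurable_compose[OF Y gm] by auto
    show "E \<in> sets N" unfolding E_def using A(1) A'(1) by auto
    fix \<omega> assume \<omega>: "\<omega> \<in> space N - E"
    have "\<bar>g (X \<omega>) - g (Y \<omega>)\<bar> < e"
    proof (rule uc)
      show "norm (X \<omega> z) \<le> R l" if "z \<in> K l" for l z
        using A(3)[of \<omega> l z] \<omega> that by (auto simp: E_def intro: less_imp_le)
      show "norm (X \<omega> z - Y \<omega> z) < \<delta>" if "z \<in> K n" for z
        using A'(3)[of \<omega> z] \<omega> that by (auto simp: E_def)
    qed (use AF \<omega> in auto)
    then show "\<bar>g (X \<omega>) - g (Y \<omega>)\<bar> \<le> e" by simp
  qed (use AF B \<eta> e in auto)
  then show ?thesis by simp
qed

text \<open>An open set \<open>U\<close> is the union of the closed sets \<open>V m\<close> of functions whose neighbourhood of radius \<open>1/(m+1)\<close> on \<open>K m\<close>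
  lies in \<open>U\<close>; the limit lies in \<open>U\<close> iff the sequence eventually stays in one \<open>V m\<close>.\<close>

lemma hol_space_measurable_limit:
  assumes D: "open D" and Fm: "\<And>N. F N \<in> measurable M (borel_of (hol_space D))"
    and G: "\<And>\<omega>. \<omega> \<in> space M \<Longrightarrow> G \<omega> \<in> analytic_functions D"
    and lim: "\<And>\<omega> C. \<omega> \<in> space M \<Longrightarrow> compact C \<Longrightarrow> C \<subseteq> D \<Longrightarrow> uniform_limit C (\<lambda>N. F N \<omega>) (G \<omega>) sequentially"
  shows "G \<in> measurable M (borel_of (hol_space D))"
  unfolding borel_of_def
proof (rule measurable_measure_of)
  show "{U. openin (hol_space D) U} \<subseteq> Pow (topspace (hol_space D))" using openin_subset by auto
  show "G \<in> space M \<rightarrow> topspace (hol_space D)" using G by (auto simp: topspace_hol_space)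
  fix U assume "U \<in> {U. openin (hol_space D) U}"
  then have U: "compact_convergence_open D U" by (simp add: openin_hol_space)
  let ?AF = "analytic_functions D"
  obtain K where K: "\<And>n. compact (K n)" "\<And>n. K n \<subseteq> D"
    and Kex: "\<And>C. compact C \<Longrightarrow> C \<subseteq> D \<Longrightarrow> \<exists>N::nat. \<forall>n\<ge>N. C \<subseteq> K n"
    using compact_exhaustion[OF D] by metis
  define V where "V = (\<lambda>m. {f \<in> ?AF. \<forall>g\<in>?AF. (\<forall>z\<in>K m. dist (f z) (g z) < 1 / real (Suc m)) \<longrightarrow> g \<in> U})"
  have closed: "closedin (hol_space D) (V m)" for m
  proof -
    have "compact_convergence_open D (?AF - V m)"
      unfolding compact_convergence_open_def
    proof (intro conjI ballI)
      fix f assume "f \<in> ?AF - V m"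
      then obtain g where g: "f \<in> ?AF" "g \<in> ?AF" "g \<notin> U" "\<And>z. z \<in> K m \<Longrightarrow> dist (f z) (g z) < 1 / real (Suc m)"
        by (auto simp: V_def)
      have "\<exists>\<rho>. \<rho> < 1 / real (Suc m) \<and> (\<forall>z\<in>K m. dist (f z) (g z) \<le> \<rho>)"
      proof (cases "K m = {}")
        case True
        then show ?thesis by (intro exI[of _ 0]) auto
      next
        case False
        have "continuous_on (K m) f" "continuous_on (K m) g"
          using g(1,2) K(2) analytic_functions_holomorphic holomorphic_on_imp_continuous_on continuous_on_subset by blast+
        then have "continuous_on (K m) (\<lambda>z. dist (f z) (g z))" by (intro continuous_intros)
        then obtain w where "w \<in> K m" "\<forall>z\<in>K m. dist (f z) (g z) \<le> dist (f w) (g w)"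
          using continuous_attains_sup[OF K(1) False] by blast
        then show ?thesis using g(4) by blast
      qed
      then obtain \<rho> where \<rho>: "\<rho> < 1 / real (Suc m)" "\<And>z. z \<in> K m \<Longrightarrow> dist (f z) (g z) \<le> \<rho>" by blast
      have "{h \<in> ?AF. \<forall>z\<in>K m. dist (f z) (h z) < 1 / real (Suc m) - \<rho>} \<subseteq> ?AF - V m"
      proof
        fix h assume h: "h \<in> {h \<in> ?AF. \<forall>z\<in>K m. dist (f z) (h z) < 1 / real (Suc m) - \<rho>}"
        have "dist (h z) (g z) < 1 / real (Suc m)" if "z \<in> K m" for z
        proof -
          have "dist (f z) (h z) < 1 / real (Suc m) - \<rho>" using h that by blast
          then show ?thesis using \<rho>(2)[OF that] dist_triangle[of "h z" "g z" "f z"] by (simp add: dist_commute)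
        qed
        then show "h \<in> ?AF - V m" using h g unfolding V_def by blast
      qed
      then show "\<exists>K' \<epsilon>. compact K' \<and> K' \<subseteq> D \<and> \<epsilon> > 0 \<and> {h \<in> ?AF. \<forall>z\<in>K'. dist (f z) (h z) < \<epsilon>} \<subseteq> ?AF - V m"
        using K \<rho>(1) by (intro exI[of _ "K m"] exI[of _ "1 / real (Suc m) - \<rho>"]) auto
    qed auto
    then show ?thesis by (auto simp: closedin_def openin_hol_space topspace_hol_space V_def)
  qed
  have FAF: "F N \<omega> \<in> ?AF" if "\<omega> \<in> space M" for N \<omega>
    using measurable_space[OF Fm that] by (simp add: topspace_hol_space)
  have iff: "G \<omega> \<in> U \<longleftrightarrow> (\<exists>m N0. \<forall>N\<ge>N0. F N \<omega> \<in> V m)" if \<omega>: "\<omega> \<in> space M" for \<omega>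
  proof
    assume "G \<omega> \<in> U"
    then obtain C \<epsilon> where C: "compact C" "C \<subseteq> D" "\<epsilon> > 0" "{g \<in> ?AF. \<forall>z\<in>C. dist (G \<omega> z) (g z) < \<epsilon>} \<subseteq> U"
      using U unfolding compact_convergence_open_def by blast
    obtain N1 where N1: "\<forall>n\<ge>N1. C \<subseteq> K n" using Kex[OF C(1,2)] by blast
    obtain N2 where N2: "1 / real (Suc N2) < \<epsilon> / 2" using C(3) nat_approx_posE[of "\<epsilon> / 2"] by auto
    define m where "m = max N1 N2"
    have m: "C \<subseteq> K m" "1 / real (Suc m) < \<epsilon> / 2"
    proof -
      show "C \<subseteq> K m" using N1 by (simp add: m_def)
      have "1 / real (Suc m) \<le> 1 / real (Suc N2)" by (intro divide_left_mono) (auto simp: m_def)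
      then show "1 / real (Suc m) < \<epsilon> / 2" using N2 by simp
    qed
    have "\<forall>\<^sub>F N in sequentially. \<forall>z\<in>C. dist (F N \<omega> z) (G \<omega> z) < \<epsilon> / 2"
      using uniform_limitD[OF lim[OF \<omega> C(1,2)], of "\<epsilon> / 2"] C(3) by simp
    then obtain N0 where N0: "\<And>N z. N \<ge> N0 \<Longrightarrow> z \<in> C \<Longrightarrow> dist (F N \<omega> z) (G \<omega> z) < \<epsilon> / 2" by (auto simp: eventually_sequentially)
    have "F N \<omega> \<in> V m" if "N \<ge> N0" for N
      unfolding V_def
    proof (intro CollectI conjI ballI impI FAF \<omega>)
      fix g assume g: "g \<in> ?AF" "\<forall>z\<in>K m. dist (F N \<omega> z) (g z) < 1 / real (Suc m)"
      have "dist (G \<omega> z) (g z) < \<epsilon>" if "z \<in> C" for z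
      proof -
        have "dist (F N \<omega> z) (g z) < 1 / real (Suc m)" using g(2) m(1) that by blast
        then show ?thesis
          using N0[OF \<open>N \<ge> N0\<close> that] m(2) dist_triangle[of "G \<omega> z" "g z" "F N \<omega> z"] by (simp add: dist_commute)
      qed
      then show "g \<in> U" using C(4) g(1) by blast
    qed
    then show "\<exists>m N0. \<forall>N\<ge>N0. F N \<omega> \<in> V m" by blast
  next
    assume "\<exists>m N0. \<forall>N\<ge>N0. F N \<omega> \<in> V m"
    then obtain m N0 where m: "\<forall>N\<ge>N0. F N \<omega> \<in> V m" by blast
    have "\<forall>\<^sub>F N in sequentially. \<forall>z\<in>K m. dist (F N \<omega> z) (G \<omega> z) < 1 / real (Suc m)"
      using uniform_limitD[OF lim[OF \<omega> K(1,2)], of "1 / real (Suc m)"] by simp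
    then obtain N1 where N1: "\<forall>N\<ge>N1. \<forall>z\<in>K m. dist (F N \<omega> z) (G \<omega> z) < 1 / real (Suc m)" by (auto simp: eventually_sequentially)
    have "F (max N0 N1) \<omega> \<in> V m" "\<forall>z\<in>K m. dist (F (max N0 N1) \<omega> z) (G \<omega> z) < 1 / real (Suc m)" using m N1 by auto
    then show "G \<omega> \<in> U" using G[OF \<omega>] unfolding V_def by blast
  qed
  have "G -` U \<inter> space M = (\<Union>m. \<Union>N0. \<Inter>N\<in>{N0..}. F N -` V m \<inter> space M)"
    using iff by (auto simp: atLeast_def) blast+
  also have "\<dots> \<in> sets M"
    by (intro sets.countable_UN sets.countable_INT' measurable_sets[OF Fm] borel_of_closedin closed image_subsetI subsetI) auto
  finally show "G -` U \<inter> space M \<in> sets M" .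
qed

section \<open>Random Dirichlet series\<close>

lemma open_strip: "open strip"
proof -
  have "strip = {s. Re s > 1/2} \<inter> {s. Re s < 1}" by (auto simp: strip_def)
  moreover have "open ({s. Re s > 1/2} \<inter> {s. Re s < 1})"
    by (intro open_Int open_halfspace_Re_gt open_halfspace_Re_lt)
  ultimately show ?thesis by (simp only:)
qed

definition zeta_psum :: "nat \<Rightarrow> (nat \<Rightarrow> complex) \<Rightarrow> complex \<Rightarrow> complex" where
  "zeta_psum N \<omega> s = (\<Sum>n=1..N. random_zeta_term \<omega> n s)"

definition zeta_diff_psum :: "int \<Rightarrow> int \<Rightarrow> nat \<Rightarrow> (nat \<Rightarrow> complex) \<Rightarrow> complex \<Rightarrow> complex" where
  "zeta_diff_psum j k N \<omega> = (\<lambda>s\<in>strip. zeta_psum N (Omega_power \<omega> j) s - zeta_psum N (Omega_power \<omega> k) s)"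

lemma zeta_psum_holomorphic: "zeta_psum N \<omega> holomorphic_on S"
  unfolding zeta_psum_def random_zeta_term_def by (intro holomorphic_intros)

lemma zeta_diff_psum_analytic: "zeta_diff_psum j k N \<omega> \<in> analytic_functions strip"
  unfolding zeta_diff_psum_def
  by (intro analytic_functionsI open_strip holomorphic_intros zeta_psum_holomorphic)

lemma continuous_on_zeta_psum:
  "continuous_on (torus \<times> S) (\<lambda>(\<omega>, s). zeta_psum N (Omega_power \<omega> j) s)"
  unfolding zeta_psum_def random_zeta_term_def split_beta
proof (intro continuous_on_sum continuous_on_mult)
  fix n assume "n \<in> {1..N}"
  show "continuous_on (torus \<times> S) (\<lambda>x. Omega_ext (Omega_power (fst x) j) n)"
    by (rule continuous_on_compose2[OF continuous_on_Omega_ext_power continuous_on_fst[OF continuous_on_id]]) auto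
  show "continuous_on (torus \<times> S) (\<lambda>x. of_nat n powr - snd x)"
    using \<open>n \<in> {1..N}\<close> by (intro continuous_on_nat_powr continuous_intros) auto
qed

lemma zeta_diff_psum_continuous: "continuous_map (top_of_set torus) (hol_space strip) (zeta_diff_psum j k N)"
proof (rule continuous_map_into_hol_space)
  have "continuous_on (torus \<times> strip) (\<lambda>x. (case x of (\<omega>, s) \<Rightarrow> zeta_psum N (Omega_power \<omega> j) s) - (case x of (\<omega>, s) \<Rightarrow> zeta_psum N (Omega_power \<omega> k) s))"
    by (intro continuous_on_diff continuous_on_zeta_psum)
  then show "continuous_on (torus \<times> strip) (\<lambda>(\<omega>, s). zeta_diff_psum j k N \<omega> s)"
    by (rule continuous_on_cong[THEN iffD1, rotated -1]) (auto simp: zeta_diff_psum_def)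
qed (rule zeta_diff_psum_analytic)

text \<open>Valid without convergence, both sides being the same description of a limit. In this
  form uniform convergence on a compact set names its own limit function.\<close>

lemma random_zeta_eq_lim: "random_zeta s \<omega> = lim (\<lambda>N. zeta_psum N \<omega> s)"
proof -
  have "(\<Sum>n<N. random_zeta_term \<omega> (Suc n) s) = zeta_psum N \<omega> s" for N
    unfolding zeta_psum_def by (rule sum.reindex_bij_witness[of _ "\<lambda>n. n - 1" Suc]) auto
  then show ?thesis by (simp add: random_zeta_def suminf_eq_lim)
qed

lemma zeta_psum_uniform_limit:
  assumes "random_zeta_converges \<omega>" "compact C" "C \<subseteq> strip"
  shows "uniform_limit C (\<lambda>N. zeta_psum N \<omega>) (\<lambda>s. random_zeta s \<omega>) sequentially"
proof -
  have "uniformly_convergent_on C (\<lambda>N s. zeta_psum N \<omega> s)"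
    using assms unfolding random_zeta_converges_def zeta_psum_def by blast
  then show ?thesis unfolding uniformly_convergent_uniform_limit_iff random_zeta_eq_lim .
qed

lemma zeta_psum_tendsto:
  assumes "random_zeta_converges \<omega>" "z \<in> strip"
  shows "(\<lambda>N. zeta_psum N \<omega> z) \<longlonglongrightarrow> random_zeta z \<omega>"
  using tendsto_uniform_limitI[OF zeta_psum_uniform_limit[OF assms(1), of "{z}"]] assms(2) by auto

lemma random_zeta_holomorphic:
  assumes "random_zeta_converges \<omega>"
  shows "(\<lambda>s. random_zeta s \<omega>) holomorphic_on strip"
proof (rule holomorphic_uniform_sequence[OF open_strip zeta_psum_holomorphic])
  fix x assume "x \<in> strip"
  then obtain d where "d > 0" "cball x d \<subseteq> strip" using open_strip open_contains_cball by blast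
  then show "\<exists>d>0. cball x d \<subseteq> strip \<and> uniform_limit (cball x d) (\<lambda>N. zeta_psum N \<omega>) (\<lambda>s. random_zeta s \<omega>) sequentially"
    using zeta_psum_uniform_limit[OF assms] by (intro exI[of _ d]) auto
qed

section \<open>Measurability and second moments of the random tails\<close>

text \<open>The sum of n^(-2a) over n > N; N + 1 is the first index that the partial sum omits. It
  measures the tail on the torus and on the line alike.\<close>

definition tail_sum :: "real \<Rightarrow> nat \<Rightarrow> real" where
  "tail_sum a N = (\<Sum>n. real (n + (N + 1)) powr (- 2 * a))"

lemma tail_sum_nonneg: "a > 1/2 \<Longrightarrow> tail_sum a N \<ge> 0"
  unfolding tail_sum_def by (intro suminf_nonneg summable_shift_powr) auto

lemma tail_sum_tendsto:
  assumes "a > 1/2"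
  shows "tail_sum a \<longlonglongrightarrow> 0"
proof (rule tendsto_sandwich[OF _ _ tendsto_const])
  define \<delta> where "\<delta> = (2 * a - 1) / 2"
  have \<delta>: "\<delta> > 0" "- 2 * a \<le> -1 - \<delta>" "- 2 * a + 1 + \<delta> < 0" using assms by (auto simp: \<delta>_def field_simps)
  show "\<forall>\<^sub>F N in sequentially. 0 \<le> tail_sum a N" using tail_sum_nonneg[OF assms] by simp
  show "\<forall>\<^sub>F N in sequentially. tail_sum a N \<le> real (N + 1) powr (- 2 * a + 1 + \<delta>) * powr_series \<delta>"
    unfolding tail_sum_def using \<delta> by (intro always_eventually allI tail_powr_le) auto
  have "(\<lambda>N. real (N + 1) powr (- 2 * a + 1 + \<delta>)) \<longlonglongrightarrow> 0"
    by (rule LIMSEQ_ignore_initial_segment[where f = "\<lambda>n. real n powr (- 2 * a + 1 + \<delta>)"])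
       (rule tendsto_neg_powr, use \<delta> filterlim_real_sequentially in auto)
  from tendsto_mult[OF this tendsto_const[of "powr_series \<delta>"]]
  show "(\<lambda>N. real (N + 1) powr (- 2 * a + 1 + \<delta>) * powr_series \<delta>) \<longlonglongrightarrow> 0" by simp
qed

lemma norm_diff_square_le: "(norm (x - y))\<^sup>2 \<le> 2 * (norm x)\<^sup>2 + 2 * (norm y)\<^sup>2" for x y :: complex
proof -
  have "(norm (x - y))\<^sup>2 \<le> (norm x + norm y)\<^sup>2" by (intro power_mono norm_triangle_ineq4) auto
  also have "\<dots> \<le> 2 * (norm x)\<^sup>2 + 2 * (norm y)\<^sup>2"
    using sum_squares_bound[of "norm x" "norm y"] by (simp add: power2_sum)
  finally show ?thesis .
qed

context haar_torus
begin

lemma zeta_diff_psum_measurable: "zeta_diff_psum j k N \<in> measurable M (borel_of (hol_space strip))"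
  by (rule measurable_continuous_map[of Omega_top]) (simp_all add: Omega_top_eq[symmetric] sets_M zeta_diff_psum_continuous[folded Omega_top_eq])

text \<open>An intersection over uncountably many z is harmless here, because the sets are
  closed.\<close>

lemma torus_closed_condition_in_sets:
  assumes "\<And>z. z \<in> C \<Longrightarrow> continuous_on torus (\<lambda>\<omega>. f \<omega> z :: real)"
  shows "{\<omega> \<in> torus. \<forall>z\<in>C. f \<omega> z \<le> e} \<in> sets M"
proof -
  have "closedin (top_of_set torus) (torus \<inter> (\<Inter>z\<in>C. {\<omega> \<in> torus. f \<omega> z \<le> e}))"
  proof (cases "C = {}")
    case False
    have "closedin (top_of_set torus) {\<omega> \<in> torus. f \<omega> z \<le> e}" if "z \<in> C" for z
      using continuous_closedin_preimage[OF assms[OF that] closed_atMost[of e]] by (simp add: vimage_def Int_def)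
    then show ?thesis using False by (intro closedin_Int closedin_INT) auto
  qed auto
  moreover have "torus \<inter> (\<Inter>z\<in>C. {\<omega> \<in> torus. f \<omega> z \<le> e}) = {\<omega> \<in> torus. \<forall>z\<in>C. f \<omega> z \<le> e}" by auto
  ultimately show ?thesis using borel_of_closedin by (simp add: sets_M Omega_top_eq)
qed

text \<open>Cauchy's criterion on a countable exhaustion makes the set a countable combination of
  conditions on pairs of partial sums. Writing them with \<le> instead of < makes each of them
  closed.\<close>

lemma random_zeta_converges_measurable:
  "{\<omega> \<in> torus. random_zeta_converges (Omega_power \<omega> j)} \<in> sets M"
proof -
  obtain K where K: "\<And>n. compact (K n)" "\<And>n. K n \<subseteq> strip"
    and Kex: "\<And>C. compact C \<Longrightarrow> C \<subseteq> strip \<Longrightarrow> \<exists>N::nat. \<forall>n\<ge>N. C \<subseteq> K n"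
    using compact_exhaustion[OF open_strip] by metis
  let ?Q = "\<lambda>l m N N'. {\<omega> \<in> torus. \<forall>z\<in>K l. norm (zeta_psum N (Omega_power \<omega> j) z - zeta_psum N' (Omega_power \<omega> j) z) \<le> 1 / real (Suc m)}"
  have iff: "random_zeta_converges \<omega> \<longleftrightarrow> (\<forall>l m. \<exists>N0. \<forall>N\<ge>N0. \<forall>N'\<ge>N0. \<forall>z\<in>K l. norm (zeta_psum N \<omega> z - zeta_psum N' \<omega> z) \<le> 1 / real (Suc m))" for \<omega>
  proof -
    have "random_zeta_converges \<omega> \<longleftrightarrow> (\<forall>l. uniformly_convergent_on (K l) (\<lambda>N s. zeta_psum N \<omega> s))"
    proof
      assume "random_zeta_converges \<omega>"
      then show "\<forall>l. uniformly_convergent_on (K l) (\<lambda>N s. zeta_psum N \<omega> s)"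
        using K unfolding random_zeta_converges_def zeta_psum_def by blast
    next
      assume u: "\<forall>l. uniformly_convergent_on (K l) (\<lambda>N s. zeta_psum N \<omega> s)"
      have "uniformly_convergent_on C (\<lambda>N s. zeta_psum N \<omega> s)" if C: "compact C" "C \<subseteq> strip" for C
      proof -
        obtain n where "C \<subseteq> K n" using Kex[OF C] by blast
        then show ?thesis using u uniformly_convergent_on_subset by blast
      qed
      then show "random_zeta_converges \<omega>" unfolding random_zeta_converges_def zeta_psum_def by blast
    qed
    also have "\<dots> \<longleftrightarrow> (\<forall>l m. \<exists>N0. \<forall>N\<ge>N0. \<forall>N'\<ge>N0. \<forall>z\<in>K l. norm (zeta_psum N \<omega> z - zeta_psum N' \<omega> z) \<le> 1 / real (Suc m))"
    proof (intro iff_allI)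
      fix l
      show "uniformly_convergent_on (K l) (\<lambda>N s. zeta_psum N \<omega> s) \<longleftrightarrow> (\<forall>m. \<exists>N0. \<forall>N\<ge>N0. \<forall>N'\<ge>N0. \<forall>z\<in>K l. norm (zeta_psum N \<omega> z - zeta_psum N' \<omega> z) \<le> 1 / real (Suc m))"
        unfolding uniformly_convergent_eq_Cauchy uniformly_Cauchy_on_def
      proof (intro iffI allI impI)
        fix m :: nat assume a: "\<forall>e>0. \<exists>M. \<forall>x\<in>K l. \<forall>m\<ge>M. \<forall>n\<ge>M. dist (zeta_psum m \<omega> x) (zeta_psum n \<omega> x) < e"
        have "1 / real (Suc m) > 0" by simp
        then obtain M where "\<forall>x\<in>K l. \<forall>p\<ge>M. \<forall>n\<ge>M. dist (zeta_psum p \<omega> x) (zeta_psum n \<omega> x) < 1 / real (Suc m)" using a by blast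
        then show "\<exists>N0. \<forall>N\<ge>N0. \<forall>N'\<ge>N0. \<forall>z\<in>K l. norm (zeta_psum N \<omega> z - zeta_psum N' \<omega> z) \<le> 1 / real (Suc m)"
          by (intro exI[of _ M]) (auto simp: dist_norm intro: less_imp_le)
      next
        fix e :: real assume e: "e > 0" and a: "\<forall>m. \<exists>N0. \<forall>N\<ge>N0. \<forall>N'\<ge>N0. \<forall>z\<in>K l. norm (zeta_psum N \<omega> z - zeta_psum N' \<omega> z) \<le> 1 / real (Suc m)"
        obtain m where m: "1 / real (Suc m) < e" using nat_approx_posE[OF e] by auto
        obtain N0 where N0: "\<forall>N\<ge>N0. \<forall>N'\<ge>N0. \<forall>z\<in>K l. norm (zeta_psum N \<omega> z - zeta_psum N' \<omega> z) \<le> 1 / real (Suc m)" using a by blast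
        show "\<exists>M. \<forall>x\<in>K l. \<forall>m\<ge>M. \<forall>n\<ge>M. dist (zeta_psum m \<omega> x) (zeta_psum n \<omega> x) < e"
          using N0 m by (intro exI[of _ N0]) (auto simp: dist_norm intro: le_less_trans)
      qed
    qed
    finally show ?thesis .
  qed
  have "{\<omega> \<in> torus. random_zeta_converges (Omega_power \<omega> j)} = (\<Inter>l. \<Inter>m. \<Union>N0. \<Inter>N\<in>{N0..}. \<Inter>N'\<in>{N0..}. ?Q l m N N')"
    unfolding iff by fastforce
  also have "\<dots> \<in> sets M"
  proof (intro sets.countable_INT sets.countable_UN sets.countable_INT' image_subsetI)
    fix l m N N'
    show "?Q l m N N' \<in> sets M"
    proof (rule torus_closed_condition_in_sets)
      fix z
      have c: "continuous_on torus (\<lambda>\<omega>. zeta_psum N (Omega_power \<omega> j) z)" for N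
        unfolding zeta_psum_def random_zeta_term_def
        by (intro continuous_on_sum continuous_on_mult continuous_on_Omega_ext_power continuous_on_const)
      show "continuous_on torus (\<lambda>\<omega>. norm (zeta_psum N (Omega_power \<omega> j) z - zeta_psum N' (Omega_power \<omega> j) z))"
        by (intro continuous_on_norm continuous_on_diff c)
    qed
  qed auto
  finally show ?thesis .
qed

text \<open>The partial sums are set to 0 outside the convergence set G, just as the random function
  is. Hence they converge to it at every point, not only almost everywhere, and the limit is Borel
  without completing the measure.\<close>

lemma zeta_diff_random_measurable: "zeta_diff_random j k \<in> measurable M (borel_of (hol_space strip))"
proof -
  define G where "G = {\<omega> \<in> torus. random_zeta_converges (Omega_power \<omega> j)} \<inter> {\<omega> \<in> torus. random_zeta_converges (Omega_power \<omega> k)}"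
  have G: "G \<in> sets M" unfolding G_def using random_zeta_converges_measurable by (intro sets.Int)
  have z: "(\<lambda>s\<in>strip. 0) \<in> analytic_functions strip" by (intro analytic_functionsI open_strip holomorphic_intros)
  define F where "F = (\<lambda>N \<omega>. if \<omega> \<in> G then zeta_diff_psum j k N \<omega> else (\<lambda>s\<in>strip. 0))"
  have eq: "zeta_diff_random j k \<omega> = (if \<omega> \<in> G then (\<lambda>s\<in>strip. random_zeta s (Omega_power \<omega> j) - random_zeta s (Omega_power \<omega> k)) else (\<lambda>s\<in>strip. 0))"
    if "\<omega> \<in> torus" for \<omega>
    using that by (auto simp: zeta_diff_random_def G_def)
  show ?thesis
  proof (rule hol_space_measurable_limit[OF open_strip, of F])
    show "F N \<in> measurable M (borel_of (hol_space strip))" for N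
      unfolding F_def using G z by (intro measurable_If_set zeta_diff_psum_measurable) (auto simp: topspace_hol_space)
    fix \<omega> assume "\<omega> \<in> space M"
    then have \<omega>: "\<omega> \<in> torus" by (simp add: space_M)
    show "zeta_diff_random j k \<omega> \<in> analytic_functions strip"
    proof (cases "\<omega> \<in> G")
      case True
      then show ?thesis unfolding eq[OF \<omega>]
        by (auto simp: G_def intro!: analytic_functionsI open_strip holomorphic_intros random_zeta_holomorphic)
    qed (simp add: eq[OF \<omega>] z)
    fix C assume C: "compact C" "C \<subseteq> strip"
    show "uniform_limit C (\<lambda>N. F N \<omega>) (zeta_diff_random j k \<omega>) sequentially"
    proof (cases "\<omega> \<in> G")
      case True
      then have "uniform_limit C (\<lambda>N s. zeta_psum N (Omega_power \<omega> j) s - zeta_psum N (Omega_power \<omega> k) s)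
          (\<lambda>s. random_zeta s (Omega_power \<omega> j) - random_zeta s (Omega_power \<omega> k)) sequentially"
        by (intro uniform_limit_minus zeta_psum_uniform_limit C) (auto simp: G_def)
      then show ?thesis
        by (rule uniform_limit_cong'[THEN iffD1, rotated -1]) (use True C eq[OF \<omega>] in \<open>auto simp: F_def zeta_diff_psum_def\<close>)
    next
      case False
      then show ?thesis using eq[OF \<omega>] by (simp add: F_def uniform_limit_const)
    qed
  qed
qed

text \<open>By orthogonality each of the two blocks has second moment at most
  \<open>tail_sum a N\<close>. Bounding the square of their difference costs a factor 2 per block,
  which gives the 4.\<close>

lemma zeta_diff_psum_moment:
  assumes "j \<noteq> 0" "k \<noteq> 0" "1/2 < a" "a \<le> Re z" "z \<in> strip" "N \<le> N'"
  shows "(\<integral>\<^sup>+\<omega>. ennreal ((norm (zeta_diff_psum j k N' \<omega> z - zeta_diff_psum j k N \<omega> z))\<^sup>2) \<partial>M) \<le> ennreal (4 * tail_sum a N)"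
proof -
  let ?S = "\<lambda>j \<omega>. \<Sum>n\<in>{N+1..N'}. Omega_ext (Omega_power \<omega> j) n * of_nat n powr (- z)"
  have split: "zeta_psum N' \<omega> z - zeta_psum N \<omega> z = (\<Sum>n\<in>{N+1..N'}. Omega_ext \<omega> n * of_nat n powr (- z))" for \<omega>
  proof -
    have "{1..N'} = {1..N} \<union> {N+1..N'}" using assms(6) by auto
    then have "zeta_psum N' \<omega> z = zeta_psum N \<omega> z + (\<Sum>n\<in>{N+1..N'}. random_zeta_term \<omega> n z)"
      unfolding zeta_psum_def by (metis Int_emptyI atLeastAtMost_iff finite_atLeastAtMost not_less_eq_eq Suc_eq_plus1 sum.union_disjoint)
    then show ?thesis by (simp add: random_zeta_term_def)
  qed
  have sm: "(\<integral>\<omega>. (norm (?S j \<omega>))\<^sup>2 \<partial>M) \<le> tail_sum a N" if "j \<noteq> 0" for j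
  proof -
    have "(\<integral>\<omega>. (norm (?S j \<omega>))\<^sup>2 \<partial>M) = (\<Sum>n\<in>{N+1..N'}. (norm ((of_nat n :: complex) powr (- z)))\<^sup>2)"
      using that by (intro second_moment) auto
    also have "\<dots> \<le> (\<Sum>n\<in>{N+1..N'}. real n powr (- 2 * a))"
    proof (intro sum_mono)
      fix n assume n: "n \<in> {N+1..N'}"
      then have "(norm ((of_nat n :: complex) powr (- z)))\<^sup>2 = real n powr (- 2 * Re z)"
        by (simp add: norm_nat_powr power2_eq_square powr_add[symmetric])
      also have "\<dots> \<le> real n powr (- 2 * a)" using n assms by (intro powr_mono) auto
      finally show "(norm ((of_nat n :: complex) powr (- z)))\<^sup>2 \<le> real n powr (- 2 * a)" .
    qed
    also have "\<dots> = (\<Sum>n<N'-N. real (n + (N + 1)) powr (- 2 * a))"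
      by (rule sum.reindex_bij_witness[of _ "\<lambda>n. n + (N + 1)" "\<lambda>n. n - (N + 1)"]) auto
    also have "\<dots> \<le> tail_sum a N"
      unfolding tail_sum_def using assms by (intro sum_le_suminf summable_shift_powr) auto
    finally show ?thesis .
  qed
  have int: "integrable M (\<lambda>\<omega>. (norm (?S j \<omega>))\<^sup>2)" for j
    by (intro integrable_continuous continuous_on_power continuous_on_norm continuous_on_sum continuous_on_mult
        continuous_on_Omega_ext_power continuous_on_const)
  have "(\<integral>\<^sup>+\<omega>. ennreal ((norm (zeta_diff_psum j k N' \<omega> z - zeta_diff_psum j k N \<omega> z))\<^sup>2) \<partial>M)
     \<le> (\<integral>\<^sup>+\<omega>. ennreal (2 * (norm (?S j \<omega>))\<^sup>2 + 2 * (norm (?S k \<omega>))\<^sup>2) \<partial>M)"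
  proof (intro nn_integral_mono ennreal_leI)
    fix \<omega>
    have "zeta_diff_psum j k N' \<omega> z - zeta_diff_psum j k N \<omega> z = ?S j \<omega> - ?S k \<omega>"
      using assms(5) split[of "Omega_power \<omega> j"] split[of "Omega_power \<omega> k"] by (simp add: zeta_diff_psum_def algebra_simps)
    then show "(norm (zeta_diff_psum j k N' \<omega> z - zeta_diff_psum j k N \<omega> z))\<^sup>2 \<le> 2 * (norm (?S j \<omega>))\<^sup>2 + 2 * (norm (?S k \<omega>))\<^sup>2"
      by (simp only: norm_diff_square_le)
  qed
  also have "\<dots> = ennreal (\<integral>\<omega>. 2 * (norm (?S j \<omega>))\<^sup>2 + 2 * (norm (?S k \<omega>))\<^sup>2 \<partial>M)"
    using int by (intro nn_integral_eq_integral) auto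
  also have "(\<integral>\<omega>. 2 * (norm (?S j \<omega>))\<^sup>2 + 2 * (norm (?S k \<omega>))\<^sup>2 \<partial>M) = 2 * (\<integral>\<omega>. (norm (?S j \<omega>))\<^sup>2 \<partial>M) + 2 * (\<integral>\<omega>. (norm (?S k \<omega>))\<^sup>2 \<partial>M)"
    using int by simp
  also have "ennreal (2 * (\<integral>\<omega>. (norm (?S j \<omega>))\<^sup>2 \<partial>M) + 2 * (\<integral>\<omega>. (norm (?S k \<omega>))\<^sup>2 \<partial>M)) \<le> ennreal (4 * tail_sum a N)"
    using sm[OF assms(1)] sm[OF assms(2)] by (intro ennreal_leI) linarith
  finally show ?thesis .
qed

text \<open>Fatou's lemma: the bound for the blocks from N to N' is uniform in N', and the partial
  sums converge almost surely at z.\<close>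

lemma zeta_diff_random_moment:
  assumes "j \<noteq> 0" "k \<noteq> 0" "1/2 < a" "a \<le> Re z" "z \<in> strip"
  shows "(\<integral>\<^sup>+\<omega>. ennreal ((norm (zeta_diff_random j k \<omega> z - zeta_diff_psum j k N \<omega> z))\<^sup>2) \<partial>M) \<le> ennreal (4 * tail_sum a N)"
proof -
  let ?u = "\<lambda>N' \<omega>. ennreal ((norm (zeta_diff_psum j k N' \<omega> z - zeta_diff_psum j k N \<omega> z))\<^sup>2)"
  have ev: "(\<lambda>\<omega>. zeta_diff_psum j k N' \<omega> z) \<in> borel_measurable M" for N'
    by (rule measurable_compose[OF zeta_diff_psum_measurable borel_measurable_continuous_map[OF continuous_map_eval[OF assms(5)]]])
  have "AE \<omega> in M. random_zeta_converges (Omega_power \<omega> j) \<and> random_zeta_converges (Omega_power \<omega> k)"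
    using AE_random_zeta_converges[OF assms(1)] AE_random_zeta_converges[OF assms(2)] by eventually_elim auto
  then have "AE \<omega> in M. ennreal ((norm (zeta_diff_random j k \<omega> z - zeta_diff_psum j k N \<omega> z))\<^sup>2) = liminf (\<lambda>N'. ?u N' \<omega>)"
  proof eventually_elim
    case (elim \<omega>)
    then have "(\<lambda>N'. zeta_psum N' (Omega_power \<omega> j) z - zeta_psum N' (Omega_power \<omega> k) z) \<longlonglongrightarrow> random_zeta z (Omega_power \<omega> j) - random_zeta z (Omega_power \<omega> k)"
      using assms(5) by (intro tendsto_diff zeta_psum_tendsto) auto
    then have "(\<lambda>N'. zeta_diff_psum j k N' \<omega> z) \<longlonglongrightarrow> zeta_diff_random j k \<omega> z"
      using elim assms(5) by (simp add: zeta_diff_psum_def zeta_diff_random_def)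
    then have "(\<lambda>N'. ?u N' \<omega>) \<longlonglongrightarrow> ennreal ((norm (zeta_diff_random j k \<omega> z - zeta_diff_psum j k N \<omega> z))\<^sup>2)"
      by (intro tendsto_ennrealI tendsto_power tendsto_norm tendsto_diff tendsto_const)
    then show ?case by (rule lim_imp_Liminf[OF sequentially_bot, symmetric])
  qed
  then have "(\<integral>\<^sup>+\<omega>. ennreal ((norm (zeta_diff_random j k \<omega> z - zeta_diff_psum j k N \<omega> z))\<^sup>2) \<partial>M) = (\<integral>\<^sup>+\<omega>. liminf (\<lambda>N'. ?u N' \<omega>) \<partial>M)"
    by (rule nn_integral_cong_AE)
  also have "\<dots> \<le> liminf (\<lambda>N'. \<integral>\<^sup>+\<omega>. ?u N' \<omega> \<partial>M)"
    using ev by (intro nn_integral_liminf) measurable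
  also have "\<dots> \<le> ennreal (4 * tail_sum a N)"
  proof (rule Liminf_le)
    show "\<forall>\<^sub>F N' in sequentially. (\<integral>\<^sup>+\<omega>. ?u N' \<omega> \<partial>M) \<le> ennreal (4 * tail_sum a N)"
      using eventually_ge_at_top[of N] by eventually_elim (rule zeta_diff_psum_moment[OF assms])
  qed simp
  finally show ?thesis .
qed

end

section \<open>Vertical shifts of the zeta function\<close>

text \<open>The half-open range matches the mean square estimate with N0 = N + 1.\<close>

definition zeta_tail :: "nat \<Rightarrow> complex \<Rightarrow> complex" where
  "zeta_tail N s = riemann_zeta s - (\<Sum>n\<in>{1..<N+1}. of_nat n powr (- s))"

lemma continuous_on_zeta_tail: "continuous_on (- {1}) (zeta_tail N)"
  unfolding zeta_tail_def
  by (intro continuous_on_diff continuous_on_sum continuous_on_nat_powr continuous_intros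
      holomorphic_on_imp_continuous_on[OF riemann_zeta_properties(1)]) auto

text \<open>The substitution u = Im z + j\<tau> turns the mean over \<tau> into a mean square on a
  vertical line. The symmetric interval of the mean square estimate admits either sign of j.\<close>

lemma zeta_tail_shift_moment:
  assumes ab: "1/2 < a" "a \<le> b" "b < 1"
  shows "\<exists>C \<kappa>. C \<ge> 0 \<and> \<kappa> < 0 \<and> (\<forall>j z Y T N. j \<noteq> 0 \<longrightarrow> a \<le> Re z \<longrightarrow> Re z \<le> b \<longrightarrow> \<bar>Im z\<bar> \<le> Y \<longrightarrow> T \<ge> 1 \<longrightarrow> real (N + 1) \<le> T \<longrightarrow>
    (\<integral>\<^sup>+\<tau>. ennreal ((norm (zeta_tail N (z + \<i> * of_int j * of_real \<tau>)))\<^sup>2) \<partial>uniform_measure lborel {0..T})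
      \<le> ennreal (C * (\<bar>of_int j\<bar> + Y) * (tail_sum a N + T powr \<kappa>)))"
proof (rule zeta_mean_square[OF ab])
  fix C \<kappa> :: real
  assume C: "C \<ge> 0" and \<kappa>: "\<kappa> < 1" and ms: "\<And>\<sigma> T N0. a \<le> \<sigma> \<Longrightarrow> \<sigma> \<le> b \<Longrightarrow> T \<ge> 1 \<Longrightarrow> N0 \<ge> 1 \<Longrightarrow> real N0 \<le> T \<Longrightarrow>
    integral {-T..T} (\<lambda>t. (norm (riemann_zeta (of_real \<sigma> + \<i> * of_real t)
        - (\<Sum>n\<in>{1..<N0}. of_nat n powr (- (of_real \<sigma> + \<i> * of_real t)))))\<^sup>2)
     \<le> C * (T * (\<Sum>n. real (n + N0) powr (- 2 * a)) + T powr \<kappa>)"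
  have "(\<integral>\<^sup>+\<tau>. ennreal ((norm (zeta_tail N (z + \<i> * of_int j * of_real \<tau>)))\<^sup>2) \<partial>uniform_measure lborel {0..T})
      \<le> ennreal (C * (\<bar>of_int j\<bar> + Y) * (tail_sum a N + T powr (\<kappa> - 1)))"
    if j: "j \<noteq> 0" and z: "a \<le> Re z" "Re z \<le> b" "\<bar>Im z\<bar> \<le> Y" and T: "T \<ge> 1" "real (N + 1) \<le> T" for j z Y T N
  proof -
    define J where "J = real_of_int j"
    have "\<bar>j\<bar> \<ge> 1" using j by linarith
    then have J: "\<bar>J\<bar> \<ge> 1" unfolding J_def by linarith
    \<comment> \<open>The interval [-T', T'] contains Im z + j\<tau> for all \<tau> in
      [0,T].\<close>
    define T' where "T' = \<bar>J\<bar> * T + Y"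
    have "T \<le> \<bar>J\<bar> * T" using J T by simp
    then have T': "T' \<ge> T" using z(3) unfolding T'_def by linarith
    define f where "f = (\<lambda>u. (norm (zeta_tail N (of_real (Re z) + \<i> * of_real u)))\<^sup>2)"
    have contf: "continuous_on UNIV f"
      unfolding f_def
    proof (intro continuous_on_power continuous_on_norm)
      show "continuous_on UNIV (\<lambda>u. zeta_tail N (of_real (Re z) + \<i> * of_real u))"
        by (rule continuous_on_compose2[OF continuous_on_zeta_tail])
           (use z ab in \<open>auto intro!: continuous_intros simp: complex_eq_iff\<close>)
    qed
    have [measurable]: "f \<in> borel_measurable borel" by (rule borel_measurable_continuous_onI[OF contf])
    have eq: "(norm (zeta_tail N (z + \<i> * of_int j * of_real \<tau>)))\<^sup>2 = f (Im z + J * \<tau>)" for \<tau>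
    proof -
      have "z + \<i> * of_int j * of_real \<tau> = of_real (Re z) + \<i> * of_real (Im z + J * \<tau>)"
        by (simp add: complex_eq_iff J_def)
      then show ?thesis by (simp only: f_def)
    qed
    let ?g = "\<lambda>u. ennreal (f u) * indicator {-T'..T'} u"
    have "(\<integral>\<^sup>+\<tau>. ennreal (f (Im z + J * \<tau>)) * indicator {0..T} \<tau> \<partial>lborel) \<le> (\<integral>\<^sup>+\<tau>. ?g (Im z + J * \<tau>) \<partial>lborel)"
    proof (intro nn_integral_mono)
      fix \<tau> :: real
      have "\<bar>Im z + J * \<tau>\<bar> \<le> T'" if "\<tau> \<in> {0..T}"
      proof -
        have "\<bar>J * \<tau>\<bar> \<le> \<bar>J\<bar> * T" using that by (auto simp: abs_mult intro!: mult_left_mono)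
        then show ?thesis using z(3) unfolding T'_def by linarith
      qed
      then show "ennreal (f (Im z + J * \<tau>)) * indicator {0..T} \<tau> \<le> ?g (Im z + J * \<tau>)"
        by (auto simp: indicator_def abs_le_iff)
    qed
    \<comment> \<open>The factor 1 is enlarged to |j|, which is exactly the Jacobian of the
      substitution.\<close>
    also have "\<dots> = 1 * (\<integral>\<^sup>+\<tau>. ?g (Im z + J * \<tau>) \<partial>lborel)" by simp
    also have "\<dots> \<le> ennreal \<bar>J\<bar> * (\<integral>\<^sup>+\<tau>. ?g (Im z + J * \<tau>) \<partial>lborel)"
      using J by (intro mult_right_mono) (simp_all flip: ennreal_1 add: ennreal_leI)
    also have "\<dots> = (\<integral>\<^sup>+u. ?g u \<partial>lborel)"
      using J by (intro nn_integral_real_affine[symmetric]) auto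
    also have "\<dots> = ennreal (integral {-T'..T'} f)"
      by (intro nn_integral_interval continuous_on_subset[OF contf]) (auto simp: f_def)
    also have "integral {-T'..T'} f \<le> C * (T' * tail_sum a N + T' powr \<kappa>)"
      unfolding f_def zeta_tail_def tail_sum_def using ms[of "Re z" T' "N + 1"] z T T' by simp
    finally have 1: "(\<integral>\<^sup>+\<tau>. ennreal (f (Im z + J * \<tau>)) * indicator {0..T} \<tau> \<partial>lborel) \<le> ennreal (C * (T' * tail_sum a N + T' powr \<kappa>))"
      by (simp add: ennreal_leI)
    have "(\<integral>\<^sup>+\<tau>. ennreal ((norm (zeta_tail N (z + \<i> * of_int j * of_real \<tau>)))\<^sup>2) \<partial>uniform_measure lborel {0..T})
       = (\<integral>\<^sup>+\<tau>. ennreal (f (Im z + J * \<tau>)) * indicator {0..T} \<tau> \<partial>lborel) / emeasure lborel {0..T}"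
      unfolding eq by (subst nn_integral_uniform_measure) auto
    also have "\<dots> \<le> ennreal (C * (T' * tail_sum a N + T' powr \<kappa>)) / ennreal T"
      using T by (auto intro!: divide_right_mono_ennreal 1)
    also have "\<dots> = ennreal (C * (T' * tail_sum a N + T' powr \<kappa>) / T)"
      using T T' C tail_sum_nonneg[OF ab(1), of N] by (intro divide_ennreal) auto
    also have "\<dots> \<le> ennreal (C * (\<bar>of_int j\<bar> + Y) * (tail_sum a N + T powr (\<kappa> - 1)))"
    proof (rule ennreal_leI)
      \<comment> \<open>One factor T' combines with the 1/T of the mean into a constant; the other
        has negative exponent and only grows when T' is replaced by T.\<close>
      have "T' powr \<kappa> = T' * T' powr (\<kappa> - 1)" using T T' by (simp add: powr_diff)
      also have "\<dots> \<le> T' * T powr (\<kappa> - 1)" using T T' \<kappa> by (intro mult_left_mono powr_mono2') auto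
      finally have "C * (T' * tail_sum a N + T' powr \<kappa>) / T \<le> C * (T' * tail_sum a N + T' * T powr (\<kappa> - 1)) / T"
        using C T by (intro divide_right_mono mult_left_mono) auto
      also have "\<dots> = C * (tail_sum a N + T powr (\<kappa> - 1)) * (T' / T)" by (simp add: algebra_simps add_divide_distrib)
      also have "\<dots> \<le> C * (tail_sum a N + T powr (\<kappa> - 1)) * (\<bar>of_int j\<bar> + Y)"
      proof (intro mult_left_mono mult_nonneg_nonneg add_nonneg_nonneg C tail_sum_nonneg ab(1))
        have "Y \<ge> 0" using z(3) by linarith
        then have "Y \<le> Y * T" using T mult_left_mono[of 1 T Y] by simp
        then show "T' / T \<le> \<bar>of_int j\<bar> + Y" using T by (simp add: T'_def J_def field_simps)
      qed auto
      finally show "C * (T' * tail_sum a N + T' powr \<kappa>) / T \<le> C * (\<bar>of_int j\<bar> + Y) * (tail_sum a N + T powr (\<kappa> - 1))"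
        by (simp add: mult_ac)
    qed
    finally show ?thesis .
  qed
  then show ?thesis using C \<kappa> by (intro exI[of _ C] exI[of _ "\<kappa> - 1"]) auto
qed

lemma compact_strip_bounds:
  assumes "compact L" "L \<subseteq> strip"
  shows "\<exists>a b Y. 1/2 < a \<and> a \<le> b \<and> b < 1 \<and> Y \<ge> 0 \<and> (\<forall>z\<in>L. a \<le> Re z \<and> Re z \<le> b \<and> \<bar>Im z\<bar> \<le> Y)"
proof (cases "L = {}")
  case True
  then show ?thesis by (intro exI[of _ "3/4"] exI[of _ 0]) auto
next
  case False
  obtain x where x: "x \<in> L" "\<forall>z\<in>L. Re x \<le> Re z"
    using continuous_attains_inf[OF assms(1) False continuous_on_Re[OF continuous_on_id]] by auto
  obtain y where y: "y \<in> L" "\<forall>z\<in>L. Re z \<le> Re y"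
    using continuous_attains_sup[OF assms(1) False continuous_on_Re[OF continuous_on_id]] by auto
  obtain Y where Y: "\<forall>z\<in>L. norm z \<le> Y" using compact_imp_bounded[OF assms(1)] by (auto simp: bounded_iff)
  have "\<forall>z\<in>L. \<bar>Im z\<bar> \<le> Y" using Y abs_Im_le_cmod order_trans by blast
  moreover have "Y \<ge> 0" using Y x(1) norm_ge_zero order_trans by blast
  ultimately show ?thesis
    using x y assms(2) by (intro exI[of _ "Re x"] exI[of _ "Re y"] exI[of _ Y]) (auto simp: strip_def)
qed

lemma strip_shift_ne_1: "z \<in> strip \<Longrightarrow> z + \<i> * of_int j * of_real \<tau> \<noteq> 1"
  by (auto simp: strip_def complex_eq_iff)

lemma zeta_diff_shift_analytic: "zeta_diff_shift j k \<tau> \<in> analytic_functions strip"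
proof -
  have "(\<lambda>s. riemann_zeta (s + \<i> * of_int j * of_real \<tau>)) holomorphic_on strip" for j
  proof -
    have "(riemann_zeta \<circ> (\<lambda>s. s + \<i> * of_int j * of_real \<tau>)) holomorphic_on strip"
      by (rule holomorphic_on_compose_gen[OF _ riemann_zeta_properties(1)])
         (use strip_shift_ne_1 in \<open>auto intro!: holomorphic_intros\<close>)
    then show ?thesis by (simp add: o_def)
  qed
  then show ?thesis unfolding zeta_diff_shift_def by (intro analytic_functionsI open_strip holomorphic_on_diff)
qed

lemma zeta_diff_shift_continuous: "continuous_map euclideanreal (hol_space strip) (zeta_diff_shift j k)"
proof -
  have c: "continuous_on (UNIV \<times> strip) (\<lambda>x. riemann_zeta (snd x + \<i> * of_int j * of_real (fst x)))" for j
    by (rule continuous_on_compose2[OF holomorphic_on_imp_continuous_on[OF riemann_zeta_properties(1)]])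
       (use strip_shift_ne_1 in \<open>auto intro!: continuous_intros\<close>)
  have "continuous_on (UNIV \<times> strip) (\<lambda>x. riemann_zeta (snd x + \<i> * of_int j * of_real (fst x)) - riemann_zeta (snd x + \<i> * of_int k * of_real (fst x)))"
    by (intro continuous_on_diff c)
  then have "continuous_on (UNIV \<times> strip) (\<lambda>(\<tau>, s). zeta_diff_shift j k \<tau> s)"
    by (rule continuous_on_cong[THEN iffD1, rotated -1]) (auto simp: zeta_diff_shift_def)
  from continuous_map_into_hol_space[OF this zeta_diff_shift_analytic] show ?thesis by simp
qed

lemma sets_borel_of_euclidean: "sets (borel_of euclidean) = sets borel"
  by (simp add: sets_borel_of borel_def)

lemma zeta_diff_shift_measurable:
  "zeta_diff_shift j k \<in> measurable (uniform_measure lborel {0..T}) (borel_of (hol_space strip))"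
  by (rule measurable_continuous_map[OF zeta_diff_shift_continuous]) (simp add: sets_borel_of_euclidean)

lemma zeta_diff_psum_line_continuous:
  "continuous_map euclideanreal (hol_space strip) (\<lambda>\<tau>. zeta_diff_psum j k N (torus_line \<tau>))"
proof -
  have "continuous_map euclideanreal (top_of_set torus) torus_line"
    using continuous_on_torus_line torus_line_torus by (auto simp: continuous_map_in_subtopology)
  from continuous_map_compose[OF this zeta_diff_psum_continuous] show ?thesis by (simp add: o_def)
qed

lemma zeta_diff_psum_line_measurable:
  "(\<lambda>\<tau>. zeta_diff_psum j k N (torus_line \<tau>)) \<in> measurable (uniform_measure lborel {0..T}) (borel_of (hol_space strip))"
  by (rule measurable_continuous_map[OF zeta_diff_psum_line_continuous]) (simp add: sets_borel_of_euclidean)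

text \<open>At a point of the line the random coefficients are n^(-ij\<tau>), so the random partial
  sum is the partial sum of the Dirichlet series at the shifted argument and only the zeta tails are
  left.\<close>

lemma zeta_diff_shift_minus_psum:
  assumes "z \<in> strip"
  shows "zeta_diff_shift j k \<tau> z - zeta_diff_psum j k N (torus_line \<tau>) z =
     zeta_tail N (z + \<i> * of_int j * of_real \<tau>) - zeta_tail N (z + \<i> * of_int k * of_real \<tau>)"
proof -
  have "zeta_psum N (Omega_power (torus_line \<tau>) j) z = (\<Sum>n\<in>{1..<N+1}. of_nat n powr (- (z + \<i> * of_int j * of_real \<tau>)))" for j
    unfolding zeta_psum_def random_zeta_term_def torus_line_power
  proof (intro sum.cong)
    fix n assume "n \<in> {1..<N+1}"
    then have "Omega_ext (torus_line (of_int j * \<tau>)) n * of_nat n powr (- z) = of_nat n powr (- (\<i> * of_real (of_int j * \<tau>))) * of_nat n powr (- z)"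
      by (simp add: Omega_ext_torus_line)
    also have "\<dots> = of_nat n powr (- (\<i> * of_real (of_int j * \<tau>)) + - z)" by (rule powr_add[symmetric])
    also have "- (\<i> * of_real (of_int j * \<tau>)) + - z = - (z + \<i> * of_int j * of_real \<tau>)" by simp
    finally show "Omega_ext (torus_line (of_int j * \<tau>)) n * of_nat n powr (- z) = of_nat n powr (- (z + \<i> * of_int j * of_real \<tau>))" .
  qed auto
  then show ?thesis using assms by (simp add: zeta_diff_shift_def zeta_diff_psum_def zeta_tail_def)
qed

lemma zeta_diff_shift_moment:
  assumes jk: "j \<noteq> 0" "k \<noteq> 0" and L: "compact L" "L \<subseteq> strip"
  shows "\<exists>C a \<kappa>. C \<ge> 4 \<and> 1/2 < a \<and> \<kappa> < 0 \<and> (\<forall>z\<in>L. a \<le> Re z) \<and> (\<forall>N T z. T \<ge> 1 \<longrightarrow> real (N + 1) \<le> T \<longrightarrow> z \<in> L \<longrightarrow>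
    (\<integral>\<^sup>+\<tau>. ennreal ((norm (zeta_diff_shift j k \<tau> z - zeta_diff_psum j k N (torus_line \<tau>) z))\<^sup>2) \<partial>uniform_measure lborel {0..T})
      \<le> ennreal (C * (tail_sum a N + T powr \<kappa>)))"
proof -
  obtain a b Y where ab: "1/2 < a" "a \<le> b" "b < 1" "Y \<ge> 0" and LL: "\<And>z. z \<in> L \<Longrightarrow> a \<le> Re z \<and> Re z \<le> b \<and> \<bar>Im z\<bar> \<le> Y"
    using compact_strip_bounds[OF L] by blast
  obtain C \<kappa> where C: "C \<ge> 0" "\<kappa> < 0" and mom: "\<And>j z Y T N. j \<noteq> 0 \<Longrightarrow> a \<le> Re z \<Longrightarrow> Re z \<le> b \<Longrightarrow> \<bar>Im z\<bar> \<le> Y \<Longrightarrow> T \<ge> 1 \<Longrightarrow> real (N + 1) \<le> T \<Longrightarrow>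
    (\<integral>\<^sup>+\<tau>. ennreal ((norm (zeta_tail N (z + \<i> * of_int j * of_real \<tau>)))\<^sup>2) \<partial>uniform_measure lborel {0..T})
      \<le> ennreal (C * (\<bar>of_int j\<bar> + Y) * (tail_sum a N + T powr \<kappa>))"
    using zeta_tail_shift_moment[OF ab(1-3)] by auto
  \<comment> \<open>The extra 4 lets the same constant bound the random tail, whose moment estimate
    has the factor 4.\<close>
  define C' where "C' = 2 * (C * (\<bar>of_int j\<bar> + Y)) + 2 * (C * (\<bar>of_int k\<bar> + Y)) + 4"
  have "(\<integral>\<^sup>+\<tau>. ennreal ((norm (zeta_diff_shift j k \<tau> z - zeta_diff_psum j k N (torus_line \<tau>) z))\<^sup>2) \<partial>uniform_measure lborel {0..T})
      \<le> ennreal (C' * (tail_sum a N + T powr \<kappa>))" if T: "T \<ge> 1" "real (N + 1) \<le> T" and z: "z \<in> L" for N T z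
  proof -
    let ?f = "\<lambda>j \<tau>. zeta_tail N (z + \<i> * of_int j * of_real \<tau>)"
    have zs: "z \<in> strip" using z L by blast
    have [measurable]: "?f j \<in> borel_measurable borel" for j
      by (intro borel_measurable_continuous_onI continuous_on_compose2[OF continuous_on_zeta_tail])
         (use strip_shift_ne_1[OF zs] in \<open>auto intro!: continuous_intros\<close>)
    have t0: "tail_sum a N + T powr \<kappa> \<ge> 0" using tail_sum_nonneg[OF ab(1), of N] by simp
    have "(\<integral>\<^sup>+\<tau>. ennreal ((norm (zeta_diff_shift j k \<tau> z - zeta_diff_psum j k N (torus_line \<tau>) z))\<^sup>2) \<partial>uniform_measure lborel {0..T})
       \<le> (\<integral>\<^sup>+\<tau>. 2 * ennreal ((norm (?f j \<tau>))\<^sup>2) + 2 * ennreal ((norm (?f k \<tau>))\<^sup>2) \<partial>uniform_measure lborel {0..T})"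
    proof (intro nn_integral_mono)
      fix \<tau>
      have "ennreal ((norm (?f j \<tau> - ?f k \<tau>))\<^sup>2) \<le> ennreal (2 * (norm (?f j \<tau>))\<^sup>2 + 2 * (norm (?f k \<tau>))\<^sup>2)"
        by (intro ennreal_leI norm_diff_square_le)
      also have "\<dots> = 2 * ennreal ((norm (?f j \<tau>))\<^sup>2) + 2 * ennreal ((norm (?f k \<tau>))\<^sup>2)"
        by (simp add: ennreal_plus ennreal_mult')
      finally show "ennreal ((norm (zeta_diff_shift j k \<tau> z - zeta_diff_psum j k N (torus_line \<tau>) z))\<^sup>2) \<le> 2 * ennreal ((norm (?f j \<tau>))\<^sup>2) + 2 * ennreal ((norm (?f k \<tau>))\<^sup>2)"
        by (simp only: zeta_diff_shift_minus_psum[OF zs])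
    qed
    also have "\<dots> = 2 * (\<integral>\<^sup>+\<tau>. ennreal ((norm (?f j \<tau>))\<^sup>2) \<partial>uniform_measure lborel {0..T}) + 2 * (\<integral>\<^sup>+\<tau>. ennreal ((norm (?f k \<tau>))\<^sup>2) \<partial>uniform_measure lborel {0..T})"
      by (subst nn_integral_add) (auto simp: nn_integral_cmult)
    also have "\<dots> \<le> 2 * ennreal (C * (\<bar>of_int j\<bar> + Y) * (tail_sum a N + T powr \<kappa>)) + 2 * ennreal (C * (\<bar>of_int k\<bar> + Y) * (tail_sum a N + T powr \<kappa>))"
      using LL[OF z] by (intro add_mono mult_left_mono mom jk T) auto
    also have "\<dots> = ennreal (2 * (C * (\<bar>of_int j\<bar> + Y) * (tail_sum a N + T powr \<kappa>)) + 2 * (C * (\<bar>of_int k\<bar> + Y) * (tail_sum a N + T powr \<kappa>)))"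
      using C ab(4) t0 by (simp add: ennreal_plus ennreal_mult')
    also have "\<dots> \<le> ennreal (C' * (tail_sum a N + T powr \<kappa>))"
      using t0 by (intro ennreal_leI) (simp add: C'_def algebra_simps)
    finally show ?thesis .
  qed
  moreover have "C' \<ge> 4" using C ab(4) by (simp add: C'_def)
  ultimately show ?thesis using ab C LL by (intro exI[of _ C'] exI[of _ a] exI[of _ \<kappa>]) auto
qed

text \<open>For a fixed g three comparisons are chained: shift against partial sum along the line,
  time mean against Haar mean of the partial sum, partial sum against random function. The order of
  choices matters: the bounds \<open>R\<close> fix n and \<delta>, these fix N, and T comes
  last.\<close>

theorem theorem2p7:
  fixes j k :: int and m\<^sub>H :: "(nat \<Rightarrow> complex) measure"
  assumes "coprime j k" and "j \<noteq> 0" and "k \<noteq> 0"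
    and "Omega_haar_prob m\<^sub>H"
  shows "weakly_converges (hol_space strip) (P_T j k) (P_lim m\<^sub>H j k) at_top"
  unfolding weakly_converges_def
proof (intro allI impI)
  fix g assume "continuous_map (hol_space strip) euclideanreal g \<and> bounded (g ` topspace (hol_space strip))"
  then have g: "continuous_map (hol_space strip) euclideanreal g" and gb: "bounded (g ` analytic_functions strip)"
    by (auto simp: topspace_hol_space)
  interpret haar_torus m\<^sub>H by unfold_locales fact
  have gm: "g \<in> borel_measurable (borel_of (hol_space strip))" by (rule borel_measurable_continuous_map[OF g])
  obtain B where B: "B > 0" "\<And>f. f \<in> analytic_functions strip \<Longrightarrow> \<bar>g f\<bar> \<le> B"
    using gb unfolding bounded_pos by auto
  obtain K where K: "\<And>n. compact (K n)" "\<And>n. K n \<subseteq> strip"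
    and Kex: "\<And>C. compact C \<Longrightarrow> C \<subseteq> strip \<Longrightarrow> \<exists>N::nat. \<forall>n\<ge>N. C \<subseteq> K n"
    using compact_exhaustion[OF open_strip] by metis
  obtain P where P: "\<And>l. disc_cover strip (K l) (P l)" using disc_cover_exists[OF open_strip K] by metis
  \<comment> \<open>The outer circles, where second moments are evaluated. Their compactness gives
    constants uniform over each \<open>L l\<close>.\<close>
  define L where "L = (\<lambda>l. \<Union>(c, r)\<in>P l. sphere c (2 * r))"
  have L: "compact (L l)" "L l \<subseteq> strip" for l
  proof -
    show "compact (L l)" unfolding L_def using P[of l] by (intro compact_UN) (auto simp: disc_cover_def)
    show "L l \<subseteq> strip" unfolding L_def using P[of l] sphere_cball by (fastforce simp: disc_cover_def)
  qed
  have inL: "z \<in> L l" if "(c, r) \<in> P l" "z \<in> sphere c (2 * r)" for c r z l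
    unfolding L_def by (rule UN_I[OF that(1)]) (use that(2) in simp)
  \<comment> \<open>The constants depend on l, because the exhaustion comes arbitrarily close to the
    boundary lines of the strip.\<close>
  have "\<forall>l. \<exists>C a \<kappa>. 4 \<le> C \<and> 1/2 < a \<and> \<kappa> < 0 \<and> (\<forall>z\<in>L l. a \<le> Re z) \<and> (\<forall>N T z. T \<ge> 1 \<longrightarrow> real (N + 1) \<le> T \<longrightarrow> z \<in> L l \<longrightarrow>
    (\<integral>\<^sup>+\<tau>. ennreal ((norm (zeta_diff_shift j k \<tau> z - zeta_diff_psum j k N (torus_line \<tau>) z))\<^sup>2) \<partial>uniform_measure lborel {0..T})
      \<le> ennreal (C * (tail_sum (a) N + T powr \<kappa>)))"
    by (intro allI zeta_diff_shift_moment[OF assms(2,3) L])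
  then have "\<exists>C a \<kappa>. \<forall>l. 4 \<le> C l \<and> 1/2 < a l \<and> \<kappa> l < 0 \<and> (\<forall>z\<in>L l. a l \<le> Re z) \<and> (\<forall>N T z. T \<ge> 1 \<longrightarrow> real (N + 1) \<le> T \<longrightarrow> z \<in> L l \<longrightarrow>
    (\<integral>\<^sup>+\<tau>. ennreal ((norm (zeta_diff_shift j k \<tau> z - zeta_diff_psum j k N (torus_line \<tau>) z))\<^sup>2) \<partial>uniform_measure lborel {0..T})
      \<le> ennreal (C l * (tail_sum (a l) N + T powr \<kappa> l)))"
    by (simp only: choice_iff)
  then obtain C a \<kappa> where CC: "\<forall>l. 4 \<le> C l \<and> 1/2 < a l \<and> \<kappa> l < 0 \<and> (\<forall>z\<in>L l. a l \<le> Re z) \<and> (\<forall>N T z. T \<ge> 1 \<longrightarrow> real (N + 1) \<le> T \<longrightarrow> z \<in> L l \<longrightarrow>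
    (\<integral>\<^sup>+\<tau>. ennreal ((norm (zeta_diff_shift j k \<tau> z - zeta_diff_psum j k N (torus_line \<tau>) z))\<^sup>2) \<partial>uniform_measure lborel {0..T})
      \<le> ennreal (C l * (tail_sum (a l) N + T powr \<kappa> l)))"
    by (elim exE)
  have C: "C l \<ge> 4" and a: "1/2 < a l" and \<kappa>: "\<kappa> l < 0" and aL: "z \<in> L l \<Longrightarrow> a l \<le> Re z" for l z
    using CC[rule_format, of l] by simp_all
  have shift_mom: "(\<integral>\<^sup>+\<tau>. ennreal ((norm (zeta_diff_shift j k \<tau> z - zeta_diff_psum j k N (torus_line \<tau>) z))\<^sup>2) \<partial>uniform_measure lborel {0..T})
      \<le> ennreal (C l * (tail_sum (a l) N + T powr \<kappa> l))" if "T \<ge> 1" "real (N + 1) \<le> T" "z \<in> L l" for l N T z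
    using CC that by simp
  have rand_mom: "(\<integral>\<^sup>+\<omega>. ennreal ((norm (zeta_diff_random j k \<omega> z - zeta_diff_psum j k N \<omega> z))\<^sup>2) \<partial>m\<^sub>H) \<le> ennreal (C l * tail_sum (a l) N)"
    if "z \<in> L l" for l z N
  proof -
    have "(\<integral>\<^sup>+\<omega>. ennreal ((norm (zeta_diff_random j k \<omega> z - zeta_diff_psum j k N \<omega> z))\<^sup>2) \<partial>m\<^sub>H) \<le> ennreal (4 * tail_sum (a l) N)"
      using that L aL a assms(2,3) by (intro zeta_diff_random_moment) auto
    also have "\<dots> \<le> ennreal (C l * tail_sum (a l) N)" using C tail_sum_nonneg[OF a] by (intro ennreal_leI mult_right_mono) auto
    finally show ?thesis .
  qed
  have psum0: "zeta_diff_psum j k 0 \<omega> z = 0" if "z \<in> strip" for \<omega> z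
    using that by (simp add: zeta_diff_psum_def zeta_psum_def)
  \<comment> \<open>The case N = 0, in which the partial sum vanishes, bounds the moments of the
    full functions; the 1 dominates T to the power \<open>\<kappa> l\<close> for every T \<ge>
    1.\<close>
  define b where "b = (\<lambda>l. C l * (tail_sum (a l) 0 + 1))"
  have b: "b l \<ge> 0" for l using C[of l] tail_sum_nonneg[OF a[of l], of 0] by (simp add: b_def)
  have int_T: "(\<integral>x. g x \<partial>P_T j k T) = (\<integral>\<tau>. g (zeta_diff_shift j k \<tau>) \<partial>uniform_measure lborel {0..T})" for T
    unfolding P_T_def by (rule integral_distr[OF zeta_diff_shift_measurable gm])
  have int_lim: "(\<integral>x. g x \<partial>P_lim m\<^sub>H j k) = (\<integral>\<omega>. g (zeta_diff_random j k \<omega>) \<partial>m\<^sub>H)"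
    unfolding P_lim_def by (rule integral_distr[OF zeta_diff_random_measurable gm])
  show "((\<lambda>T. \<integral>x. g x \<partial>P_T j k T) \<longlongrightarrow> (\<integral>x. g x \<partial>P_lim m\<^sub>H j k)) at_top"
  proof (rule tendstoI)
    fix e :: real assume e: "e > 0"
    \<comment> \<open>Then 4 B \<eta> = e/8, so each of the two tail comparisons costs e/4; with e/4
      for equidistribution the total stays below e.\<close>
    define \<eta> where "\<eta> = e / (32 * B)"
    have \<eta>: "\<eta> > 0" "4 * B * \<eta> = e / 8" using e B by (auto simp: \<eta>_def)
    \<comment> \<open>Solved from the Markov bound for probability \<eta>/2^(l+1). The summand 1
      keeps R positive when the square root is 0.\<close>
    define R where "R = (\<lambda>l. sqrt (2 * real (card (P l)) * b l * 2 ^ Suc l / \<eta>) + 1)"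
    have R0: "R l > 0" for l unfolding R_def using b[of l] \<eta> by (intro add_nonneg_pos) auto
    have R: "2 * real (card (P l)) * b l / (R l)\<^sup>2 \<le> \<eta> * (1/2) ^ Suc l" for l
    proof -
      define q where "q = 2 * real (card (P l)) * b l"
      have q: "q \<ge> 0" using b[of l] by (simp add: q_def)
      have "q * 2 ^ Suc l / \<eta> = (sqrt (q * 2 ^ Suc l / \<eta>))\<^sup>2" using q \<eta> by simp
      also have "\<dots> \<le> (R l)\<^sup>2" unfolding R_def q_def[symmetric] using q \<eta> by (intro power_mono) auto
      finally have "q \<le> \<eta> * (1/2) ^ Suc l * (R l)\<^sup>2" using \<eta> by (simp add: field_simps power_divide)
      then show ?thesis unfolding q_def[symmetric] using R0[of l] by (simp add: divide_le_eq)
    qed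
    have "\<exists>n \<delta>. \<delta> > 0 \<and> (\<forall>f\<in>analytic_functions strip. \<forall>h\<in>analytic_functions strip.
      (\<forall>l. \<forall>z\<in>K l. norm (f z) \<le> R l) \<longrightarrow> (\<forall>z\<in>K n. norm (f z - h z) < \<delta>) \<longrightarrow> \<bar>g f - g h\<bar> < e / 8)"
      using e by (intro hol_space_uniformly_continuous[OF open_strip g K Kex]) auto
    then obtain n \<delta> where \<delta>: "\<delta> > 0" and uc': "\<forall>f\<in>analytic_functions strip. \<forall>h\<in>analytic_functions strip.
      (\<forall>l. \<forall>z\<in>K l. norm (f z) \<le> R l) \<longrightarrow> (\<forall>z\<in>K n. norm (f z - h z) < \<delta>) \<longrightarrow> \<bar>g f - g h\<bar> < e / 8"
      by (elim exE conjE)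
    have uc: "\<bar>g f - g h\<bar> < e / 8" if "f \<in> analytic_functions strip" "h \<in> analytic_functions strip"
       "\<And>l z. z \<in> K l \<Longrightarrow> norm (f z) \<le> R l" "\<And>z. z \<in> K n \<Longrightarrow> norm (f z - h z) < \<delta>" for f h
      using uc' that by simp
    \<comment> \<open>The factor between second moments on the circles of \<open>P n\<close> and the
      probability of a deviation \<delta> on \<open>K n\<close>. Half of \<eta> is spent on the tail
      sum by the choice of N, half on T to the power \<open>\<kappa> n\<close> by the choice of
      T.\<close>
    define q where "q = 2 * real (card (P n)) / \<delta>\<^sup>2 * C n"
    have q0: "q \<ge> 0" using C[of n] by (simp add: q_def)
    have "(\<lambda>N. q * tail_sum (a n) N) \<longlonglongrightarrow> q * 0" by (intro tendsto_mult tendsto_const tail_sum_tendsto a)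
    then have "\<forall>\<^sub>F N in sequentially. q * tail_sum (a n) N < \<eta> / 2" using \<eta> by (intro order_tendstoD) auto
    then obtain N where N: "q * tail_sum (a n) N < \<eta> / 2" by (auto simp: eventually_sequentially)
    have tl: "tail_sum (a n) N \<ge> 0" by (rule tail_sum_nonneg[OF a])
    define h where "h = (\<lambda>\<omega>. g (zeta_diff_psum j k N \<omega>))"
    have hc: "continuous_on torus h"
      using continuous_map_compose[OF zeta_diff_psum_continuous g] by (simp add: h_def o_def)
    have rand_close: "\<bar>(\<integral>\<omega>. g (zeta_diff_random j k \<omega>) \<partial>m\<^sub>H) - (\<integral>\<omega>. h \<omega> \<partial>m\<^sub>H)\<bar> \<le> e / 8 + 4 * B * \<eta>"
      unfolding h_def
    proof (rule hol_expectation_close[OF prob_space_axioms open_strip zeta_diff_random_measurable zeta_diff_psum_measurable P _ b R0 R, where b' = "C n * tail_sum (a n) N"])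
      show "(\<integral>\<^sup>+\<omega>. ennreal ((norm (zeta_diff_random j k \<omega> z))\<^sup>2) \<partial>m\<^sub>H) \<le> ennreal (b l)" if "(c, r) \<in> P l" "z \<in> sphere c (2 * r)" for l c r z
      proof -
        have z: "z \<in> L l" "z \<in> strip" using inL[OF that] L(2) by auto
        have "(\<integral>\<^sup>+\<omega>. ennreal ((norm (zeta_diff_random j k \<omega> z))\<^sup>2) \<partial>m\<^sub>H) \<le> ennreal (C l * tail_sum (a l) 0)"
          using rand_mom[OF z(1), of 0] psum0[OF z(2)] by simp
        also have "\<dots> \<le> ennreal (b l)" unfolding b_def using C[of l] by (intro ennreal_leI mult_left_mono) auto
        finally show ?thesis .
      qed
      show "(\<integral>\<^sup>+\<omega>. ennreal ((norm (zeta_diff_random j k \<omega> z - zeta_diff_psum j k N \<omega> z))\<^sup>2) \<partial>m\<^sub>H) \<le> ennreal (C n * tail_sum (a n) N)"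
        if "(c, r) \<in> P n" "z \<in> sphere c (2 * r)" for c r z by (rule rand_mom[OF inL[OF that]])
      show "2 * real (card (P n)) * (C n * tail_sum (a n) N) / \<delta>\<^sup>2 \<le> \<eta>" using N \<eta> by (simp add: q_def)
      show "0 \<le> C n * tail_sum (a n) N" using C[of n] tl by simp
    qed (use \<delta> \<eta> e uc g B in auto)
    have "((\<lambda>T. q * T powr \<kappa> n) \<longlongrightarrow> q * 0) at_top"
      by (intro tendsto_mult tendsto_const tendsto_neg_powr \<kappa> filterlim_ident)
    then have "\<forall>\<^sub>F T in at_top. q * T powr \<kappa> n < \<eta> / 2" using \<eta> by (intro order_tendstoD) auto
    moreover have "\<forall>\<^sub>F T in at_top. dist (\<integral>t. h (torus_line t) \<partial>uniform_measure lborel {0..T}) (\<integral>\<omega>. h \<omega> \<partial>m\<^sub>H) < e / 4"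
      using tendstoD[OF torus_line_equidistributed[OF hc], of "e / 4"] e by simp
    ultimately show "\<forall>\<^sub>F T in at_top. dist (\<integral>x. g x \<partial>P_T j k T) (\<integral>x. g x \<partial>P_lim m\<^sub>H j k) < e"
      using eventually_ge_at_top[of "real (N + 1)"]
    proof eventually_elim
      case (elim T)
      have T1: "T \<ge> 1" using elim(3) by simp
      interpret U: prob_space "uniform_measure lborel {0..T}" using T1 by (intro prob_space_uniform_interval) simp
      have "\<bar>(\<integral>\<tau>. g (zeta_diff_shift j k \<tau>) \<partial>uniform_measure lborel {0..T}) - (\<integral>\<tau>. g (zeta_diff_psum j k N (torus_line \<tau>)) \<partial>uniform_measure lborel {0..T})\<bar> \<le> e / 8 + 4 * B * \<eta>"
      proof (rule hol_expectation_close[OF U.prob_space_axioms open_strip zeta_diff_shift_measurable zeta_diff_psum_line_measurable P _ b R0 R, where b' = "C n * (tail_sum (a n) N + T powr \<kappa> n)"])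
        show "(\<integral>\<^sup>+\<tau>. ennreal ((norm (zeta_diff_shift j k \<tau> z))\<^sup>2) \<partial>uniform_measure lborel {0..T}) \<le> ennreal (b l)" if "(c, r) \<in> P l" "z \<in> sphere c (2 * r)" for l c r z
        proof -
          have z: "z \<in> L l" "z \<in> strip" using inL[OF that] L(2) by auto
          have "(\<integral>\<^sup>+\<tau>. ennreal ((norm (zeta_diff_shift j k \<tau> z))\<^sup>2) \<partial>uniform_measure lborel {0..T}) \<le> ennreal (C l * (tail_sum (a l) 0 + T powr \<kappa> l))"
            using shift_mom[OF T1 _ z(1), of 0] psum0[OF z(2)] T1 by simp
          also have "\<dots> \<le> ennreal (b l)"
          proof -
            have "T powr \<kappa> l \<le> T powr 0" using T1 \<kappa>[of l] by (intro powr_mono) auto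
            then show ?thesis unfolding b_def using C[of l] T1 by (intro ennreal_leI mult_left_mono) auto
          qed
          finally show ?thesis .
        qed
        show "(\<integral>\<^sup>+\<tau>. ennreal ((norm (zeta_diff_shift j k \<tau> z - zeta_diff_psum j k N (torus_line \<tau>) z))\<^sup>2) \<partial>uniform_measure lborel {0..T}) \<le> ennreal (C n * (tail_sum (a n) N + T powr \<kappa> n))"
          if "(c, r) \<in> P n" "z \<in> sphere c (2 * r)" for c r z
          by (rule shift_mom[OF T1 elim(3) inL[OF that]])
        have "2 * real (card (P n)) * (C n * (tail_sum (a n) N + T powr \<kappa> n)) / \<delta>\<^sup>2 = q * tail_sum (a n) N + q * T powr \<kappa> n"
          by (simp add: q_def algebra_simps add_divide_distrib)
        then show "2 * real (card (P n)) * (C n * (tail_sum (a n) N + T powr \<kappa> n)) / \<delta>\<^sup>2 \<le> \<eta>" using N elim(1) by linarith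
        show "0 \<le> C n * (tail_sum (a n) N + T powr \<kappa> n)" using C[of n] tl by simp
      qed (use \<delta> \<eta> e uc g B in auto)
      moreover have "dist (\<integral>t. h (torus_line t) \<partial>uniform_measure lborel {0..T}) (\<integral>\<omega>. h \<omega> \<partial>m\<^sub>H) < e / 4" by (rule elim(2))
      ultimately show ?case
        using rand_close unfolding int_T int_lim \<eta>(2) dist_real_def h_def by linarith
    qed
  qed
qed

end
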